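(* Consider the contextual MNL bandit with uniform rewards ($r_{ti}=1$ for all $t,i$), arbitrary (adversarial) features with $\|x_{ti}\|_2\le1$, $\|\mathbf w^\star\|_2\le1$, and instance constant $\kappa>0$. Let $\delta\in(0,1]$. Then with probability at least $1-\delta$, the algorithm OFU-MNL+ described below satisfies $$\mathrm{Reg}_T(\mathbf w^\star)=\tilde O\Big(\frac{\sqrt{v_0K}}{v_0+K}\,d\sqrt T+\frac{d^2}{\kappa}\Big),$$ where $\tilde O$ hides an absolute multiplicative constant and factors polylogarithmic in $T$, $K$, $d$ and $1/\delta$.
   Context: Contextual MNL bandit. Known $v_0>0$; $\mathcal S=\{S\subseteq[N]:|S|\le K\}$. At round $t$ the environment reveals $x_{ti}\in\mathbb R^d$ with $\|x_{ti}\|_2\le 1$ and $r_{ti}\in[0,1]$ for $i\in[N]$ (possibly adversarially); the learner picks $S_t\in\mathcal S$ and observes a one-hot $(y_{ti})_{i\in S_t\cup\{0\}}$ with $\Pr(y_{ti}=1)=p_t(i\mid S_t,\mathbf w^\star)$, where $p_t(i\mid S,\mathbf w)=\frac{\exp(x_{ti}^\top\mathbf w)}{v_0+\sum_{j\in S}\exp(x_{tj}^\top\mathbf w)}$ ($i\in S$), $p_t(0\mid S,\mathbf w)=\frac{v_0}{v_0+\sum_{j\in S}\exp(x_{tj}^\top\mathbf w)}$. $R_t(S,\mathbf w)=\sum_{i\in S}p_t(i\mid S,\mathbf w)r_{ti}$, $S_t^\star\in\arg\max_{S}R_t(S,\mathbf w^\star)$, $\mathrm{Reg}_T(\mathbf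 w^\star)=\sum_{t=1}^T(R_t(S_t^\star,\mathbf w^\star)-R_t(S_t,\mathbf w^\star))$. $\mathcal W=\{\mathbf w:\|\mathbf w\|_2\le1\}$; $\kappa>0$ satisfies $p_t(i\mid S,\mathbf w)p_t(0\mid S,\mathbf w)\ge\kappa$ for all $t$, $S\in\mathcal S$, $i\in S$, $\mathbf w\in\mathcal W$. Algorithm OFU-MNL+: $\eta=\tfrac12\log(K+1)+2$, $\lambda=84\sqrt2 d\eta$, $c=7\eta/6$, $\beta_t(\delta)=\frac{4\eta}{\lambda}+\sqrt{2\eta[11(3\log(1+(K+1)t)+3)\log(2\sqrt{1+2t}/\delta)+2+\sqrt6 c d\log(1+\frac{t+1}{2\lambda})]+4\lambda}$. Loss $\ell_t(\mathbf w)=-\sum_{i\in S_t\cup\{0\}}y_{ti}\log p_t(i\mid S_t,\mathbf w)$; $\mathcal G_t(\mathbf w)=\sum_{i\in S_t}p_t(i\mid S_t,\mathbf w)x_{ti}x_{ti}^\top-\sum_{i,j\in S_t}p_t(i\mid S_t,\mathbf w)p_t(j\mid S_t,\mathbf w)x_{ti}x_{tj}^\top$. Initialize $H_1=\lambda I_d$, $\mathbf w_1\in\mathcal W$. At round $t$: compute $\alpha_{ti}=x_{ti}^\top\mathbf w_t+\beta_t(\delta)\|x_{ti}\|_{H_t^{-1}}$ for all $i$; offer $S_t\in\arg\max_{S\in\mathcal S}\tilde R_t(S)$ where $\tilde R_t(S)=\frac{\sum_{i\in S}e^{\alpha_{ti}}r_{ti}}{v_0+\sum_{j\in S}e^{\alpha_{tj}}}$;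 observe $y_t$; set $\tilde H_t=H_t+\eta\mathcal G_t(\mathbf w_t)$, $\mathbf w_{t+1}=\arg\min_{\mathbf w\in\mathcal W}\langle\nabla\ell_t(\mathbf w_t),\mathbf w\rangle+\frac1{2\eta}\|\mathbf w-\mathbf w_t\|^2_{\tilde H_t}$, $H_{t+1}=H_t+\mathcal G_t(\mathbf w_{t+1})$. (Under uniform rewards $S_t$ consists of $K$ items with largest $\alpha_{ti}$.) *)

theory Defs
  imports "HOL-Probability.Probability" "Jordan_Normal_Form.Gauss_Jordan_Elimination"
begin

text \<open>Contextual MNL bandit with uniform rewards (r_ti = 1), OFU-MNL+.
  Vectors in R^d are Jordan_Normal_Form vectors of dimension d (so that d is a
  value and constants can be absolute).  Items are 1..N, the index 0 is the
  outside option.  A history is a list of (offered set, observed outcome)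
  pairs, NEWEST FIRST; a history of length t-1 is the information before
  round t.  Features are chosen by an adaptive adversary: x t h i is the
  feature of item i at round t given the past history h.\<close>

type_synonym hist = "(nat set \<times> nat) list"

definition vnorm :: "real vec \<Rightarrow> real" where
  "vnorm v = sqrt (scalar_prod v v)"

definition param_ball :: "nat \<Rightarrow> real vec set" where
  "param_ball d = {w \<in> carrier_vec d. vnorm w \<le> 1}"

definition assortments :: "nat \<Rightarrow> nat \<Rightarrow> nat set set" where
  "assortments N K = {S. S \<subseteq> {1..N} \<and> card S \<le> K}"

definition mnl_prob :: "real \<Rightarrow> (nat \<Rightarrow> real vec) \<Rightarrow> nat set \<Rightarrow> real vec \<Rightarrow> nat \<Rightarrow> real" where
  "mnl_prob v0 xs S w i =
     (if i = 0 then v0 / (v0 + (\<Sum>j\<in>S. exp (scalar_prod (xs j) w)))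
      else if i \<in> S then exp (scalar_prod (xs i) w) / (v0 + (\<Sum>j\<in>S. exp (scalar_prod (xs j) w)))
      else 0)"

definition mnl_pmf :: "real \<Rightarrow> (nat \<Rightarrow> real vec) \<Rightarrow> nat set \<Rightarrow> real vec \<Rightarrow> nat pmf" where
  "mnl_pmf v0 xs S w = embed_pmf (mnl_prob v0 xs S w)"

definition exp_rev :: "real \<Rightarrow> (nat \<Rightarrow> real vec) \<Rightarrow> nat set \<Rightarrow> real vec \<Rightarrow> real" where
  "exp_rev v0 xs S w = (\<Sum>i\<in>S. mnl_prob v0 xs S w i * 1)"

definition opt_rev :: "real \<Rightarrow> (nat \<Rightarrow> real) \<Rightarrow> nat set \<Rightarrow> real" where
  "opt_rev v0 \<alpha> S = (\<Sum>i\<in>S. exp (\<alpha> i) * 1) / (v0 + (\<Sum>j\<in>S. exp (\<alpha> j)))"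

definition opt_argmax :: "real \<Rightarrow> nat \<Rightarrow> nat \<Rightarrow> (nat \<Rightarrow> real) \<Rightarrow> nat set set" where
  "opt_argmax v0 N K \<alpha> = {S \<in> assortments N K. \<forall>S'\<in>assortments N K. opt_rev v0 \<alpha> S' \<le> opt_rev v0 \<alpha> S}"

definition mnl_loss :: "real \<Rightarrow> (nat \<Rightarrow> real vec) \<Rightarrow> nat set \<Rightarrow> nat \<Rightarrow> real vec \<Rightarrow> real" where
  "mnl_loss v0 xs S y w = - (\<Sum>i\<in>insert 0 S. (if i = y then 1 else 0) * ln (mnl_prob v0 xs S w i))"

definition vgrad :: "nat \<Rightarrow> (real vec \<Rightarrow> real) \<Rightarrow> real vec \<Rightarrow> real vec" where
  "vgrad d f w = vec d (\<lambda>j. deriv (\<lambda>s. f (w + s \<cdot>\<^sub>v unit_vec d j)) 0)"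

definition Gmat :: "real \<Rightarrow> nat \<Rightarrow> (nat \<Rightarrow> real vec) \<Rightarrow> nat set \<Rightarrow> real vec \<Rightarrow> real mat" where
  "Gmat v0 d xs S w = mat d d (\<lambda>(a, b).
      (\<Sum>i\<in>S. mnl_prob v0 xs S w i * (xs i $ a) * (xs i $ b))
    - (\<Sum>i\<in>S. \<Sum>j\<in>S. mnl_prob v0 xs S w i * mnl_prob v0 xs S w j * (xs i $ a) * (xs j $ b)))"

definition minv :: "real mat \<Rightarrow> real mat" where
  "minv H = the (mat_inverse H)"

definition wnorm :: "real mat \<Rightarrow> real vec \<Rightarrow> real" where
  "wnorm A v = sqrt (scalar_prod v (A *\<^sub>v v))"

definition ofu_eta :: "nat \<Rightarrow> real" where
  "ofu_eta K = ln (real K + 1) / 2 + 2"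

definition ofu_lambda :: "nat \<Rightarrow> nat \<Rightarrow> real" where
  "ofu_lambda d K = 84 * sqrt 2 * real d * ofu_eta K"

definition ofu_c :: "nat \<Rightarrow> real" where
  "ofu_c K = 7 * ofu_eta K / 6"

definition ofu_beta :: "nat \<Rightarrow> nat \<Rightarrow> real \<Rightarrow> nat \<Rightarrow> real" where
  "ofu_beta d K \<delta> t =
     4 * ofu_eta K / ofu_lambda d K
   + sqrt (2 * ofu_eta K *
        (11 * (3 * ln (1 + (real K + 1) * real t) + 3) * ln (2 * sqrt (1 + 2 * real t) / \<delta>)
         + 2 + sqrt 6 * ofu_c K * real d * ln (1 + (real t + 1) / (2 * ofu_lambda d K)))
       + 4 * ofu_lambda d K)"

text \<open>Algorithm state (w_t, H_t) after history h, where t = length h + 1.\<close>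
primrec ofu_state ::
  "real \<Rightarrow> nat \<Rightarrow> nat \<Rightarrow> (nat \<Rightarrow> hist \<Rightarrow> nat \<Rightarrow> real vec) \<Rightarrow> real vec \<Rightarrow> hist \<Rightarrow> real vec \<times> real mat" where
  "ofu_state v0 d K x w1 [] = (w1, ofu_lambda d K \<cdot>\<^sub>m 1\<^sub>m d)"
| "ofu_state v0 d K x w1 (e # h) =
     (let t = Suc (length h); xs = x t h; S = fst e; y = snd e;
          w = fst (ofu_state v0 d K x w1 h); H = snd (ofu_state v0 d K x w1 h);
          \<eta> = ofu_eta K;
          Ht = H + \<eta> \<cdot>\<^sub>m Gmat v0 d xs S w;
          g = vgrad d (mnl_loss v0 xs S y) w;
          obj = (\<lambda>v. scalar_prod g v + (1 / (2 * \<eta>)) * scalar_prod (v - w) (Ht *\<^sub>v (v - w)));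
          w' = (THE v. v \<in> param_ball d \<and> (\<forall>u\<in>param_ball d. obj v \<le> obj u));
          H' = H + Gmat v0 d xs S w'
      in (w', H'))"

definition ofu_alpha ::
  "real \<Rightarrow> nat \<Rightarrow> nat \<Rightarrow> real \<Rightarrow> (nat \<Rightarrow> hist \<Rightarrow> nat \<Rightarrow> real vec) \<Rightarrow> real vec \<Rightarrow> hist \<Rightarrow> nat \<Rightarrow> real" where
  "ofu_alpha v0 d K \<delta> x w1 h i =
     (let t = Suc (length h); w = fst (ofu_state v0 d K x w1 h); H = snd (ofu_state v0 d K x w1 h)
      in scalar_prod (x t h i) w + ofu_beta d K \<delta> t * wnorm (minv H) (x t h i))"

text \<open>Offered assortment; sel is an arbitrary tie-breaking rule among maximizers.\<close>
definition ofu_offer ::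
  "real \<Rightarrow> nat \<Rightarrow> nat \<Rightarrow> real \<Rightarrow> (nat \<Rightarrow> hist \<Rightarrow> nat \<Rightarrow> real vec)
   \<Rightarrow> (nat \<Rightarrow> hist \<Rightarrow> (nat \<Rightarrow> real) \<Rightarrow> nat set) \<Rightarrow> real vec \<Rightarrow> hist \<Rightarrow> nat set" where
  "ofu_offer v0 d K \<delta> x sel w1 h = sel (Suc (length h)) h (ofu_alpha v0 d K \<delta> x w1 h)"

primrec hist_pmf ::
  "real \<Rightarrow> nat \<Rightarrow> nat \<Rightarrow> real \<Rightarrow> (nat \<Rightarrow> hist \<Rightarrow> nat \<Rightarrow> real vec)
   \<Rightarrow> (nat \<Rightarrow> hist \<Rightarrow> (nat \<Rightarrow> real) \<Rightarrow> nat set) \<Rightarrow> real vec \<Rightarrow> real vec \<Rightarrow> nat \<Rightarrow> hist pmf" where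
  "hist_pmf v0 d K \<delta> x sel w1 wstar 0 = return_pmf []"
| "hist_pmf v0 d K \<delta> x sel w1 wstar (Suc n) =
     bind_pmf (hist_pmf v0 d K \<delta> x sel w1 wstar n) (\<lambda>h.
       let S = ofu_offer v0 d K \<delta> x sel w1 h
       in map_pmf (\<lambda>y. (S, y) # h) (mnl_pmf v0 (x (Suc (length h)) h) S wstar))"

primrec regret ::
  "real \<Rightarrow> nat \<Rightarrow> nat \<Rightarrow> (nat \<Rightarrow> hist \<Rightarrow> nat \<Rightarrow> real vec) \<Rightarrow> real vec \<Rightarrow> hist \<Rightarrow> real" where
  "regret v0 N K x wstar [] = 0"
| "regret v0 N K x wstar (e # h) = regret v0 N K x wstar h
     + (Max ((\<lambda>S. exp_rev v0 (x (Suc (length h)) h) S wstar) ` assortments N K)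
        - exp_rev v0 (x (Suc (length h)) h) (fst e) wstar)"

end

theory Submission
  imports Defs "Jordan_Normal_Form.Determinant"
begin

text \<open>
  The estimate is an online mirror descent iterate. Self-concordance of the softmax loss turns its
  regret inequality into a recursion for \<open>\<parallel>w\<^sub>t - w\<^sup>*\<parallel>\<close> in the norm of \<open>H\<^sub>t\<close>, in which the only
  uncontrolled term is the excess log-likelihood of the true parameter over the updated estimates.
  For every outcome the likelihood of the updated estimate, discounted by the squared length of
  the update, exceeds that of the old estimate by a factor \<open>1 + O(\<parallel>x\<^sub>y - x\<parallel>\<^sup>2)\<close> only (norm of
  \<open>H\<^sub>t\<^sup>-\<^sup>1\<close>, \<open>x\<close> the mean feature). Normalizing gives a predictable forecaster, so the likelihood
  ratio against the truth is a supermartingale; Ville's inequality bounds it by \<open>1 / \<delta>\<close> at all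
  times, and the normalization costs are absorbed by the growth of \<open>ln det H\<^sub>t\<close>.

  On this event the utilities are optimistic, and the regret of a round is the revenue gain from
  raising the logits. Its linear part is handled by Young's inequality with a fixed weight
  \<open>\<theta>\<close>, using \<open>p\<^sub>0 (1 - p\<^sub>0) = O(v\<^sub>0 K / (v\<^sub>0 + K)\<^sup>2)\<close> for full assortments, and its quadratic
  part by the curvature constant \<open>\<kappa>\<close>; both are again paid for by \<open>ln det H\<^sub>t\<close>.
\<close>

text \<open>The obstacle is that the updated estimate depends on the outcome of its own round, so
  its likelihood ratio against the truth may have conditional mean above 1. The discount that
  repairs this is already paid for: the mirror descent inequality leaves \<open>- 9/10\<close> of
  the squared step in the norm of \<open>H\<close>, and \<open>c = 7 \<eta> / 6\<close> makes the
  discount cost \<open>6/7\<close> of it. The normalization costs the trace of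
  \<open>H\<^sup>-\<^sup>1 G\<close> at the old estimate, whereas the determinant grows by
  \<open>G\<close> at the new one; the large regularizer keeps the steps so short that the two
  traces are comparable. In the regret, confidence widths are norms of raw features, while
  \<open>G\<close> sees only centered ones. The zero feature of the outside option converts one into
  the other at the price of a factor \<open>p\<^sub>0\<close>. The linear part of the gain carries
  the weights \<open>p\<^sub>0 p\<^sub>i\<close> by itself; the quadratic part does not and takes
  them from \<open>\<kappa>\<close>. A fixed Young weight, in place of a Cauchy-Schwarz inequality
  over the rounds, allows an induction on the history; balancing it once at the end puts
  \<open>v\<^sub>0 K / (v\<^sub>0 + K)\<^sup>2\<close> under the root.\<close>

no_notation inner (infix "\<bullet>" 70)
no_notation vec_nth (infixl "$" 90)
hide_const (open) Determinants.det

section \<open>Symmetric positive definite matrices\<close>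

abbreviation bil :: "real mat \<Rightarrow> real vec \<Rightarrow> real vec \<Rightarrow> real" where
  "bil H u v \<equiv> u \<bullet> (H *\<^sub>v v)"

definition spd :: "nat \<Rightarrow> real mat \<Rightarrow> bool" where
  "spd d H \<longleftrightarrow> H \<in> carrier_mat d d \<and> transpose_mat H = H
     \<and> (\<forall>v\<in>carrier_vec d. v \<noteq> 0\<^sub>v d \<longrightarrow> bil H v v > 0)"

lemma spd_carrier: "spd d H \<Longrightarrow> H \<in> carrier_mat d d"
  by (simp add: spd_def)

lemma spd_pos: "spd d H \<Longrightarrow> v \<in> carrier_vec d \<Longrightarrow> v \<noteq> 0\<^sub>v d \<Longrightarrow> bil H v v > 0"
  by (simp add: spd_def)

lemma spd_nonneg: "spd d H \<Longrightarrow> v \<in> carrier_vec d \<Longrightarrow> bil H v v \<ge> 0"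
  by (cases "v = 0\<^sub>v d") (use spd_carrier spd_pos[of d H v] in \<open>fastforce simp: scalar_prod_left_zero[of _ d]\<close>)+

lemma bil_swap:
  assumes "transpose_mat H = H" "H \<in> carrier_mat d d" "u \<in> carrier_vec d" "v \<in> carrier_vec d"
  shows "bil H u v = bil H v u"
proof -
  have "(H *\<^sub>v v) \<bullet> u = v \<bullet> (H *\<^sub>v u)"
    using transpose_vec_mult_scalar[OF assms(2) assms(3) assms(4)] assms(1)
    by (metis assms(2-4) comm_scalar_prod mult_mat_vec_carrier transpose_vec_mult_scalar)
  then show ?thesis
    using assms(2-4) comm_scalar_prod[of u d "H *\<^sub>v v"] by simp
qed

lemma spd_swap: "spd d H \<Longrightarrow> u \<in> carrier_vec d \<Longrightarrow> v \<in> carrier_vec d \<Longrightarrow> bil H u v = bil H v u"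
  using bil_swap unfolding spd_def by blast

lemma bil_linear:
  assumes "H \<in> carrier_mat d d" "u \<in> carrier_vec d" "v \<in> carrier_vec d" "w \<in> carrier_vec d"
  shows "bil H (u + v) w = bil H u w + bil H v w"
    "bil H u (v + w) = bil H u v + bil H u w"
    "bil H (u - v) w = bil H u w - bil H v w"
    "bil H u (v - w) = bil H u v - bil H u w"
    "bil H (c \<cdot>\<^sub>v u) v = c * bil H u v"
    "bil H u (c \<cdot>\<^sub>v v) = c * bil H u v"
  using assms
  by (simp_all add: add_scalar_prod_distrib[of _ d] minus_scalar_prod_distrib[of _ d] mult_mat_vec[of _ d d]
      scalar_prod_add_distrib[of _ d] scalar_prod_minus_distrib[of _ d] mult_add_distrib_mat_vec[of _ d d]
      mult_minus_distrib_mat_vec[of _ d d])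

lemma bil_mat_add:
  assumes "A \<in> carrier_mat d d" "B \<in> carrier_mat d d" "u \<in> carrier_vec d" "v \<in> carrier_vec d"
  shows "bil (A + B) u v = bil A u v + bil B u v"
  using assms by (simp add: add_mult_distrib_mat_vec[of _ d d] scalar_prod_add_distrib[of _ d])

lemma bil_mat_smult:
  assumes "A \<in> carrier_mat d d" "u \<in> carrier_vec d" "v \<in> carrier_vec d"
  shows "bil (c \<cdot>\<^sub>m A) u v = c * bil A u v"
proof -
  have "(c \<cdot>\<^sub>m A) *\<^sub>v v = c \<cdot>\<^sub>v (A *\<^sub>v v)"
    by (rule eq_vecI) (use assms in \<open>auto simp: smult_scalar_prod_distrib[of _ d]\<close>)
  then show ?thesis using assms by simp
qed

lemma bil_sum:
  assumes "A \<in> carrier_mat d d" "u \<in> carrier_vec d" "v \<in> carrier_vec d"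
  shows "bil A u v = (\<Sum>i<d. \<Sum>j<d. u $ i * A $$ (i, j) * v $ j)"
  using assms by (auto simp: scalar_prod_def sum_distrib_left lessThan_atLeast0 mult.assoc intro!: sum.cong)

lemma vnorm_nonneg[simp]: "0 \<le> vnorm v"
  by (simp add: vnorm_def scalar_prod_def sum_nonneg)

lemma vnorm_sq: "(vnorm v)\<^sup>2 = v \<bullet> v"
  by (simp add: vnorm_def scalar_prod_def sum_nonneg)

lemma self_scalar_prod_nonneg: "0 \<le> (v :: real vec) \<bullet> v"
  by (simp add: scalar_prod_def sum_nonneg)

lemma self_scalar_prod_pos:
  fixes v :: "real vec"
  assumes "v \<in> carrier_vec d" "v \<noteq> 0\<^sub>v d" shows "v \<bullet> v > 0"
proof -
  have "\<exists>i<d. v $ i \<noteq> 0"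
  proof (rule ccontr)
    assume "\<not> ?thesis"
    then have "v = 0\<^sub>v d" using assms(1) by (intro eq_vecI) auto
    then show False using assms(2) by simp
  qed
  then obtain i where i: "i < d" "v $ i \<noteq> 0" by blast
  have "0 < v $ i * v $ i" using i(2) by (metis not_real_square_gt_zero)
  then have "0 < (\<Sum>i\<in>{0..<d}. v $ i * v $ i)"
    using i(1) by (intro sum_pos2[of _ i]) simp_all
  then show ?thesis using assms(1) by (simp add: scalar_prod_def)
qed

lemma spd_smult_one:
  assumes "l > 0" shows "spd d (l \<cdot>\<^sub>m 1\<^sub>m d)"
  unfolding spd_def
proof (intro conjI ballI impI)
  show "transpose_mat (l \<cdot>\<^sub>m 1\<^sub>m d) = l \<cdot>\<^sub>m 1\<^sub>m d" by (rule eq_matI) auto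
  fix v :: "real vec" assume v: "v \<in> carrier_vec d" "v \<noteq> 0\<^sub>v d"
  have "bil (l \<cdot>\<^sub>m 1\<^sub>m d) v v = l * (v \<bullet> v)"
    using v by (simp add: bil_mat_smult[OF one_carrier_mat])
  then show "bil (l \<cdot>\<^sub>m 1\<^sub>m d) v v > 0" using self_scalar_prod_pos[OF v] assms by simp
qed simp

lemma cauchy_schwarz_bil:
  assumes "spd d H" "u \<in> carrier_vec d" "v \<in> carrier_vec d"
  shows "(bil H u v)\<^sup>2 \<le> bil H u u * bil H v v"
proof (cases "v = 0\<^sub>v d")
  case True
  then show ?thesis using assms spd_carrier[OF assms(1)] spd_swap[OF assms(1,2,3)]
     by (simp add: scalar_prod_left_zero[of _ d] )
next
  case False
  note H = spd_carrier[OF assms(1)]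
  let ?v = "bil H v v" and ?c = "bil H u v"
  have pos: "?v > 0" using spd_pos[OF assms(1,3) False] .
  define z where "z = ?v \<cdot>\<^sub>v u - ?c \<cdot>\<^sub>v v"
  have z: "z \<in> carrier_vec d" using assms by (simp add: z_def)
  have "bil H z z = ?v * (?v * bil H u u - ?c * ?c) - ?c * (?v * ?c - ?c * ?v)"
    using assms H by (simp add: z_def bil_linear[of _ d] spd_swap[OF assms(1,3,2)])
  also have "\<dots> = ?v * (?v * bil H u u - ?c * ?c)"
    by (simp add: right_diff_distrib mult.commute)
  finally have "?v * (?v * bil H u u - ?c * ?c) \<ge> 0" using spd_nonneg[OF assms(1) z] by simp
  then have "?v * bil H u u - ?c * ?c \<ge> 0" using pos by (simp add: zero_le_mult_iff)
  then show ?thesis by (simp add: power2_eq_square mult.commute)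
qed

lemma cauchy_schwarz_vnorm:
  assumes "u \<in> carrier_vec d" "v \<in> carrier_vec d"
  shows "\<bar>u \<bullet> v\<bar> \<le> vnorm u * vnorm v"
proof -
  have "(u \<bullet> v)\<^sup>2 \<le> (vnorm u * vnorm v)\<^sup>2"
    using cauchy_schwarz_bil[OF spd_smult_one[of 1 d] assms] assms
    by (simp add: bil_mat_smult[of _ d] power_mult_distrib vnorm_sq)
  then show ?thesis by (simp add: abs_le_square_iff[symmetric])
qed

lemma spd_det_nonzero:
  assumes "spd d H" shows "det H \<noteq> 0"
proof
  assume "det H = 0"
  then obtain v where "v \<in> carrier_vec d" "v \<noteq> 0\<^sub>v d" "H *\<^sub>v v = 0\<^sub>v d"
    using det_0_iff_vec_prod_zero_field[OF spd_carrier[OF assms]] by auto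
  then show False using spd_pos[OF assms, of v] by simp
qed

lemma spd_minv:
  assumes "spd d H"
  shows "minv H \<in> carrier_mat d d" "H * minv H = 1\<^sub>m d" "minv H * H = 1\<^sub>m d"
proof -
  have "H \<in> Units (ring_mat TYPE(real) d ())"
    using det_non_zero_imp_unit[OF spd_carrier[OF assms] spd_det_nonzero[OF assms]] .
  then obtain B where "mat_inverse H = Some B"
    using mat_inverse(1)[OF spd_carrier[OF assms], where b = "()"] by (cases "mat_inverse H") auto
  then show "minv H \<in> carrier_mat d d" "H * minv H = 1\<^sub>m d" "minv H * H = 1\<^sub>m d"
    using mat_inverse(2)[OF spd_carrier[OF assms]] by (auto simp: minv_def)
qed

lemma bil_minv_left:
  assumes "spd d H" "a \<in> carrier_vec d" "v \<in> carrier_vec d"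
  shows "bil H (minv H *\<^sub>v a) v = a \<bullet> v"
proof -
  note H = spd_carrier[OF assms(1)] and Hi = spd_minv[OF assms(1)]
  have "bil H (minv H *\<^sub>v a) v = bil H v (minv H *\<^sub>v a)"
    using assms Hi by (intro spd_swap) auto
  also have "H *\<^sub>v (minv H *\<^sub>v a) = a"
    using assms H Hi by (simp flip: assoc_mult_mat_vec[of _ d d _ d])
  finally show ?thesis using assms comm_scalar_prod by metis
qed

lemma spd_minv_spd:
  assumes "spd d H" shows "spd d (minv H)"
proof -
  note H = spd_carrier[OF assms(1)] and Hi = spd_minv[OF assms(1)]
  let ?T = "transpose_mat (minv H)"
  have T: "?T \<in> carrier_mat d d" using Hi by simp
  have sym: "transpose_mat H = H" using assms by (simp add: spd_def)
  have "?T * H = 1\<^sub>m d"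
    using transpose_mult[OF H Hi(1)] sym Hi(2) by simp
  then have "?T * (H * minv H) = minv H"
    using assoc_mult_mat[OF T H Hi(1)] Hi by simp
  then have "?T = minv H" using Hi T by simp
  moreover have "bil (minv H) v v > 0" if v: "v \<in> carrier_vec d" "v \<noteq> 0\<^sub>v d" for v
  proof -
    let ?u = "minv H *\<^sub>v v"
    have "H *\<^sub>v ?u = v" using v H Hi by (simp flip: assoc_mult_mat_vec[of _ d d _ d])
    moreover have "H *\<^sub>v 0\<^sub>v d = 0\<^sub>v d" using H by (intro eq_vecI) auto
    ultimately have "?u \<noteq> 0\<^sub>v d" using v(2) by metis
    then have "bil H ?u ?u > 0" using assms v Hi by (intro spd_pos) auto
    then show ?thesis using bil_minv_left[OF assms v(1), of ?u] v Hi by simp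
  qed
  ultimately show ?thesis using Hi by (simp add: spd_def)
qed

text \<open>Expands the nonnegative form of \<open>H\<close> at
  \<open>v - c H\<^sup>-\<^sup>1 a\<close>. The weight stays free because the likelihood discount
  and the comparison of inverses prescribe different ones.\<close>

lemma young_minv:
  assumes "spd d H" "a \<in> carrier_vec d" "v \<in> carrier_vec d" "c > 0"
  shows "a \<bullet> v \<le> c / 2 * bil (minv H) a a + bil H v v / (2 * c)"
proof -
  note H = spd_carrier[OF assms(1)] and Hi = spd_minv[OF assms(1)]
  let ?u = "minv H *\<^sub>v a"
  have u: "?u \<in> carrier_vec d" using assms Hi by simp
  have "0 \<le> bil H (v - c \<cdot>\<^sub>v ?u) (v - c \<cdot>\<^sub>v ?u)"
    using assms u by (intro spd_nonneg) auto
  also have "\<dots> = (bil H v v - c * bil H ?u v) - c * (bil H ?u v - c * bil H ?u ?u)"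
    using assms u H by (simp add: bil_linear[of _ d] spd_swap[OF assms(1,3) u])
  also have "\<dots> = bil H v v - 2 * c * (a \<bullet> v) + c * c * bil (minv H) a a"
    unfolding bil_minv_left[OF assms(1,2,3)] bil_minv_left[OF assms(1,2) u]
    by (simp add: right_diff_distrib)
  finally show ?thesis using assms(4) by (simp add: field_simps)
qed

lemma cauchy_schwarz_minv:
  assumes "spd d H" "a \<in> carrier_vec d" "v \<in> carrier_vec d"
  shows "(a \<bullet> v)\<^sup>2 \<le> bil (minv H) a a * bil H v v"
proof -
  note Hi = spd_minv[OF assms(1)]
  let ?u = "minv H *\<^sub>v a"
  have u: "?u \<in> carrier_vec d" using assms Hi by simp
  show ?thesis
    using cauchy_schwarz_bil[OF assms(1) u assms(3)] bil_minv_left[OF assms(1,2)] assms u by simp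
qed

lemma bil_minv_le:
  assumes "spd d H" "a \<in> carrier_vec d" "l > 0"
    and "\<And>v. v \<in> carrier_vec d \<Longrightarrow> bil H v v \<ge> l * (v \<bullet> v)"
  shows "bil (minv H) a a \<le> (a \<bullet> a) / l"
proof -
  note Hi = spd_minv[OF assms(1)]
  let ?u = "minv H *\<^sub>v a"
  have u: "?u \<in> carrier_vec d" using assms Hi by simp
  have eq: "bil (minv H) a a = bil H ?u ?u" using bil_minv_left[OF assms(1,2) u] by simp
  have "(vnorm ?u)\<^sup>2 * l \<le> bil (minv H) a a" using assms(4)[OF u] eq by (simp add: vnorm_sq mult.commute)
  moreover have "bil (minv H) a a \<le> vnorm a * vnorm ?u"
    using cauchy_schwarz_vnorm[OF assms(2) u] by linarith
  moreover have "vnorm a * vnorm ?u \<le> (vnorm a)\<^sup>2 / (2 * l) + l * (vnorm ?u)\<^sup>2 / 2"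
  proof -
    have "0 \<le> (vnorm a - l * vnorm ?u)\<^sup>2" by simp
    then show ?thesis using assms(3) by (simp add: power2_eq_square field_simps)
  qed
  ultimately show ?thesis by (simp add: vnorm_sq algebra_simps)
qed

text \<open>Inversion reverses the order of forms. With \<open>u = H\<^sup>-\<^sup>1 a\<close>, the
  form of \<open>minv H\<close> at \<open>a\<close> is both \<open>a \<bullet> u\<close> and the
  form of \<open>H\<close> at \<open>u\<close>; Young's inequality in the norm of \<open>H'\<close>
  absorbs half of it.\<close>

lemma bil_minv_antimono:
  assumes "spd d H" "spd d H'" "a \<in> carrier_vec d" "c > 0"
    and "\<And>v. v \<in> carrier_vec d \<Longrightarrow> bil H' v v \<le> c * bil H v v"
  shows "bil (minv H) a a \<le> c * bil (minv H') a a"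
proof -
  note Hi = spd_minv[OF assms(1)]
  let ?u = "minv H *\<^sub>v a"
  have u: "?u \<in> carrier_vec d" using assms Hi by simp
  have eq: "bil (minv H) a a = bil H ?u ?u" using bil_minv_left[OF assms(1,3) u] by simp
  have "bil (minv H) a a \<le> c / 2 * bil (minv H') a a + bil H' ?u ?u / (2 * c)"
    using young_minv[OF assms(2,3) u assms(4)] by simp
  moreover have "bil H' ?u ?u / (2 * c) \<le> bil (minv H) a a / 2"
    using assms(5)[OF u] assms(4) eq by (simp add: field_simps)
  ultimately show ?thesis by simp
qed

section \<open>Determinants and rank-one updates\<close>

definition outer :: "real vec \<Rightarrow> real mat" where
  "outer a = mat (dim_vec a) (dim_vec a) (\<lambda>(i, j). a $ i * a $ j)"

lemma outer_carrier[simp]: "a \<in> carrier_vec d \<Longrightarrow> outer a \<in> carrier_mat d d"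
  by (auto simp: outer_def)

lemma bil_outer:
  assumes "a \<in> carrier_vec d" "u \<in> carrier_vec d" "v \<in> carrier_vec d"
  shows "bil (outer a) u v = (a \<bullet> u) * (a \<bullet> v)"
  using assms by (subst bil_sum[of _ d])
    (auto simp: outer_def scalar_prod_def sum_product lessThan_atLeast0 intro!: sum.cong)

lemma bil_unit_vec:
  assumes "C \<in> carrier_mat d d" "i < d" "j < d"
  shows "bil C (unit_vec d i) (unit_vec d j) = C $$ (i, j)"
proof -
  have "bil C (unit_vec d i) (unit_vec d j) = (C *\<^sub>v unit_vec d j) $ i"
    by (rule scalar_prod_left_unit) (use assms in auto)
  also have "\<dots> = row C i \<bullet> unit_vec d j" using assms by (subst index_mult_mat_vec) auto
  also have "\<dots> = row C i $ j" by (rule scalar_prod_right_unit[OF assms(3)])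
  finally show ?thesis using assms by simp
qed

lemma mat_eq_if_bil_eq:
  assumes "A \<in> carrier_mat d d" "B \<in> carrier_mat d d"
    and eq: "\<And>u v. u \<in> carrier_vec d \<Longrightarrow> v \<in> carrier_vec d \<Longrightarrow> bil A u v = bil B u v"
  shows "A = B"
proof (rule eq_matI)
  fix i j assume "i < dim_row B" "j < dim_col B"
  then show "A $$ (i, j) = B $$ (i, j)"
    using eq[of "unit_vec d i" "unit_vec d j"] bil_unit_vec[OF assms(1)] bil_unit_vec[OF assms(2)] assms(2)
    by (metis carrier_matD unit_vec_carrier)
qed (use assms(1,2) in auto)

lemma spd_add_psd:
  assumes H: "spd d H" and G: "G \<in> carrier_mat d d"
    and sym: "\<And>u v. u \<in> carrier_vec d \<Longrightarrow> v \<in> carrier_vec d \<Longrightarrow> bil G u v = bil G v u"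
    and psd: "\<And>v. v \<in> carrier_vec d \<Longrightarrow> bil G v v \<ge> 0"
  shows "spd d (H + G)"
  unfolding spd_def
proof (intro conjI ballI impI)
  note Hc = spd_carrier[OF H]
  show c: "H + G \<in> carrier_mat d d" using Hc G by simp
  have "transpose_mat G = G"
  proof (rule eq_matI)
    fix i j assume "i < dim_row G" "j < dim_col G"
    then have ij: "i < d" "j < d" using G by auto
    then have "G $$ (j, i) = G $$ (i, j)"
      using sym[of "unit_vec d i" "unit_vec d j"] bil_unit_vec[OF G] by (metis unit_vec_carrier)
    then show "transpose_mat G $$ (i, j) = G $$ (i, j)" using ij G by simp
  qed (use G in auto)
  then show "transpose_mat (H + G) = H + G"
    using H Hc G by (simp add: transpose_add[of _ d d] spd_def)
  fix v :: "real vec" assume v: "v \<in> carrier_vec d" "v \<noteq> 0\<^sub>v d"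
  show "bil (H + G) v v > 0"
    using spd_pos[OF H v] psd[OF v(1)] bil_mat_add[OF Hc G v(1) v(1)] by simp
qed

lemma spd_add_outer:
  assumes "spd d H" "a \<in> carrier_vec d"
  shows "spd d (H + outer a)"
  by (rule spd_add_psd) (use assms in \<open>simp_all add: bil_outer[of _ d] mult.commute\<close>)

text \<open>Matrix determinant lemma. The bordered matrix \<open>M\<close> is reduced to block
  triangular form from the left by \<open>L\<close> and from the right by \<open>L'\<close>, both of
  determinant 1. So \<open>det M\<close> equals both \<open>det (1 + R U)\<close>, which is a
  scalar, and \<open>det (1 + U R)\<close>.\<close>

lemma det_one_plus_rank_one:
  fixes a u :: "real vec"
  assumes "a \<in> carrier_vec n" "u \<in> carrier_vec n"
  shows "det (1\<^sub>m n + mat n n (\<lambda>(i, j). u $ i * a $ j)) = 1 + a \<bullet> u"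
proof -
  note One_nat_def[simp del]
  define U where "U = mat n 1 (\<lambda>(i, j). u $ i)"
  define R where "R = mat 1 n (\<lambda>(i, j). a $ j)"
  have [simp]: "U \<in> carrier_mat n 1" "R \<in> carrier_mat 1 n" "- R \<in> carrier_mat 1 n"
    by (auto simp: U_def R_def)
  have UR: "U * R = mat n n (\<lambda>(i, j). u $ i * a $ j)"
    by (rule eq_matI) (auto simp: U_def R_def scalar_prod_def)
  have RU: "R * U = mat 1 1 (\<lambda>_. a \<bullet> u)"
    by (rule eq_matI) (use assms in \<open>auto simp: U_def R_def scalar_prod_def\<close>)
  have [simp]: "R * U \<in> carrier_mat 1 1" "U * R \<in> carrier_mat n n" by (auto simp: RU UR)
  define M where "M = four_block_mat (1\<^sub>m n) U (- R) (1\<^sub>m 1)"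
  define L where "L = four_block_mat (1\<^sub>m n) (0\<^sub>m n 1) (- R) (1\<^sub>m 1)"
  define V where "V = four_block_mat (1\<^sub>m n) U (0\<^sub>m 1 n) (1\<^sub>m 1 + R * U)"
  define L' where "L' = four_block_mat (1\<^sub>m n) (0\<^sub>m n 1) R (1\<^sub>m 1)"
  have c: "M \<in> carrier_mat (n + 1) (n + 1)" "L \<in> carrier_mat (n + 1) (n + 1)"
     "V \<in> carrier_mat (n + 1) (n + 1)" "L' \<in> carrier_mat (n + 1) (n + 1)"
    by (auto simp: M_def L_def V_def L'_def intro!: four_block_carrier_mat)
  have R1: "- R * 1\<^sub>m n = - R" by (rule right_mult_one_mat[of _ 1]) simp
  have "L * V = M"
  proof -
    have "- R * U + 1\<^sub>m 1 * (1\<^sub>m 1 + R * U) = 1\<^sub>m 1"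
      by (rule eq_matI) (auto simp: U_def R_def scalar_prod_def sum_negf)
    moreover have "1\<^sub>m n * U + 0\<^sub>m n 1 * (1\<^sub>m 1 + R * U) = U" "- R * 1\<^sub>m n + 0\<^sub>m 1 n = - R"
      using R1 left_mult_one_mat[of U n 1] left_mult_zero_mat[of "1\<^sub>m 1 + R * U" 1 1 n] by simp_all
    ultimately show ?thesis
      unfolding L_def V_def M_def
      by (subst mult_four_block_mat[of _ n n _ 1 _ 1 _ _ n _ 1]) (auto intro!: cong_four_block_mat)
  qed
  moreover have "det L = 1" "det L' = 1"
    unfolding L_def L'_def by (subst det_four_block_mat_upper_right_zero[of _ n _ 1]; auto)+
  moreover have "det V = 1 + a \<bullet> u"
    unfolding V_def by (subst det_four_block_mat_lower_left_zero[of _ n _ 1]; auto simp: RU det_single)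
  ultimately have 1: "det M = 1 + a \<bullet> u" using det_mult[OF c(2,3)] by simp
  have e1: "0\<^sub>m n 1 + U * 1\<^sub>m 1 = U"
    by (subst right_mult_one_mat[of _ n 1]) auto
  have e2: "- R * 1\<^sub>m n + 1\<^sub>m 1 * R = 0\<^sub>m 1 n"
    unfolding R1 left_mult_one_mat[of R 1 n, simplified] by (rule eq_matI) (auto simp: R_def)
  have e3: "- R * 0\<^sub>m n 1 + 1\<^sub>m 1 = 1\<^sub>m 1"
    by (subst right_mult_zero_mat[of _ 1 n]) auto
  have "M * L' = four_block_mat (1\<^sub>m n + U * R) U (0\<^sub>m 1 n) (1\<^sub>m 1)"
    unfolding M_def L'_def
    using e1 e2 e3
    by (subst mult_four_block_mat[of _ n n _ 1 _ 1 _ _ n _ 1]) (auto intro!: cong_four_block_mat)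
  then have "det (M * L') = det (1\<^sub>m n + U * R)"
    by (simp add: det_four_block_mat_lower_left_zero[of _ n _ 1])
  then show ?thesis using 1 det_mult[OF c(1,4)] \<open>det L' = 1\<close> UR by simp
qed

lemma det_add_outer:
  assumes "spd d H" "a \<in> carrier_vec d"
  shows "det (H + outer a) = det H * (1 + bil (minv H) a a)"
proof -
  note H = spd_carrier[OF assms(1)] and Hi = spd_minv[OF assms(1)]
  let ?u = "minv H *\<^sub>v a"
  let ?A = "mat d d (\<lambda>(i, j). ?u $ i * a $ j)"
  have u: "?u \<in> carrier_vec d" using assms Hi by simp
  have "H * ?A = outer a"
  proof (rule eq_matI)
    fix i j assume ij: "i < dim_row (outer a)" "j < dim_col (outer a)"
    then have "i < d" "j < d" using assms by (auto simp: outer_def)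
    have "(H * ?A) $$ (i, j) = (\<Sum>k = 0..<d. H $$ (i, k) * ?u $ k) * a $ j"
      using \<open>i < d\<close> \<open>j < d\<close> H by (simp add: scalar_prod_def sum_distrib_right mult.assoc)
    also have "(\<Sum>k = 0..<d. H $$ (i, k) * ?u $ k) = (H *\<^sub>v ?u) $ i"
      using \<open>i < d\<close> H Hi by (simp add: scalar_prod_def)
    also have "H *\<^sub>v ?u = a"
      using assms H Hi by (simp flip: assoc_mult_mat_vec[of _ d d _ d])
    finally show "(H * ?A) $$ (i, j) = outer a $$ (i, j)"
      using ij by (simp add: outer_def)
  qed (use H assms in \<open>auto simp: outer_def\<close>)
  then have "H + outer a = H * (1\<^sub>m d + ?A)"
    using H by (simp add: mult_add_distrib_mat[of _ d d _ d])
  then show ?thesis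
    using det_mult[of H d "1\<^sub>m d + ?A"] H det_one_plus_rank_one[OF assms(2) u] by simp
qed

text \<open>By Cramer's rule the last diagonal entry of the inverse is
  the quotient of the leading minor by the determinant, and by the Cauchy-Schwarz inequality
  it is at least the reciprocal of the last diagonal entry.\<close>
lemma hadamard:
  assumes "spd d H"
  shows "0 < det H \<and> det H \<le> (\<Prod>j<d. H $$ (j, j))"
  using assms
proof (induction d arbitrary: H)
  case 0
  then have "det H = 1" using det_dim_zero[of H] by (simp add: spd_def)
  then show ?case by simp
next
  case (Suc n)
  note H = spd_carrier[OF Suc.prems] and Hi = spd_minv[OF Suc.prems]
  define B where "B = mat_delete H n n"
  have B: "B \<in> carrier_mat n n" using mat_delete_carrier[OF H] by (simp add: B_def)
  have Bij: "B $$ (i, j) = H $$ (i, j)" if "i < n" "j < n" for i j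
    using that H by (simp add: B_def mat_delete_def)
  have "spd n B"
    unfolding spd_def
  proof (intro conjI ballI impI)
    show "transpose_mat B = B"
    proof (rule eq_matI)
      fix i j assume "i < dim_row B" "j < dim_col B"
      moreover have "H $$ (j, i) = H $$ (i, j)" if "i < Suc n" "j < Suc n" for i j
        using Suc.prems that unfolding spd_def by (metis H carrier_matD index_transpose_mat(1))
      ultimately show "transpose_mat B $$ (i, j) = B $$ (i, j)" using B by (simp add: Bij)
    qed (use B in auto)
    fix v :: "real vec" assume v: "v \<in> carrier_vec n" "v \<noteq> 0\<^sub>v n"
    define w where "w = vec (Suc n) (\<lambda>i. if i < n then v $ i else 0)"
    have "w \<noteq> 0\<^sub>v (Suc n)"
    proof
      assume "w = 0\<^sub>v (Suc n)"
      then have "v $ i = 0" if "i < n" for i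
      proof -
        have "w $ i = 0" using \<open>w = 0\<^sub>v (Suc n)\<close> that by simp
        then show ?thesis using that by (simp add: w_def)
      qed
      then show False using v by (auto intro!: eq_vecI)
    qed
    moreover have "w \<in> carrier_vec (Suc n)" by (simp add: w_def)
    ultimately have "bil H w w > 0" using spd_pos[OF Suc.prems] by blast
    also have "bil H w w = bil B v v"
      using \<open>w \<in> _\<close> v H B by (simp add: bil_sum[of _ "Suc n"] bil_sum[of _ n] w_def Bij)
    finally show "bil B v v > 0" .
  qed (rule B)
  then have IH: "0 < det B" "det B \<le> (\<Prod>j<n. B $$ (j, j))" using Suc.IH by auto
  let ?e = "unit_vec (Suc n) n :: real vec"
  have e: "?e \<in> carrier_vec (Suc n)" by simp
  have unit: "bil A ?e ?e = A $$ (n, n)" if "A \<in> carrier_mat (Suc n) (Suc n)" for A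
    using that by (simp add: scalar_prod_left_unit)
  have "minv H * (H * adj_mat H) = minv H * (det H \<cdot>\<^sub>m 1\<^sub>m (Suc n))"
    using adj_mat(2)[OF H] by simp
  then have "adj_mat H = det H \<cdot>\<^sub>m minv H"
    using H Hi adj_mat(1)[OF H]
    by (simp add: mult_smult_distrib[of _ "Suc n" "Suc n" _ "Suc n"]
        flip: assoc_mult_mat[of _ "Suc n" "Suc n" _ "Suc n" _ "Suc n"])
  then have "adj_mat H $$ (n, n) = det H * minv H $$ (n, n)" using Hi by simp
  moreover have "adj_mat H $$ (n, n) = det B"
    using H by (simp add: adj_mat_def cofactor_def B_def)
  ultimately have eq: "det B = det H * minv H $$ (n, n)" by simp
  have ni: "minv H $$ (n, n) > 0"
    using spd_pos[OF spd_minv_spd[OF Suc.prems] e] unit[OF Hi(1)] by simp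
  have nH: "H $$ (n, n) > 0"
    using spd_pos[OF Suc.prems e] unit[OF H] by simp
  have pos: "det H > 0" using IH(1) eq ni by (simp add: zero_less_mult_iff)
  have "1 \<le> minv H $$ (n, n) * H $$ (n, n)"
    using cauchy_schwarz_minv[OF Suc.prems e e] unit[OF H] unit[OF Hi(1)] by simp
  then have "det H \<le> det B * H $$ (n, n)"
    using pos eq by (simp add: mult.assoc)
  also have "\<dots> \<le> (\<Prod>j<n. B $$ (j, j)) * H $$ (n, n)"
    using IH nH by (intro mult_right_mono) auto
  also have "(\<Prod>j<n. B $$ (j, j)) = (\<Prod>j<n. H $$ (j, j))"
    by (intro prod.cong) (auto simp: Bij)
  finally show ?case using pos by simp
qed

lemma ln_one_plus_ge:
  assumes "0 \<le> z" "z \<le> 1 / 200"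
  shows "z \<le> 201 / 200 * ln (1 + z :: real)"
proof -
  have "ln (1 / (1 + z)) \<le> 1 / (1 + z) - 1" using assms by (intro ln_le_minus_one) auto
  then have "z / (1 + z) \<le> ln (1 + z)" using assms by (simp add: ln_div field_simps)
  moreover have "z * (1 + z) \<le> z * (201 / 200)" using assms by (intro mult_left_mono) auto
  then have "z \<le> 201 / 200 * (z / (1 + z))" using assms by (simp add: field_simps)
  ultimately show ?thesis by (smt (verit, ccfv_SIG) mult_left_mono zero_le_divide_iff)
qed

text \<open>The determinant telescopes over single rank-one updates, each measured in the inverse of
  the current matrix, whereas the sum keeps the inverse of the initial \<open>H\<close>. All updates
  together are dominated by the identity and \<open>l \<ge> 200\<close>, so every intermediate
  matrix is within a factor \<open>201/200\<close> of \<open>H\<close> and the exchange costs almost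
  nothing.\<close>

lemma ln_det_outer_sum:
  fixes a :: "'i \<Rightarrow> real vec"
  assumes "spd d H" "finite Y" and a: "\<And>y. y \<in> Y \<Longrightarrow> a y \<in> carrier_vec d"
    and l: "\<And>v. v \<in> carrier_vec d \<Longrightarrow> bil H v v \<ge> l * (v \<bullet> v)" "l \<ge> 200"
    and tot: "\<And>v. v \<in> carrier_vec d \<Longrightarrow> (\<Sum>y\<in>Y. (a y \<bullet> v)\<^sup>2) \<le> v \<bullet> v"
    and G: "G \<in> carrier_mat d d" "\<And>u v. u \<in> carrier_vec d \<Longrightarrow> v \<in> carrier_vec d \<Longrightarrow>
               bil G u v = (\<Sum>y\<in>Y. (a y \<bullet> u) * (a y \<bullet> v))"
  shows "spd d (H + G) \<and> det (H + G) > 0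
    \<and> (\<Sum>y\<in>Y. bil (minv H) (a y) (a y)) \<le> 11/10 * (ln (det (H + G)) - ln (det H))"
proof -
  note H = spd_carrier[OF assms(1)]
  have "\<exists>H'. spd d H' \<and> det H' > 0
      \<and> (\<forall>u v. u \<in> carrier_vec d \<longrightarrow> v \<in> carrier_vec d \<longrightarrow>
            bil H' u v = bil H u v + (\<Sum>y\<in>F. (a y \<bullet> u) * (a y \<bullet> v)))
      \<and> (\<Sum>y\<in>F. bil (minv H) (a y) (a y)) \<le> 11/10 * (ln (det H') - ln (det H))"
    if "F \<subseteq> Y" for F
    using finite_subset[OF that assms(2)] that
  proof (induction F rule: finite_induct)
    case empty
    show ?case using assms(1) hadamard by (intro exI[of _ H]) auto
  next
    case (insert y F)
    then obtain H' where H': "spd d H'" "det H' > 0"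
        "\<And>u v. u \<in> carrier_vec d \<Longrightarrow> v \<in> carrier_vec d \<Longrightarrow>
            bil H' u v = bil H u v + (\<Sum>y\<in>F. (a y \<bullet> u) * (a y \<bullet> v))"
        "(\<Sum>y\<in>F. bil (minv H) (a y) (a y)) \<le> 11/10 * (ln (det H') - ln (det H))"
      by auto
    note c' = spd_carrier[OF H'(1)]
    have ay: "a y \<in> carrier_vec d" "y \<in> Y" using insert.prems a by auto
    let ?z = "bil (minv H') (a y) (a y)"
    have z0: "?z \<ge> 0" using spd_nonneg[OF spd_minv_spd[OF H'(1)] ay(1)] .
    have part: "0 \<le> (\<Sum>y\<in>F. (a y \<bullet> v) * (a y \<bullet> v))"
      "(\<Sum>y\<in>F. (a y \<bullet> v) * (a y \<bullet> v)) \<le> v \<bullet> v" if "v \<in> carrier_vec d" for v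
    proof -
      show "0 \<le> (\<Sum>y\<in>F. (a y \<bullet> v) * (a y \<bullet> v))" by (intro sum_nonneg) auto
      have "(\<Sum>y\<in>F. (a y \<bullet> v) * (a y \<bullet> v)) \<le> (\<Sum>y\<in>Y. (a y \<bullet> v)\<^sup>2)"
        unfolding power2_eq_square using insert.prems assms(2) by (intro sum_mono2) auto
      then show "(\<Sum>y\<in>F. (a y \<bullet> v) * (a y \<bullet> v)) \<le> v \<bullet> v" using tot[OF that] by simp
    qed
    \<comment> \<open>\<open>tot\<close> at \<open>v = a y\<close> bounds the square of
      \<open>a y \<bullet> a y\<close> by \<open>a y \<bullet> a y\<close> itself, which forces it
      to be at most 1.\<close>
    have "(a y \<bullet> a y)\<^sup>2 \<le> (\<Sum>x\<in>Y. (a x \<bullet> a y)\<^sup>2)"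
      using assms(2) ay by (intro member_le_sum) auto
    then have "(a y \<bullet> a y) * (a y \<bullet> a y) \<le> 1 * (a y \<bullet> a y)"
      using tot[OF ay(1)] by (simp add: power2_eq_square)
    then have "a y \<bullet> a y \<le> 1"
      using self_scalar_prod_nonneg[of "a y"] by (cases "a y \<bullet> a y = 0") (auto simp: mult_le_cancel_right)
    moreover have "?z \<le> (a y \<bullet> a y) / l"
    proof (rule bil_minv_le[OF H'(1) ay(1)])
      fix v :: "real vec" assume v: "v \<in> carrier_vec d"
      show "l * (v \<bullet> v) \<le> bil H' v v" using l(1)[OF v] H'(3)[OF v v] part(1)[OF v] by linarith
    qed (use l(2) in simp)
    moreover have "(a y \<bullet> a y) / l \<le> 1 / 200"
      using \<open>a y \<bullet> a y \<le> 1\<close> l(2) by (simp add: field_simps)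
    ultimately have z1: "?z \<le> 1 / 200" by linarith
    have "bil (minv H) (a y) (a y) \<le> 201 / 200 * ?z"
    proof (rule bil_minv_antimono[OF assms(1) H'(1) ay(1)])
      fix v :: "real vec" assume v: "v \<in> carrier_vec d"
      have "200 * (v \<bullet> v) \<le> l * (v \<bullet> v)"
        using l(2) self_scalar_prod_nonneg by (intro mult_right_mono) auto
      then show "bil H' v v \<le> 201 / 200 * bil H v v"
        using H'(3)[OF v v] part(2)[OF v] l(1)[OF v] by linarith
    qed simp
    moreover have "?z \<le> 201 / 200 * ln (1 + ?z)" by (rule ln_one_plus_ge[OF z0 z1])
    moreover have "ln (1 + ?z) \<ge> 0" using z0 by simp
    \<comment> \<open>One factor \<open>201/200\<close> comes from exchanging the matrix and one
      from \<open>ln_one_plus_ge\<close>; \<open>11/10\<close> rounds up their product.\<close>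
    ultimately have "bil (minv H) (a y) (a y) \<le> 11 / 10 * ln (1 + ?z)" by linarith
    moreover have "det (H' + outer (a y)) = det H' * (1 + ?z)"
      by (rule det_add_outer[OF H'(1) ay(1)])
    moreover have "0 < det H' * (1 + ?z)" using H'(2) z0 by simp
    moreover have "ln (det H' * (1 + ?z)) = ln (det H') + ln (1 + ?z)"
      using H'(2) z0 by (simp add: ln_mult)
    moreover have "bil (H' + outer (a y)) u v = bil H u v + (\<Sum>y\<in>insert y F. (a y \<bullet> u) * (a y \<bullet> v))"
      if "u \<in> carrier_vec d" "v \<in> carrier_vec d" for u v
      using that ay c' insert.hyps H'(3)[OF that] by (simp add: bil_mat_add[of _ d] bil_outer[of _ d])
    ultimately show ?case
      using H'(4) insert.hyps spd_add_outer[OF H'(1) ay(1)]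
      by (intro exI[of _ "H' + outer (a y)"]) (simp add: algebra_simps)
  qed
  from this[of Y] obtain H' where H': "spd d H'" "det H' > 0"
        "\<And>u v. u \<in> carrier_vec d \<Longrightarrow> v \<in> carrier_vec d \<Longrightarrow>
            bil H' u v = bil H u v + (\<Sum>y\<in>Y. (a y \<bullet> u) * (a y \<bullet> v))"
        "(\<Sum>y\<in>Y. bil (minv H) (a y) (a y)) \<le> 11/10 * (ln (det H') - ln (det H))"
    by auto
  have "H' = H + G"
    by (rule mat_eq_if_bil_eq[of _ d]) (use H G H' spd_carrier in \<open>auto simp: bil_mat_add[of _ d]\<close>)
  then show ?thesis using H' by simp
qed

section \<open>Exponential tilting of finite distributions\<close>

text \<open>Self-concordance: the third central moment is at least \<open>- R\<close> times the variance when no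
  value lies more than \<open>R\<close> below the mean, so the variance of the tilted distribution decays at
  most like \<open>exp (- R s)\<close>.\<close>
lemma log_partition_lower:
  fixes b u :: "'i \<Rightarrow> real"
  assumes Y: "finite Y" "Y \<noteq> {}" and b: "\<And>y. y \<in> Y \<Longrightarrow> b y > 0" and R: "R > 0"
    and gap: "\<And>s i. 0 \<le> s \<Longrightarrow> s \<le> 1 \<Longrightarrow> i \<in> Y \<Longrightarrow>
        (\<Sum>y\<in>Y. b y * exp (s * u y) * (u y - u i)) \<le> R * (\<Sum>y\<in>Y. b y * exp (s * u y))"
    and P: "(\<Sum>y\<in>Y. b y) = 1"
  shows "ln (\<Sum>y\<in>Y. b y * exp (u y)) \<ge> (\<Sum>y\<in>Y. b y * u y)
     + ((\<Sum>y\<in>Y. b y * (u y)\<^sup>2) - (\<Sum>y\<in>Y. b y * u y)\<^sup>2) * ((R - 1) / R\<^sup>2)"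
proof -
  define A where "A k s = (\<Sum>y\<in>Y. b y * (u y) ^ k * exp (s * u y))" for k :: nat and s
  have dA: "(A k has_real_derivative A (Suc k) s) (at s)" for k s
    unfolding A_def by (auto intro!: derivative_eq_intros sum.cong simp: mult_ac)
  have Zpos: "A 0 s > 0" for s
    unfolding A_def using Y b by (intro sum_pos) auto
  \<comment> \<open>\<open>m\<close>, \<open>V\<close> and \<open>T\<close> are the mean, variance
    and third central moment of \<open>u\<close> under the distribution tilted by \<open>s\<close>.
    As cumulants they satisfy \<open>m' = V\<close> and \<open>V' = T\<close>.\<close>
  define m where "m s = A 1 s / A 0 s" for s
  define V where "V s = A 2 s / A 0 s - (m s)\<^sup>2" for s
  define T where "T s = A 3 s / A 0 s - 3 * m s * (A 2 s / A 0 s) + 2 * (m s) ^ 3" for s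
  have dm: "(m has_real_derivative V s) (at s)" for s
    unfolding m_def V_def
    by (rule DERIV_cong[OF DERIV_divide[OF dA dA]])
      (use Zpos[of s] in \<open>simp_all add: field_simps power2_eq_square numeral_2_eq_2\<close>)
  have dV: "(V has_real_derivative T s) (at s)" for s
  proof -
    have "((\<lambda>s. A 2 s / A 0 s - (m s)\<^sup>2) has_real_derivative
        (A 3 s * A 0 s - A 2 s * A 1 s) / (A 0 s * A 0 s) - 2 * m s * V s) (at s)"
      using dA[of 2 s] dA[of 0 s] dm[of s] Zpos[of s]
      by (auto intro!: derivative_eq_intros simp: numeral_3_eq_3 numeral_2_eq_2)
    moreover have "(A 3 s * A 0 s - A 2 s * A 1 s) / (A 0 s * A 0 s) - 2 * m s * V s = T s"
      using Zpos[of s] by (simp add: T_def V_def m_def field_simps power2_eq_square power3_eq_cube)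
    ultimately show ?thesis unfolding V_def by simp
  qed
  have Vsum: "V s = (\<Sum>y\<in>Y. b y * exp (s * u y) * (u y - m s)\<^sup>2) / A 0 s" for s
  proof -
    have "(\<Sum>y\<in>Y. b y * exp (s * u y) * (u y - m s)\<^sup>2) = A 2 s - 2 * m s * A 1 s + (m s)\<^sup>2 * A 0 s"
      by (simp add: A_def power2_eq_square algebra_simps sum.distrib sum_subtractf sum_distrib_left)
    moreover have "A 1 s = m s * A 0 s" using Zpos[of s] by (simp add: m_def)
    ultimately show ?thesis using Zpos[of s] by (simp add: V_def field_simps power2_eq_square)
  qed
  have Tsum: "T s = (\<Sum>y\<in>Y. b y * exp (s * u y) * (u y - m s) ^ 3) / A 0 s" for s
  proof -
    have "(\<Sum>y\<in>Y. b y * exp (s * u y) * (u y - m s) ^ 3)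
        = A 3 s - 3 * m s * A 2 s + 3 * (m s)\<^sup>2 * A 1 s - (m s) ^ 3 * A 0 s"
      by (simp add: A_def power2_eq_square power3_eq_cube algebra_simps sum.distrib sum_subtractf sum_distrib_left)
    moreover have "A 1 s = m s * A 0 s" using Zpos[of s] by (simp add: m_def)
    ultimately show ?thesis using Zpos[of s] by (simp add: T_def field_simps power2_eq_square power3_eq_cube)
  qed
  have V0: "V s \<ge> 0" for s
    unfolding Vsum using Zpos[of s] b by (intro divide_nonneg_pos sum_nonneg) (auto simp: less_imp_le)
  have TV: "T s + R * V s \<ge> 0" if s: "0 \<le> s" "s \<le> 1" for s
  proof -
    have below: "u i - m s + R \<ge> 0" if "i \<in> Y" for i
    proof -
      have "(\<Sum>y\<in>Y. b y * exp (s * u y) * (u y - u i)) = A 1 s - u i * A 0 s"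
        by (simp add: A_def algebra_simps sum_subtractf sum_distrib_left)
      moreover have "A 1 s = m s * A 0 s" using Zpos[of s] by (simp add: m_def)
      moreover have "(\<Sum>y\<in>Y. b y * exp (s * u y)) = A 0 s" by (simp add: A_def)
      ultimately have "(m s - u i) * A 0 s \<le> R * A 0 s"
        using gap[OF s that] by (simp add: left_diff_distrib)
      then show ?thesis using Zpos[of s] by (simp add: mult_le_cancel_right)
    qed
    have "T s + R * V s = (\<Sum>y\<in>Y. b y * exp (s * u y) * (u y - m s)\<^sup>2 * (u y - m s + R)) / A 0 s"
      unfolding Vsum Tsum
      by (simp add: add_divide_distrib[symmetric] sum_distrib_left sum.distrib[symmetric] distrib_left
          power2_eq_square power3_eq_cube mult_ac)
    also have "\<dots> \<ge> 0"
      using Zpos[of s] b below by (intro divide_nonneg_pos sum_nonneg mult_nonneg_nonneg) (auto simp: less_imp_le)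
    finally show ?thesis .
  qed
  have Vlow: "V s \<ge> V 0 * exp (- R * s)" if s: "0 \<le> s" "s \<le> 1" for s
  proof -
    have "V 0 * exp (R * 0) \<le> V s * exp (R * s)"
    proof (rule DERIV_nonneg_imp_nondecreasing[OF s(1), of "\<lambda>s. V s * exp (R * s)"])
      fix x assume x: "0 \<le> x" "x \<le> s"
      have "((\<lambda>s. V s * exp (R * s)) has_real_derivative (T x + R * V x) * exp (R * x)) (at x)"
        using dV[of x] by (auto intro!: derivative_eq_intros simp: algebra_simps)
      moreover have "(T x + R * V x) * exp (R * x) \<ge> 0" using TV[of x] x s by simp
      ultimately show "\<exists>y. ((\<lambda>s. V s * exp (R * s)) has_real_derivative y) (at x) \<and> 0 \<le> y" by blast
    qed
    then have "V 0 * exp (- R * s) \<le> V s * (exp (R * s) * exp (- R * s))"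
      by (simp add: mult_right_mono flip: mult.assoc)
    then show ?thesis by (simp flip: exp_add)
  qed
  have mlow: "m s - m 0 - V 0 * (1 - exp (- R * s)) / R \<ge> 0" if s: "0 \<le> s" "s \<le> 1" for s
  proof -
    have "m 0 - m 0 - V 0 * (1 - exp (- R * 0)) / R \<le> m s - m 0 - V 0 * (1 - exp (- R * s)) / R"
    proof (rule DERIV_nonneg_imp_nondecreasing[OF s(1), of "\<lambda>s. m s - m 0 - V 0 * (1 - exp (- R * s)) / R"])
      fix x assume x: "0 \<le> x" "x \<le> s"
      have "((\<lambda>s. m s - m 0 - V 0 * (1 - exp (- R * s)) / R) has_real_derivative V x - V 0 * exp (- R * x)) (at x)"
        using dm[of x] R by (auto intro!: derivative_eq_intros simp: field_simps)
      then show "\<exists>y. ((\<lambda>s. m s - m 0 - V 0 * (1 - exp (- R * s)) / R) has_real_derivative y) (at x) \<and> 0 \<le> y"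
        using Vlow[of x] x s by force
    qed
    then show ?thesis by simp
  qed
  \<comment> \<open>The last term is \<open>V 0\<close> times the double integral of
    \<open>exp (- R s)\<close>, so monotonicity of \<open>?f\<close> is the second integration of
    the variance bound. At \<open>s = 1\<close> the summand \<open>exp (- R)\<close> is dropped,
    which leaves \<open>(R - 1) / R\<^sup>2\<close>.\<close>
  let ?f = "\<lambda>s. ln (A 0 s) - s * m 0 - V 0 * (exp (- R * s) - 1 + R * s) / R\<^sup>2"
  have "?f 0 \<le> ?f 1"
  proof (rule DERIV_nonneg_imp_nondecreasing[of 0 1 ?f])
    fix x :: real assume x: "0 \<le> x" "x \<le> 1"
    have "(?f has_real_derivative m x - m 0 - V 0 * (1 - exp (- R * x)) / R) (at x)"
    proof -
      have "((\<lambda>s. ln (A 0 s)) has_real_derivative m x) (at x)"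
        using DERIV_chain2[OF DERIV_ln_divide[OF Zpos[of x]] dA[of 0 x]] by (simp add: m_def)
      moreover have "((\<lambda>s. g s - s * c - w * (exp (- R * s) - 1 + R * s) / R\<^sup>2)
          has_real_derivative D - c - w * (1 - exp (- R * x)) / R) (at x)"
        if "(g has_real_derivative D) (at x)" for g :: "real \<Rightarrow> real" and c w D
        using R that by (auto intro!: derivative_eq_intros simp: field_simps power2_eq_square)
      ultimately show ?thesis by blast
    qed
    then show "\<exists>y. (?f has_real_derivative y) (at x) \<and> 0 \<le> y" using mlow[OF x] by blast
  qed simp
  moreover have "A 0 0 = 1" "A 0 1 = (\<Sum>y\<in>Y. b y * exp (u y))" "m 0 = (\<Sum>y\<in>Y. b y * u y)"
    "V 0 = (\<Sum>y\<in>Y. b y * (u y)\<^sup>2) - (\<Sum>y\<in>Y. b y * u y)\<^sup>2"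
    by (simp_all add: A_def m_def V_def P)
  moreover have "V 0 * ((R - 1) / R\<^sup>2) \<le> V 0 * (exp (- R * 1) - 1 + R * 1) / R\<^sup>2"
    using V0[of 0] R by (simp add: field_simps)
  ultimately show ?thesis by simp
qed

lemma exp_quadratic_bounds:
  fixes x :: real
  assumes "\<bar>x\<bar> \<le> 1" shows "\<bar>exp x - 1 - x\<bar> \<le> x\<^sup>2"
proof -
  have "exp x \<le> 1 + x + x\<^sup>2"
  proof (cases "x \<ge> 0")
    case True
    then show ?thesis using assms exp_bound[of x] by simp
  next
    case False
    have pos: "1 - x + x\<^sup>2 / 2 > 0" using False by (simp add: add_pos_nonneg)
    have "1 - x + x\<^sup>2 / 2 \<le> exp (- x)"
      using exp_lower_Taylor_quadratic[of "- x"] False by simp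
    then have "exp x \<le> 1 / (1 - x + x\<^sup>2 / 2)"
      using pos by (simp add: exp_minus field_simps)
    also have "\<dots> \<le> 1 + x + x\<^sup>2"
    proof -
      have "(1 + x + x\<^sup>2) * (1 - x + x\<^sup>2 / 2) = 1 + (x\<^sup>2 / 2 + x\<^sup>2 * (- x) / 2 + x\<^sup>2 * x\<^sup>2 / 2)"
        by (simp add: field_simps power2_eq_square)
      moreover have "0 \<le> x\<^sup>2 * (- x)" using False by (intro mult_nonneg_nonneg) auto
      moreover have "0 \<le> x\<^sup>2 * x\<^sup>2" by simp
      moreover have "0 \<le> x\<^sup>2" by simp
      ultimately have "1 \<le> (1 + x + x\<^sup>2) * (1 - x + x\<^sup>2 / 2)" by linarith
      then show ?thesis using pos by (simp only: pos_divide_le_eq)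
    qed
    finally show ?thesis .
  qed
  moreover have "1 + x \<le> exp x" by (rule exp_ge_add_one_self)
  ultimately show ?thesis by linarith
qed

text \<open>The linear response of a mean to an exponential tilt is a covariance. Centering both
  \<open>v\<close> and \<open>q\<close> first makes every error a multiple of the variance of
  \<open>v\<close>, hence of \<open>n\<^sup>2\<close>: the remainder \<open>e\<close> of the
  numerator contributes 4 and the normalizer \<open>W\<close> contributes 1.\<close>

lemma tilted_mean_expansion:
  fixes p v q :: "'i \<Rightarrow> real"
  assumes Y: "finite Y" and p: "\<And>y. y \<in> Y \<Longrightarrow> p y \<ge> 0" "(\<Sum>y\<in>Y. p y) = 1"
    and v: "\<And>y. y \<in> Y \<Longrightarrow> \<bar>v y\<bar> \<le> n" "n \<le> 1 / 20" and q: "\<And>y. y \<in> Y \<Longrightarrow> \<bar>q y\<bar> \<le> 2"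
  shows "\<bar>(\<Sum>y\<in>Y. p y * exp (v y) * q y) / (\<Sum>y\<in>Y. p y * exp (v y)) - (\<Sum>y\<in>Y. p y * q y)
     - ((\<Sum>y\<in>Y. p y * q y * v y) - (\<Sum>y\<in>Y. p y * q y) * (\<Sum>y\<in>Y. p y * v y))\<bar> \<le> 5 * n\<^sup>2"
proof -
  have n0: "n \<ge> 0"
  proof -
    have "Y \<noteq> {}" using p(2) by auto
    then show ?thesis using v(1) by (metis abs_ge_zero all_not_in_conv order_trans)
  qed
  have mean: "\<bar>\<Sum>y\<in>Y. p y * f y\<bar> \<le> B" if "\<And>y. y \<in> Y \<Longrightarrow> \<bar>f y\<bar> \<le> B" for f B
  proof -
    have "\<bar>\<Sum>y\<in>Y. p y * f y\<bar> \<le> (\<Sum>y\<in>Y. \<bar>p y * f y\<bar>)" by (rule sum_abs)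
    also have "\<dots> \<le> (\<Sum>y\<in>Y. p y * B)"
      using p that by (intro sum_mono) (simp add: abs_mult mult_left_mono)
    finally show ?thesis using p(2) by (simp flip: sum_distrib_right)
  qed
  define m where "m = (\<Sum>y\<in>Y. p y * v y)"
  define Q where "Q = (\<Sum>y\<in>Y. p y * q y)"
  have m: "\<bar>m\<bar> \<le> n" and Q: "\<bar>Q\<bar> \<le> 2" unfolding m_def Q_def by (auto intro: mean v q)
  define c where "c y = v y - m" for y
  define k where "k y = q y - Q" for y
  have c: "\<bar>c y\<bar> \<le> 2 * n" and k: "\<bar>k y\<bar> \<le> 4" if "y \<in> Y" for y
    using v(1)[OF that] q[OF that] m Q by (auto simp: c_def k_def)
  define r where "r y = exp (c y) - 1 - c y" for y
  have r: "\<bar>r y\<bar> \<le> (c y)\<^sup>2" if "y \<in> Y" for y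
    unfolding r_def using c[OF that] v(2) by (intro exp_quadratic_bounds) auto
  have r0: "r y \<ge> 0" for y
    unfolding r_def using exp_ge_add_one_self[of "c y"] by linarith
  have sc: "(\<Sum>y\<in>Y. p y * c y) = 0" and sk: "(\<Sum>y\<in>Y. p y * k y) = 0"
    using p(2) by (simp_all add: c_def k_def m_def Q_def right_diff_distrib sum_subtractf flip: sum_distrib_right)
  have var: "(\<Sum>y\<in>Y. p y * (c y)\<^sup>2) \<le> n\<^sup>2"
  proof -
    have "(\<Sum>y\<in>Y. p y * (c y)\<^sup>2) = (\<Sum>y\<in>Y. p y * (v y)\<^sup>2) - 2 * m * (\<Sum>y\<in>Y. p y * v y) + m\<^sup>2 * (\<Sum>y\<in>Y. p y)"
      by (simp add: c_def power2_diff algebra_simps sum.distrib sum_subtractf sum_distrib_left sum_distrib_right)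
    also have "\<dots> \<le> (\<Sum>y\<in>Y. p y * (v y)\<^sup>2)" using p(2) by (simp add: m_def power2_eq_square)
    also have "\<dots> \<le> n\<^sup>2"
    proof -
      have "\<bar>(v y)\<^sup>2\<bar> \<le> n\<^sup>2" if "y \<in> Y" for y
        using v(1)[OF that] n0 by (simp add: abs_le_square_iff[symmetric])
      from mean[of "\<lambda>y. (v y)\<^sup>2", OF this] show ?thesis by linarith
    qed
    finally show ?thesis .
  qed
  define C where "C = (\<Sum>y\<in>Y. p y * c y * k y)"
  define W where "W = (\<Sum>y\<in>Y. p y * exp (c y))"
  define e where "e = (\<Sum>y\<in>Y. p y * r y * k y)"
  have W: "W = 1 + (\<Sum>y\<in>Y. p y * r y)"
  proof -
    have "W = (\<Sum>y\<in>Y. p y + p y * c y + p y * r y)"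
      unfolding W_def by (intro sum.cong) (simp_all add: r_def algebra_simps)
    then show ?thesis using sc p(2) by (simp add: sum.distrib)
  qed
  have sr: "0 \<le> (\<Sum>y\<in>Y. p y * r y)" "(\<Sum>y\<in>Y. p y * r y) \<le> n\<^sup>2"
  proof -
    show "0 \<le> (\<Sum>y\<in>Y. p y * r y)" using p r0 by (intro sum_nonneg) auto
    have "(\<Sum>y\<in>Y. p y * r y) \<le> (\<Sum>y\<in>Y. p y * (c y)\<^sup>2)"
      using p r by (intro sum_mono mult_left_mono) (auto simp: abs_le_iff)
    then show "(\<Sum>y\<in>Y. p y * r y) \<le> n\<^sup>2" using var by linarith
  qed
  have num: "(\<Sum>y\<in>Y. p y * exp (c y) * k y) = C + e"
  proof -
    have "(\<Sum>y\<in>Y. p y * exp (c y) * k y) = (\<Sum>y\<in>Y. p y * k y + p y * c y * k y + p y * r y * k y)"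
      by (intro sum.cong) (simp_all add: r_def algebra_simps)
    then show ?thesis using sk by (simp add: sum.distrib C_def e_def)
  qed
  have e: "\<bar>e\<bar> \<le> 4 * n\<^sup>2"
  proof -
    have "\<bar>e\<bar> \<le> (\<Sum>y\<in>Y. \<bar>p y * r y * k y\<bar>)" unfolding e_def by (rule sum_abs)
    also have "\<dots> \<le> (\<Sum>y\<in>Y. p y * r y * 4)"
      using p r0 k by (intro sum_mono) (simp add: abs_mult mult_left_mono)
    finally show ?thesis using sr(2) by (simp flip: sum_distrib_right)
  qed
  have C: "\<bar>C\<bar> \<le> 1"
  proof -
    have "\<bar>c y * k y\<bar> \<le> 1" if "y \<in> Y" for y
      using mult_mono[OF c[OF that] k[OF that]] n0 v(2) by (simp add: abs_mult)
    then show ?thesis using mean[of "\<lambda>y. c y * k y" 1] by (simp add: C_def mult.assoc)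
  qed
  have "(\<Sum>y\<in>Y. p y * exp (v y) * q y) / (\<Sum>y\<in>Y. p y * exp (v y)) = (C + e) / W + Q"
  proof -
    have ev: "exp (v y) = exp m * exp (c y)" for y by (simp add: c_def flip: exp_add)
    have "(\<Sum>y\<in>Y. p y * exp (v y) * q y) = exp m * ((C + e) + Q * W)"
      unfolding num[symmetric] W_def
      by (simp add: ev k_def algebra_simps sum_subtractf sum_distrib_left)
    moreover have "(\<Sum>y\<in>Y. p y * exp (v y)) = exp m * W"
      unfolding W_def by (simp add: ev sum_distrib_left mult_ac)
    moreover have "W > 0" using W sr by linarith
    ultimately show ?thesis by (simp add: field_simps)
  qed
  moreover have "(\<Sum>y\<in>Y. p y * q y * v y) - Q * m = C"
  proof -
    have "C = (\<Sum>y\<in>Y. p y * q y * v y) - m * (\<Sum>y\<in>Y. p y * q y) - Q * (\<Sum>y\<in>Y. p y * v y) + Q * m * (\<Sum>y\<in>Y. p y)"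
      unfolding C_def c_def k_def by (simp add: algebra_simps sum.distrib sum_subtractf sum_distrib_left)
    then show ?thesis using p(2) by (simp add: m_def Q_def)
  qed
  moreover have "\<bar>(C + e) / W - C\<bar> \<le> 5 * n\<^sup>2"
  proof -
    have W1: "W \<ge> 1" using W sr by linarith
    have "(C + e) / W - C = (e - C * (W - 1)) / W" using W1 by (simp add: field_simps)
    also have "\<bar>\<dots>\<bar> = \<bar>e - C * (W - 1)\<bar> / W" using W1 by simp
    also have "\<dots> \<le> \<bar>e - C * (W - 1)\<bar>" using W1 using divide_left_mono[of 1 W "\<bar>e - C * (W - 1)\<bar>"] by simp
    also have "\<dots> \<le> \<bar>e\<bar> + \<bar>C\<bar> * (W - 1)" using W1 abs_triangle_ineq4[of e "C * (W - 1)"] by (simp add: abs_mult)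
    also have "\<dots> \<le> 4 * n\<^sup>2 + 1 * n\<^sup>2" using e C W sr by (intro add_mono mult_mono) auto
    finally show ?thesis by simp
  qed
  ultimately show ?thesis by (simp add: m_def[symmetric] Q_def[symmetric])
qed

section \<open>Quadratic minimization over the unit ball\<close>

lemma param_ballD: "w \<in> param_ball d \<Longrightarrow> w \<in> carrier_vec d" "w \<in> param_ball d \<Longrightarrow> w \<bullet> w \<le> 1"
  by (auto simp: param_ball_def vnorm_def)

lemma param_ballI: "w \<in> carrier_vec d \<Longrightarrow> w \<bullet> w \<le> 1 \<Longrightarrow> w \<in> param_ball d"
  by (auto simp: param_ball_def vnorm_def)

lemma param_ball_segment:
  assumes "w \<in> param_ball d" "u \<in> param_ball d" "0 \<le> s" "s \<le> 1"
  shows "w + s \<cdot>\<^sub>v (u - w) \<in> param_ball d"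
proof (rule param_ballI)
  note c = param_ballD(1)[OF assms(1)] param_ballD(1)[OF assms(2)]
  have vn: "vnorm w \<le> 1" "vnorm u \<le> 1" using assms by (auto simp: param_ball_def)
  have "\<bar>w \<bullet> u\<bar> \<le> 1"
    using cauchy_schwarz_vnorm[OF c] mult_le_one[OF vn(1) _ vn(2)] by simp
  then have "2 * (s * (1 - s)) * (w \<bullet> u) \<le> 2 * (s * (1 - s)) * 1"
    using assms(3,4) by (intro mult_left_mono) auto
  moreover have "(w + s \<cdot>\<^sub>v (u - w)) \<bullet> (w + s \<cdot>\<^sub>v (u - w))
      = (1 - s)\<^sup>2 * (w \<bullet> w) + 2 * (s * (1 - s)) * (w \<bullet> u) + s\<^sup>2 * (u \<bullet> u)"
    using c comm_scalar_prod[OF c]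
    by (simp add: add_scalar_prod_distrib[of _ d] minus_scalar_prod_distrib[of _ d]
      scalar_prod_add_distrib[of _ d] scalar_prod_minus_distrib[of _ d] power2_eq_square field_simps)
  moreover have "(1 - s)\<^sup>2 * (w \<bullet> w) \<le> (1 - s)\<^sup>2 * 1" "s\<^sup>2 * (u \<bullet> u) \<le> s\<^sup>2 * 1"
    using param_ballD(2) assms(1,2) by (intro mult_left_mono; simp)+
  ultimately show "(w + s \<cdot>\<^sub>v (u - w)) \<bullet> (w + s \<cdot>\<^sub>v (u - w)) \<le> 1"
    by (simp add: power2_eq_square algebra_simps)
qed (use assms param_ballD in auto)

text \<open>Compactness is obtained by identifying a vector with the function on the naturals that
  is 0 from coordinate \<open>d\<close> on. The ball then is a closed subset of a product of compact
  intervals, on which the objective is a polynomial in finitely many coordinates.\<close>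

lemma quadratic_attains_min_on_ball:
  assumes "A \<in> carrier_mat d d" "g \<in> carrier_vec d" "w \<in> carrier_vec d"
  shows "\<exists>v\<in>param_ball d. \<forall>u\<in>param_ball d.
     g \<bullet> v + c * bil A (v - w) (v - w) \<le> g \<bullet> u + c * bil A (u - w) (u - w)"
proof -
  let ?I = "\<lambda>i. if i < d then {-1..1::real} else {0}"
  define B where "B = Pi\<^sub>E UNIV ?I \<inter> {x. (\<Sum>i<d. (x i)\<^sup>2) \<le> 1}"
  define F where "F x = (\<Sum>i<d. g $ i * x i) + c * (\<Sum>i<d. \<Sum>j<d. (x i - w $ i) * A $$ (i, j) * (x j - w $ j))" for x
  have co: "continuous_on T (\<lambda>x. x i)" for T :: "(nat \<Rightarrow> real) set" and i
    by (rule continuous_on_subset[OF continuous_on_product_coordinates]) simp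
  have "compact (Pi\<^sub>E UNIV ?I)"
  proof -
    have "compactin (product_topology (\<lambda>_. euclidean) UNIV) (Pi\<^sub>E UNIV ?I)"
      by (subst compactin_PiE) auto
    then show ?thesis by (simp add: euclidean_product_topology)
  qed
  moreover have "closed {x :: nat \<Rightarrow> real. (\<Sum>i<d. (x i)\<^sup>2) \<le> 1}"
    by (intro closed_Collect_le continuous_intros co)
  ultimately have "compact B" unfolding B_def by (rule compact_Int_closed)
  moreover have "B \<noteq> {}"
  proof -
    have "(\<lambda>_. 0) \<in> B" by (auto simp: B_def)
    then show ?thesis by blast
  qed
  moreover have "continuous_on B F"
    unfolding F_def by (intro continuous_intros co)
  ultimately have "\<exists>x\<in>B. \<forall>y\<in>B. F x \<le> F y" by (rule continuous_attains_inf)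
  then obtain x where x: "x \<in> B" "\<And>y. y \<in> B \<Longrightarrow> F x \<le> F y"
    by auto
  have F: "g \<bullet> u + c * bil A (u - w) (u - w) = F (\<lambda>i. if i < d then u $ i else 0)"
    if "u \<in> carrier_vec d" for u
    using that assms by (subst bil_sum[of _ d]) (auto simp: F_def scalar_prod_def lessThan_atLeast0)
  have memB: "(\<lambda>i. if i < d then u $ i else 0) \<in> B" if "u \<in> param_ball d" for u
  proof -
    have c: "u \<in> carrier_vec d" and n: "(\<Sum>i<d. (u $ i)\<^sup>2) \<le> 1"
      using param_ballD[OF that] by (auto simp: scalar_prod_def lessThan_atLeast0 power2_eq_square)
    have "\<bar>u $ i\<bar> \<le> 1" if "i < d" for i
    proof -
      have "(u $ i)\<^sup>2 \<le> (\<Sum>i<d. (u $ i)\<^sup>2)" using that by (intro member_le_sum) auto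
      then have "(u $ i)\<^sup>2 \<le> 1" using n by simp
      then show ?thesis by (simp add: abs_square_le_1)
    qed
    then have "- 1 \<le> u $ i \<and> u $ i \<le> 1" if "i < d" for i using that by (simp add: abs_le_iff)
    then show ?thesis using n by (auto simp: B_def)
  qed
  have xv: "vec d x \<in> param_ball d"
    using x(1) by (intro param_ballI) (auto simp: B_def scalar_prod_def lessThan_atLeast0 power2_eq_square)
  have "x = (\<lambda>i. if i < d then vec d x $ i else 0)"
    using x(1) by (auto simp: B_def PiE_iff fun_eq_iff split: if_splits)
  then have "F x = g \<bullet> vec d x + c * bil A (vec d x - w) (vec d x - w)"
    using F[of "vec d x"] by simp
  then show ?thesis
    using xv x(2) memB F param_ballD(1) by (intro bexI[of _ "vec d x"]) auto
qed

text \<open>First-order optimality on a convex set: if the directional derivative \<open>L\<close>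
  were negative, a short step along the segment from \<open>v\<close> to \<open>u\<close> would
  lower the objective.\<close>

lemma quadratic_min_variational:
  assumes A: "spd d A" and c: "g \<in> carrier_vec d" "w \<in> carrier_vec d" and e: "e > 0"
    and v: "v \<in> param_ball d" and u: "u \<in> param_ball d"
    and min: "\<And>u. u \<in> param_ball d \<Longrightarrow> g \<bullet> v + 1 / (2 * e) * bil A (v - w) (v - w)
        \<le> g \<bullet> u + 1 / (2 * e) * bil A (u - w) (u - w)"
  shows "0 \<le> g \<bullet> (u - v) + bil A (v - w) (u - v) / e"
proof (rule ccontr)
  assume neg: "\<not> ?thesis"
  note Ac = spd_carrier[OF A] and vc = param_ballD(1)[OF v] and uc = param_ballD(1)[OF u]
  define L where "L = g \<bullet> (u - v) + bil A (v - w) (u - v) / e"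
  define M where "M = bil A (u - v) (u - v) / (2 * e)"
  have M0: "M \<ge> 0" unfolding M_def using spd_nonneg[OF A, of "u - v"] vc uc e by auto
  have step: "0 \<le> s * (L + s * M)" if s: "0 \<le> s" "s \<le> 1" for s
  proof -
    let ?h = "u - v"
    have h: "?h \<in> carrier_vec d" "v - w \<in> carrier_vec d" using vc uc c by auto
    have eq: "v + s \<cdot>\<^sub>v ?h - w = (v - w) + s \<cdot>\<^sub>v ?h" using vc uc c by auto
    have "bil A ((v - w) + s \<cdot>\<^sub>v ?h) ((v - w) + s \<cdot>\<^sub>v ?h)
       = bil A (v - w) (v - w) + 2 * s * bil A (v - w) ?h + s * s * bil A ?h ?h"
      using h Ac by (simp add: bil_linear[of _ d] spd_swap[OF A h] distrib_left)
    moreover have "g \<bullet> (v + s \<cdot>\<^sub>v ?h) = g \<bullet> v + s * (g \<bullet> ?h)"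
      using c vc h by (simp add: scalar_prod_add_distrib[of _ d])
    ultimately have "g \<bullet> v + 1 / (2 * e) * bil A (v - w) (v - w) \<le> g \<bullet> v + s * (g \<bullet> ?h)
       + 1 / (2 * e) * (bil A (v - w) (v - w) + 2 * s * bil A (v - w) ?h + s * s * bil A ?h ?h)"
      using min[OF param_ball_segment[OF v u s]] by (simp add: eq)
    then have "0 \<le> s * (g \<bullet> ?h) + 1 / (2 * e) * (2 * s * bil A (v - w) ?h + s * s * bil A ?h ?h)"
      by (simp add: distrib_left)
    also have "\<dots> = s * (L + s * M)" using e by (simp add: L_def M_def field_simps)
    finally show ?thesis .
  qed
  \<comment> \<open>At most 1, so that the point stays on the segment, and short enough that
    \<open>s * M\<close> cannot outweigh half of \<open>L\<close>.\<close>
  define s where "s = min 1 (- L / (2 * (M + 1)))"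
  have L: "L < 0" using neg by (simp add: L_def)
  have s: "0 < s" "s \<le> 1" "s \<le> - L / (2 * (M + 1))" using L M0 by (auto simp: s_def field_simps)
  have "s * (M + 1) \<le> - L / 2" using s(3) M0 by (simp add: field_simps)
  then have "L + s * M < 0" using s L by (simp add: distrib_left)
  then have "s * (L + s * M) < 0" using s(1) by (simp add: mult_pos_neg)
  then show False using step[of s] s by simp
qed

text \<open>Gives meaning to the \<open>THE\<close> in the update. The variational inequalities of
  two minimizers, each tested at the other, add up to
  \<open>0 \<le> - bil A (u - v) (u - v) / e\<close>.\<close>

lemma quadratic_min_unique:
  assumes A: "spd d A" and c: "g \<in> carrier_vec d" "w \<in> carrier_vec d" and e: "e > 0"
  shows "\<exists>!v. v \<in> param_ball d \<and> (\<forall>u\<in>param_ball d. g \<bullet> v + 1 / (2 * e) * bil A (v - w) (v - w)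
        \<le> g \<bullet> u + 1 / (2 * e) * bil A (u - w) (u - w))"
proof -
  let ?P = "\<lambda>v. v \<in> param_ball d \<and> (\<forall>u\<in>param_ball d. g \<bullet> v + 1 / (2 * e) * bil A (v - w) (v - w)
        \<le> g \<bullet> u + 1 / (2 * e) * bil A (u - w) (u - w))"
  have "\<exists>v. ?P v" using quadratic_attains_min_on_ball[OF spd_carrier[OF A] c] by blast
  moreover have "v = u" if "?P v" "?P u" for v u
  proof (rule ccontr)
    assume "v \<noteq> u"
    note Ac = spd_carrier[OF A]
    have vu: "v \<in> carrier_vec d" "u \<in> carrier_vec d" using that param_ballD by auto
    have "u - v \<noteq> 0\<^sub>v d"
    proof
      assume "u - v = 0\<^sub>v d"
      then have "(u - v) $ i = 0" if "i < d" for i using that by simp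
      then have "u = v" using vu by (intro eq_vecI) auto
      then show False using \<open>v \<noteq> u\<close> by simp
    qed
    then have "bil A (u - v) (u - v) > 0" using spd_pos[OF A, of "u - v"] vu by simp
    moreover have "0 \<le> g \<bullet> (u - v) + bil A (v - w) (u - v) / e"
      using that by (intro quadratic_min_variational[OF A c e]) auto
    moreover have "0 \<le> g \<bullet> (v - u) + bil A (u - w) (v - u) / e"
      using that by (intro quadratic_min_variational[OF A c e]) auto
    moreover have "g \<bullet> (u - v) + bil A (v - w) (u - v) / e + (g \<bullet> (v - u) + bil A (u - w) (v - u) / e)
        = - bil A (u - v) (u - v) / e"
      using vu c Ac e by (simp add: bil_linear[of _ d] scalar_prod_minus_distrib[of _ d] field_simps)
    ultimately show False using e by (smt (verit) divide_pos_pos minus_divide_left)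
  qed
  ultimately show ?thesis by blast
qed

section \<open>One round of the multinomial logit model\<close>

lemma bil_sum_outer:
  fixes X W :: "'k \<Rightarrow> nat \<Rightarrow> real"
  assumes "finite T"
  shows "(\<Sum>a<d. \<Sum>b<d. u a * (\<Sum>k\<in>T. c k * X k a * W k b) * v b)
    = (\<Sum>k\<in>T. c k * (\<Sum>a<d. X k a * u a) * (\<Sum>b<d. W k b * v b))"
proof -
  have "(\<Sum>a<d. \<Sum>b<d. u a * (\<Sum>k\<in>T. c k * X k a * W k b) * v b)
     = (\<Sum>a<d. \<Sum>b<d. \<Sum>k\<in>T. c k * ((X k a * u a) * (W k b * v b)))"
    by (simp add: sum_distrib_left sum_distrib_right mult_ac)
  also have "\<dots> = (\<Sum>a<d. \<Sum>k\<in>T. \<Sum>b<d. c k * ((X k a * u a) * (W k b * v b)))"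
    by (intro sum.cong refl sum.swap)
  also have "\<dots> = (\<Sum>k\<in>T. \<Sum>a<d. \<Sum>b<d. c k * ((X k a * u a) * (W k b * v b)))"
    by (rule sum.swap)
  also have "\<dots> = (\<Sum>k\<in>T. c k * (\<Sum>a<d. X k a * u a) * (\<Sum>b<d. W k b * v b))"
    by (intro sum.cong refl) (simp only: mult.assoc sum_product, simp only: sum_distrib_left mult.assoc)
  finally show ?thesis .
qed

lemma sq_scalar_prod_le:
  assumes "x \<in> carrier_vec d" "vnorm x \<le> 1" "v \<in> carrier_vec d"
  shows "\<bar>x \<bullet> v\<bar> \<le> vnorm v" "(x \<bullet> v)\<^sup>2 \<le> v \<bullet> v"
proof -
  show 1: "\<bar>x \<bullet> v\<bar> \<le> vnorm v"
    using cauchy_schwarz_vnorm[OF assms(1,3)] mult_right_mono[OF assms(2), of "vnorm v"] by simp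
  then have "\<bar>x \<bullet> v\<bar>\<^sup>2 \<le> (vnorm v)\<^sup>2" by (intro power_mono) auto
  then show "(x \<bullet> v)\<^sup>2 \<le> v \<bullet> v" by (simp add: vnorm_sq)
qed

locale mnl_round =
  fixes v0 :: real and d :: nat and xs :: "nat \<Rightarrow> real vec" and S :: "nat set"
  assumes v0: "v0 > 0" and finS: "finite S" and S0: "0 \<notin> S"
    and xs: "\<And>i. xs i \<in> carrier_vec d" "\<And>i. vnorm (xs i) \<le> 1"
begin

text \<open>The outside option is treated as an item with zero feature and prior weight \<open>v0\<close>.\<close>
definition Y :: "nat set" where "Y = insert 0 S"
definition f :: "nat \<Rightarrow> real vec" where "f i = (if i = 0 then 0\<^sub>v d else xs i)"
definition bw :: "nat \<Rightarrow> real" where "bw i = (if i = 0 then v0 else 1)"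
definition Zs :: "real vec \<Rightarrow> real" where "Zs w = (\<Sum>j\<in>Y. bw j * exp (f j \<bullet> w))"
abbreviation p :: "real vec \<Rightarrow> nat \<Rightarrow> real" where "p w i \<equiv> mnl_prob v0 xs S w i"
abbreviation G :: "real vec \<Rightarrow> real mat" where "G w \<equiv> Gmat v0 d xs S w"
abbreviation loss :: "nat \<Rightarrow> real vec \<Rightarrow> real" where "loss y w \<equiv> mnl_loss v0 xs S y w"
definition xbar :: "real vec \<Rightarrow> real vec" where "xbar w = vec d (\<lambda>j. \<Sum>i\<in>Y. p w i * f i $ j)"

lemma finY[simp]: "finite Y" and Y_ne[simp]: "Y \<noteq> {}" and Y0[simp]: "0 \<in> Y"
  using finS by (auto simp: Y_def)

lemma sum_Y: "(\<Sum>i\<in>Y. h i) = h 0 + (\<Sum>i\<in>S. h i)" for h :: "nat \<Rightarrow> real"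
  using finS S0 by (simp add: Y_def)

lemma f_carrier[simp]: "f i \<in> carrier_vec d"
  using xs by (simp add: f_def)

lemma f_dim[simp]: "dim_vec (f i) = d"
  by (rule carrier_vecD[OF f_carrier])

lemma f_norm: "vnorm (f i) \<le> 1"
  using xs by (simp add: f_def vnorm_def)

lemma f_zero[simp]: "f 0 = 0\<^sub>v d" and f_item: "i \<in> S \<Longrightarrow> f i = xs i"
  using S0 by (auto simp: f_def)

lemmas f_dot = sq_scalar_prod_le[OF f_carrier f_norm]

lemma f_dot_ball: "w \<in> param_ball d \<Longrightarrow> \<bar>f i \<bullet> w\<bar> \<le> 1"
  using f_dot(1)[of w i] by (auto simp: param_ball_def)

lemma bw_pos[simp]: "bw i > 0" using v0 by (simp add: bw_def)

lemma Zs_pos: "Zs w > 0"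
  unfolding Zs_def by (intro sum_pos) auto

lemma Zs_eq: "w \<in> carrier_vec d \<Longrightarrow> Zs w = v0 + (\<Sum>j\<in>S. exp (xs j \<bullet> w))"
  unfolding Zs_def sum_Y using S0
  by (auto simp: bw_def f_item scalar_prod_left_zero[of _ d] intro!: sum.cong)

lemma p_eq: "w \<in> carrier_vec d \<Longrightarrow> i \<in> Y \<Longrightarrow> p w i = bw i * exp (f i \<bullet> w) / Zs w"
  unfolding Zs_eq mnl_prob_def Y_def using S0
  by (auto simp: bw_def f_item scalar_prod_left_zero[of _ d])

lemma p_pos: "w \<in> carrier_vec d \<Longrightarrow> i \<in> Y \<Longrightarrow> p w i > 0"
  by (simp add: p_eq Zs_pos)

lemma p_sum: "w \<in> carrier_vec d \<Longrightarrow> (\<Sum>i\<in>Y. p w i) = 1"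
  using Zs_pos[of w] by (simp add: p_eq sum_divide_distrib[symmetric]) (simp add: Zs_def)

lemma p_sum_S: "w \<in> carrier_vec d \<Longrightarrow> (\<Sum>i\<in>S. p w i) = 1 - p w 0"
  using p_sum[of w] by (simp add: sum_Y)

lemma Zs_tilt:
  assumes "w \<in> carrier_vec d" "u \<in> carrier_vec d"
  shows "Zs u = Zs w * (\<Sum>j\<in>Y. p w j * exp (f j \<bullet> (u - w)))"
proof -
  have "Zs u = (\<Sum>j\<in>Y. Zs w * (p w j * exp (f j \<bullet> (u - w))))"
    unfolding Zs_def[of u]
  proof (intro sum.cong refl)
    fix j assume "j \<in> Y"
    then show "bw j * exp (f j \<bullet> u) = Zs w * (p w j * exp (f j \<bullet> (u - w)))"
      using Zs_pos[of w] assms by (simp add: p_eq scalar_prod_minus_distrib[of _ d] exp_diff)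
  qed
  then show ?thesis by (simp add: sum_distrib_left)
qed

lemma p_tilt:
  assumes "w \<in> carrier_vec d" "u \<in> carrier_vec d" "i \<in> Y"
  shows "p u i = p w i * exp (f i \<bullet> (u - w)) / (\<Sum>j\<in>Y. p w j * exp (f j \<bullet> (u - w)))"
proof -
  have "p u i = bw i * exp (f i \<bullet> u) / (Zs w * (\<Sum>j\<in>Y. p w j * exp (f j \<bullet> (u - w))))"
    using assms by (simp add: p_eq[OF assms(2,3)] Zs_tilt[OF assms(1,2)])
  moreover have "bw i * exp (f i \<bullet> u) = Zs w * (p w i * exp (f i \<bullet> (u - w)))"
    using Zs_pos[of w] assms by (simp add: p_eq scalar_prod_minus_distrib[of _ d] exp_diff)
  ultimately show ?thesis using Zs_pos[of w] by simp
qed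

lemma xbar_carrier[simp]: "xbar w \<in> carrier_vec d"
  by (simp add: xbar_def)

lemma xbar_dot: "u \<in> carrier_vec d \<Longrightarrow> xbar w \<bullet> u = (\<Sum>i\<in>Y. p w i * (f i \<bullet> u))"
proof -
  assume u: "u \<in> carrier_vec d"
  have "xbar w \<bullet> u = (\<Sum>j<d. \<Sum>i\<in>Y. p w i * (f i $ j * u $ j))"
    using u by (simp add: xbar_def scalar_prod_def lessThan_atLeast0 sum_distrib_right mult.assoc)
  also have "\<dots> = (\<Sum>i\<in>Y. \<Sum>j<d. p w i * (f i $ j * u $ j))" by (rule sum.swap)
  finally show ?thesis using u by (simp add: scalar_prod_def lessThan_atLeast0 sum_distrib_left)
qed

lemma G_carrier[simp]: "G w \<in> carrier_mat d d"
  by (simp add: Gmat_def)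

lemma bil_G:
  assumes u: "u \<in> carrier_vec d" and v: "v \<in> carrier_vec d"
  shows "bil (G w) u v = (\<Sum>i\<in>Y. p w i * (f i \<bullet> u) * (f i \<bullet> v)) - (xbar w \<bullet> u) * (xbar w \<bullet> v)"
proof -
  have dot: "xs i \<bullet> z = (\<Sum>a<d. xs i $ a * z $ a)" if "z \<in> carrier_vec d" for i z
    using that by (simp add: scalar_prod_def lessThan_atLeast0)
  have "bil (G w) u v = (\<Sum>a<d. \<Sum>b<d. u $ a * (\<Sum>i\<in>S. p w i * xs i $ a * xs i $ b) * v $ b)
     - (\<Sum>a<d. \<Sum>b<d. u $ a * (\<Sum>k\<in>S \<times> S. (p w (fst k) * p w (snd k)) * xs (fst k) $ a * xs (snd k) $ b) * v $ b)"
    using assms by (subst bil_sum[of _ d])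
     (simp_all add: Gmat_def sum.cartesian_product case_prod_beta right_diff_distrib left_diff_distrib sum_subtractf)
  also have "\<dots> = (\<Sum>i\<in>S. p w i * (xs i \<bullet> u) * (xs i \<bullet> v))
     - (\<Sum>k\<in>S \<times> S. (p w (fst k) * p w (snd k)) * (xs (fst k) \<bullet> u) * (xs (snd k) \<bullet> v))"
    using finS by (simp add: bil_sum_outer dot u v)
  also have "(\<Sum>k\<in>S \<times> S. (p w (fst k) * p w (snd k)) * (xs (fst k) \<bullet> u) * (xs (snd k) \<bullet> v))
     = (\<Sum>i\<in>S. p w i * (xs i \<bullet> u)) * (\<Sum>i\<in>S. p w i * (xs i \<bullet> v))"
    by (simp add: sum_product sum.cartesian_product case_prod_beta mult_ac)
  also have "(\<Sum>i\<in>S. p w i * (xs i \<bullet> u)) = xbar w \<bullet> u"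
    using u by (simp add: xbar_dot sum_Y f_item scalar_prod_left_zero[of _ d])
  also have "(\<Sum>i\<in>S. p w i * (xs i \<bullet> v)) = xbar w \<bullet> v"
    using v by (simp add: xbar_dot sum_Y f_item scalar_prod_left_zero[of _ d])
  also have "(\<Sum>i\<in>S. p w i * (xs i \<bullet> u) * (xs i \<bullet> v)) = (\<Sum>i\<in>Y. p w i * (f i \<bullet> u) * (f i \<bullet> v))"
    using u v by (simp add: sum_Y f_item scalar_prod_left_zero[of _ d])
  finally show ?thesis .
qed

text \<open>\<open>G w\<close> is the covariance matrix of the feature of a random choice, the
  outside option included. In this form it is a sum of rank-one updates, as the determinant bound
  requires.\<close>

lemma bil_G_centered:
  assumes w: "w \<in> carrier_vec d" and u: "u \<in> carrier_vec d" and v: "v \<in> carrier_vec d"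
  shows "bil (G w) u v = (\<Sum>i\<in>Y. p w i * ((f i - xbar w) \<bullet> u) * ((f i - xbar w) \<bullet> v))"
proof -
  have "(\<Sum>i\<in>Y. p w i * ((f i - xbar w) \<bullet> u) * ((f i - xbar w) \<bullet> v))
     = (\<Sum>i\<in>Y. p w i * (f i \<bullet> u) * (f i \<bullet> v)) - (xbar w \<bullet> u) * (\<Sum>i\<in>Y. p w i * (f i \<bullet> v))
       - (\<Sum>i\<in>Y. p w i * (f i \<bullet> u)) * (xbar w \<bullet> v) + (xbar w \<bullet> u) * (xbar w \<bullet> v) * (\<Sum>i\<in>Y. p w i)"
    using u v by (simp add: minus_scalar_prod_distrib[of _ d] sum_distrib_left sum_distrib_right
       sum.distrib sum_subtractf left_diff_distrib right_diff_distrib mult_ac)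
  then show ?thesis using w u v by (simp add: bil_G p_sum flip: xbar_dot)
qed

lemma bil_G_swap: "u \<in> carrier_vec d \<Longrightarrow> v \<in> carrier_vec d \<Longrightarrow> bil (G w) u v = bil (G w) v u"
  by (simp add: bil_G mult_ac)

lemma bil_G_bounds:
  assumes w: "w \<in> carrier_vec d" and v: "v \<in> carrier_vec d"
  shows "0 \<le> bil (G w) v v" "bil (G w) v v \<le> v \<bullet> v"
proof -
  show "0 \<le> bil (G w) v v"
    unfolding bil_G_centered[OF w v v] using p_pos[OF w] by (intro sum_nonneg) (simp add: mult.assoc less_imp_le)
  have "bil (G w) v v \<le> (\<Sum>i\<in>Y. p w i * (f i \<bullet> v)\<^sup>2)"
    unfolding bil_G[OF v v] by (simp add: power2_eq_square mult.assoc)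
  also have "\<dots> \<le> (\<Sum>i\<in>Y. p w i * (v \<bullet> v))"
    using p_pos[OF w] f_dot(2)[OF v] by (intro sum_mono mult_left_mono) (auto simp: less_imp_le)
  finally show "bil (G w) v v \<le> v \<bullet> v" using p_sum[OF w] by (simp flip: sum_distrib_right)
qed

lemma loss_eq: "y \<in> Y \<Longrightarrow> loss y w = - ln (p w y)"
  unfolding mnl_loss_def Y_def using finS by (simp add: if_distrib[of "\<lambda>c. c * _"] sum.delta cong: if_cong)

lemma ln_p: "w \<in> carrier_vec d \<Longrightarrow> y \<in> Y \<Longrightarrow> ln (p w y) = ln (bw y) + f y \<bullet> w - ln (Zs w)"
  using Zs_pos[of w] less_imp_neq[OF bw_pos[of y]] by (auto simp: p_eq ln_div ln_mult)

lemma vgrad_loss: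
  assumes w: "w \<in> carrier_vec d" and y: "y \<in> Y"
  shows "vgrad d (mnl_loss v0 xs S y) w = xbar w - f y"
proof (rule eq_vecI)
  fix j assume "j < dim_vec (xbar w - f y)"
  then have j: "j < d" by simp
  let ?g = "\<lambda>s. w + s \<cdot>\<^sub>v unit_vec d j"
  have dot: "f i \<bullet> ?g s = f i \<bullet> w + s * f i $ j" for i s
    using w j by (simp add: scalar_prod_add_distrib[of _ d])
  have "((\<lambda>s. Zs (?g s)) has_real_derivative (\<Sum>i\<in>Y. bw i * (exp (f i \<bullet> w) * f i $ j))) (at 0)"
    unfolding Zs_def dot by (auto intro!: derivative_eq_intros sum.cong)
  then have "((\<lambda>s. ln (Zs (?g s))) has_real_derivative (1 / Zs (?g 0)) * (\<Sum>i\<in>Y. bw i * (exp (f i \<bullet> w) * f i $ j))) (at 0)"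
    by (rule DERIV_chain2[where f = ln and g = "\<lambda>s. Zs (?g s)", OF DERIV_ln_divide[OF Zs_pos]])
  moreover have "?g 0 = w" using w by auto
  ultimately have "((\<lambda>s. ln (Zs (?g s))) has_real_derivative (\<Sum>i\<in>Y. bw i * (exp (f i \<bullet> w) * f i $ j)) / Zs w) (at 0)"
    by simp
  also have "(\<Sum>i\<in>Y. bw i * (exp (f i \<bullet> w) * f i $ j)) / Zs w = xbar w $ j"
    using j w by (simp add: xbar_def p_eq sum_divide_distrib mult.assoc)
  finally have *: "((\<lambda>s. ln (Zs (?g s))) has_real_derivative xbar w $ j) (at 0)" .
  have "((\<lambda>s. - (c + s * e - h s)) has_real_derivative D - e) (at 0)"
    if "(h has_real_derivative D) (at 0)" for h :: "real \<Rightarrow> real" and c e D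
    using that by (auto intro!: derivative_eq_intros)
  from this[OF *] have "((\<lambda>s. - (ln (bw y) + f y \<bullet> w + s * f y $ j - ln (Zs (?g s)))) has_real_derivative xbar w $ j - f y $ j) (at 0)"
    .
  moreover have "loss y (?g s) = - (ln (bw y) + f y \<bullet> w + s * f y $ j - ln (Zs (?g s)))" for s
    using w y dot[of y s] by (subst loss_eq[OF y], subst ln_p) auto
  ultimately have "((\<lambda>s. loss y (?g s)) has_real_derivative xbar w $ j - f y $ j) (at 0)"
    by simp
  then show "vgrad d (mnl_loss v0 xs S y) w $ j = (xbar w - f y) $ j"
    using j by (simp add: vgrad_def DERIV_imp_deriv)
qed (simp add: vgrad_def)

end

section \<open>Curvature of the loss and the error of linearizing its gradient\<close>

lemma ofu_eta_ge_2: "ofu_eta K \<ge> 2"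
  by (simp add: ofu_eta_def)

context mnl_round
begin

text \<open>Supplies an \<open>R\<close> for \<open>log_partition_lower\<close> whose curvature
  \<open>(R - 1) / R\<^sup>2\<close> reaches \<open>1 / (2 * ofu_eta K)\<close>, where
  \<open>2 * ofu_eta K = ln (K + 1) + 4\<close>. Logit changes lie in \<open>[-2, 2]\<close>, so 4
  always bounds the gap, but its curvature \<open>3/16\<close> is enough only for
  \<open>K \<ge> 3\<close>; smaller \<open>K\<close> need finer gaps.\<close>

lemma softmax_gap:
  assumes K: "1 \<le> K" "card S \<le> K" and w: "w \<in> param_ball d" and u: "u \<in> param_ball d"
  obtains R :: real where "R > 0" "1 / (2 * ofu_eta K) \<le> (R - 1) / R\<^sup>2"
    "\<And>s i. 0 \<le> s \<Longrightarrow> s \<le> 1 \<Longrightarrow> i \<in> Y \<Longrightarrow>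
       (\<Sum>y\<in>Y. p w y * exp (s * (f y \<bullet> (u - w))) * (f y \<bullet> (u - w) - f i \<bullet> (u - w)))
         \<le> R * (\<Sum>y\<in>Y. p w y * exp (s * (f y \<bullet> (u - w))))"
proof -
  note wc = param_ballD(1)[OF w] and uc = param_ballD(1)[OF u]
  define U where "U y = f y \<bullet> (u - w)" for y
  define a where "a s y = p w y * exp (s * U y)" for s y
  have U: "\<bar>U y\<bar> \<le> 2" for y
    using f_dot_ball[OF w, of y] f_dot_ball[OF u, of y] wc uc
    by (simp add: U_def scalar_prod_minus_distrib[of _ d])
  have U0: "U 0 = 0" using wc uc by (simp add: U_def)
  have apos: "a s y > 0" if "y \<in> Y" for s y
    using p_pos[OF wc that] by (simp add: a_def)
  have termwise: "(\<Sum>y\<in>Y. a s y * (U y - U i)) \<le> R * (\<Sum>y\<in>Y. a s y)"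
    if "\<And>y. y \<in> Y \<Longrightarrow> U y - U i \<le> R" for R s i
    unfolding sum_distrib_left using that apos
    by (intro sum_mono) (metis less_imp_le mult.commute mult_left_mono)
  have diff4: "U y - U i \<le> 4" for y i using U[of y] U[of i] by linarith
  \<comment> \<open>Along the segment all logits stay in \<open>[-1, 1]\<close>, so the weights of
    two items differ at most by the factor \<open>exp 2 \<le> 9\<close>.\<close>
  have ratio: "a s j \<le> 9 * a s i" if "i \<in> S" "j \<in> S" "0 \<le> s" "s \<le> 1" for i j s
  proof -
    let ?w = "w + s \<cdot>\<^sub>v (u - w)"
    have ws: "?w \<in> param_ball d" by (rule param_ball_segment[OF w u that(3,4)])
    have a: "a s y = exp (f y \<bullet> ?w) / Zs w" if "y \<in> S" for y
    proof -
      have "y \<in> Y" "bw y = 1" using that S0 by (auto simp: Y_def bw_def)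
      moreover have "f y \<bullet> ?w = f y \<bullet> w + s * U y"
        using wc uc by (simp add: U_def scalar_prod_add_distrib[of _ d])
      ultimately show ?thesis using wc by (simp add: a_def p_eq exp_add)
    qed
    have "exp (f j \<bullet> ?w) \<le> exp (1 + 1 + f i \<bullet> ?w)"
      using f_dot_ball[OF ws, of i] f_dot_ball[OF ws, of j] by simp
    also have "\<dots> = exp 1 * exp 1 * exp (f i \<bullet> ?w)" by (simp only: exp_add)
    also have "\<dots> \<le> 3 * 3 * exp (f i \<bullet> ?w)"
      using exp_le by (intro mult_right_mono mult_mono) auto
    finally show ?thesis using that Zs_pos[of w] by (simp add: a divide_right_mono)
  qed
  have inner: "(\<Sum>y\<in>Y. a s y * (U y - U i)) = a s 0 * (- U i) + (\<Sum>j\<in>S - {i}. a s j * (U j - U i))"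
     "(\<Sum>y\<in>Y. a s y) = a s 0 + a s i + (\<Sum>j\<in>S - {i}. a s j)"
    if "i \<in> S" for s i
    using that finS by (simp_all add: sum_Y U0 sum.remove[of S i])
  consider "K = 1" | "K = 2" | "K \<ge> 3" using K by linarith
  then have "\<exists>R>0. 1 / (2 * ofu_eta K) \<le> (R - 1) / R\<^sup>2 \<and> (\<forall>s i. 0 \<le> s \<longrightarrow> s \<le> 1 \<longrightarrow> i \<in> Y \<longrightarrow>
      (\<Sum>y\<in>Y. a s y * (U y - U i)) \<le> R * (\<Sum>y\<in>Y. a s y))"
  proof cases
    case 1
    have "(\<Sum>y\<in>Y. a s y * (U y - U i)) \<le> 2 * (\<Sum>y\<in>Y. a s y)" if "i \<in> Y" for s i
    proof (cases "i = 0")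
      case True then show ?thesis using U0 U by (intro termwise) (auto simp: abs_le_iff)
    next
      case False
      then have i: "i \<in> S" using that by (simp add: Y_def)
      have e: "S - {i} = {}"
        using K 1 i finS by (metis Diff_eq_empty_iff card_le_Suc0_iff_eq One_nat_def singletonI subsetI)
      have "a s 0 * (- U i) \<le> a s 0 * 2"
        using U[of i] apos[of 0 s] by (intro mult_left_mono) auto
      moreover have "a s 0 * 2 \<le> 2 * (a s 0 + a s i)" using apos[OF that, of s] by simp
      ultimately show ?thesis using inner[OF i, of s] unfolding e by simp
    qed
    moreover have "1 / (2 * ofu_eta K) \<le> (2 - 1) / 2\<^sup>2"
      using ofu_eta_ge_2[of K] by (simp add: field_simps)
    ultimately show ?thesis by (intro exI[of _ 2]) simp
  next
    \<comment> \<open>Since \<open>ln 3 \<ge> 1\<close>, any \<open>R\<close> with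
      \<open>R\<^sup>2 - 5 R + 5 \<le> 0\<close> has enough curvature, and \<open>18/5\<close> is
      one. Seen from item \<open>i\<close>, the other item has gap at most 4 and weight at most 9
      times that of \<open>i\<close>, while \<open>i\<close> has gap 0 to itself;
      \<open>4 * 9 = 18/5 * (9 + 1)\<close> then bounds the mean gap.\<close>
    case 2
    have "(\<Sum>y\<in>Y. a s y * (U y - U i)) \<le> 18 / 5 * (\<Sum>y\<in>Y. a s y)"
      if "i \<in> Y" and s: "0 \<le> s" "s \<le> 1" for s i
    proof (cases "i = 0")
      case True
      have "U y - U i \<le> 18 / 5" for y using U0 U[of y] True by auto
      then show ?thesis by (rule termwise)
    next
      case False
      then have i: "i \<in> S" using that by (simp add: Y_def)
      have "(\<Sum>j\<in>S - {i}. a s j * (U j - U i)) \<le> (\<Sum>j\<in>S - {i}. a s j * 4)"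
        using apos diff4 by (intro sum_mono mult_left_mono) (auto simp: Y_def less_imp_le)
      moreover have "(\<Sum>j\<in>S - {i}. a s j) \<le> of_nat (card (S - {i})) * (9 * a s i)"
        using i s ratio by (intro sum_bounded_above) auto
      moreover have "of_nat (card (S - {i})) * (9 * a s i) \<le> 1 * (9 * a s i)"
        using K 2 i finS apos[OF that(1), of s] by (intro mult_right_mono) auto
      moreover have "a s 0 * (- U i) \<le> a s 0 * 2"
        using U[of i] apos[of 0 s] by (intro mult_left_mono) auto
      ultimately show ?thesis
        using inner[OF i, of s] apos[of 0 s] by (simp add: sum_distrib_right[symmetric])
    qed
    moreover have "1 / (2 * ofu_eta K) \<le> (18 / 5 - 1) / (18 / 5)\<^sup>2"
    proof -
      have "ln 3 \<ge> (1::real)" using exp_le by (subst ln_ge_iff) auto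
      then show ?thesis by (simp add: 2 ofu_eta_def field_simps power2_eq_square)
    qed
    ultimately show ?thesis by (intro exI[of _ "18 / 5"]) simp
  next
    case 3
    have "1 / (2 * ofu_eta K) \<le> (4 - 1) / 4\<^sup>2"
    proof -
      have "ln (2 * 2 :: real) \<le> ln (real K + 1)" using 3 by (intro ln_mono) auto
      then have "4 / 3 \<le> ln (real K + 1)" using ln2_ge_two_thirds by (simp only: ln_mult) simp
      then show ?thesis by (simp add: ofu_eta_def field_simps)
    qed
    then show ?thesis using termwise diff4 by (intro exI[of _ 4]) simp
  qed
  then show thesis using that unfolding U_def a_def by blast
qed

text \<open>The outcome enters the loss only through a term linear in the parameter, so for every
  \<open>y\<close> the Bregman divergence is that of the log-partition function, and
  \<open>log_partition_lower\<close> applies to the tilt from \<open>w\<close> to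
  \<open>u\<close>.\<close>

lemma bregman_loss:
  assumes K: "1 \<le> K" "card S \<le> K" and w: "w \<in> param_ball d" and u: "u \<in> param_ball d" and y: "y \<in> Y"
  shows "bil (G w) (u - w) (u - w)
     \<le> 2 * ofu_eta K * (loss y u - loss y w - (xbar w - f y) \<bullet> (u - w))"
proof -
  note wc = param_ballD(1)[OF w] and uc = param_ballD(1)[OF u]
  have c: "u - w \<in> carrier_vec d" using wc uc by simp
  obtain R where R: "R > 0" "1 / (2 * ofu_eta K) \<le> (R - 1) / R\<^sup>2" and
    gap: "\<And>s i. 0 \<le> s \<Longrightarrow> s \<le> 1 \<Longrightarrow> i \<in> Y \<Longrightarrow>
       (\<Sum>y\<in>Y. p w y * exp (s * (f y \<bullet> (u - w))) * (f y \<bullet> (u - w) - f i \<bullet> (u - w)))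
         \<le> R * (\<Sum>y\<in>Y. p w y * exp (s * (f y \<bullet> (u - w))))"
    using softmax_gap[OF K w u] by blast
  let ?B = "bil (G w) (u - w) (u - w)"
  have B: "?B = (\<Sum>y\<in>Y. p w y * (f y \<bullet> (u - w))\<^sup>2) - (\<Sum>y\<in>Y. p w y * (f y \<bullet> (u - w)))\<^sup>2"
    unfolding bil_G[OF c c] xbar_dot[OF c] by (simp add: power2_eq_square mult.assoc)
  let ?Z = "\<Sum>j\<in>Y. p w j * exp (f j \<bullet> (u - w))"
  have "ln ?Z \<ge> (\<Sum>y\<in>Y. p w y * (f y \<bullet> (u - w))) + ?B * ((R - 1) / R\<^sup>2)"
    unfolding B using p_pos[OF wc] p_sum[OF wc] R gap by (intro log_partition_lower) auto
  moreover have "loss y u - loss y w - (xbar w - f y) \<bullet> (u - w) = ln ?Z - xbar w \<bullet> (u - w)"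
  proof -
    have "?Z > 0" using p_pos[OF wc] by (intro sum_pos) auto
    then have "ln (Zs u) = ln (Zs w) + ln ?Z"
      using Zs_pos[of w] by (simp only: Zs_tilt[OF wc uc]) (simp add: ln_mult)
    then show ?thesis
      using wc uc c by (simp add: loss_eq[OF y] ln_p[OF _ y] minus_scalar_prod_distrib[of _ d]
          scalar_prod_minus_distrib[of _ d])
  qed
  moreover have "?B * (1 / (2 * ofu_eta K)) \<le> ?B * ((R - 1) / R\<^sup>2)"
    using R bil_G_bounds(1)[OF wc c] by (intro mult_left_mono)
  ultimately have "?B * (1 / (2 * ofu_eta K)) \<le> loss y u - loss y w - (xbar w - f y) \<bullet> (u - w)"
    by (simp add: xbar_dot[OF c])
  then show ?thesis using ofu_eta_ge_2[of K] by (simp add: field_simps)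
qed

text \<open>Measures the quality of the quadratic model in the update: \<open>G w\<close> predicts
  the change of the gradient, and the error is of second order in the step. Only its product with
  \<open>w' - ws\<close> is needed, and there every feature contributes at most 2.\<close>

lemma grad_remainder:
  assumes w: "w \<in> param_ball d" and w': "w' \<in> param_ball d" and ws: "ws \<in> param_ball d"
    and small: "vnorm (w' - w) \<le> 1 / 20"
  shows "\<bar>(xbar w' - xbar w) \<bullet> (w' - ws) - bil (G w) (w' - ws) (w' - w)\<bar> \<le> 5 * ((w' - w) \<bullet> (w' - w))"
proof -
  note c = param_ballD(1)[OF w] param_ballD(1)[OF w'] param_ballD(1)[OF ws]
  let ?q = "w' - ws" and ?v = "w' - w"
  have qv: "?q \<in> carrier_vec d" "?v \<in> carrier_vec d" using c by auto
  have q2: "\<bar>f y \<bullet> ?q\<bar> \<le> 2" for y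
    using f_dot_ball[OF w', of y] f_dot_ball[OF ws, of y] c
    by (simp add: scalar_prod_minus_distrib[of _ d])
  have "xbar w' \<bullet> ?q = (\<Sum>y\<in>Y. p w y * exp (f y \<bullet> ?v) * (f y \<bullet> ?q)) / (\<Sum>y\<in>Y. p w y * exp (f y \<bullet> ?v))"
    unfolding xbar_dot[OF qv(1)] sum_divide_distrib
    by (intro sum.cong refl) (simp add: p_tilt[OF c(1,2)])
  then have "\<bar>xbar w' \<bullet> ?q - xbar w \<bullet> ?q - ((\<Sum>y\<in>Y. p w y * (f y \<bullet> ?q) * (f y \<bullet> ?v))
        - (xbar w \<bullet> ?q) * (xbar w \<bullet> ?v))\<bar> \<le> 5 * (vnorm ?v)\<^sup>2"
    unfolding xbar_dot[OF qv(1), of w] xbar_dot[OF qv(2), of w]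
    using tilted_mean_expansion[of Y "p w" "\<lambda>y. f y \<bullet> ?v" "vnorm ?v" "\<lambda>y. f y \<bullet> ?q"]
      p_pos[OF c(1)] p_sum[OF c(1)] f_dot(1)[OF qv(2)] q2 small by (simp add: less_imp_le)
  then show ?thesis
    using c qv by (simp add: vnorm_sq bil_G minus_scalar_prod_distrib[of _ d])
qed

lemma xbar_dot_le:
  assumes "w \<in> carrier_vec d" "v \<in> carrier_vec d" shows "\<bar>xbar w \<bullet> v\<bar> \<le> vnorm v"
proof -
  have "\<bar>xbar w \<bullet> v\<bar> \<le> (\<Sum>y\<in>Y. \<bar>p w y * (f y \<bullet> v)\<bar>)" unfolding xbar_dot[OF assms(2)] by (rule sum_abs)
  also have "\<dots> \<le> (\<Sum>y\<in>Y. p w y * vnorm v)"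
    using f_dot(1)[OF assms(2)] p_pos[OF assms(1)]
    by (intro sum_mono) (simp add: abs_mult mult_left_mono less_imp_le)
  finally show ?thesis using p_sum[OF assms(1)] by (simp flip: sum_distrib_right)
qed

lemma grad_dot_le:
  assumes "w \<in> carrier_vec d" "v \<in> carrier_vec d" shows "\<bar>(xbar w - f y) \<bullet> v\<bar> \<le> 2 * vnorm v"
  using xbar_dot_le[OF assms] f_dot(1)[OF assms(2), of y] assms
  by (simp add: minus_scalar_prod_distrib[of _ d])

lemma centered_norm:
  assumes "w \<in> carrier_vec d" shows "(f y - xbar w) \<bullet> (f y - xbar w) \<le> 4"
proof -
  let ?a = "f y - xbar w"
  have a: "?a \<in> carrier_vec d" by simp
  have "?a \<bullet> ?a = - ((xbar w - f y) \<bullet> ?a)"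
    using a by (simp add: minus_scalar_prod_distrib[of _ d])
  then have "vnorm ?a * vnorm ?a \<le> 2 * vnorm ?a"
    using grad_dot_le[OF assms a, of y] vnorm_sq[of ?a] by (simp add: power2_eq_square)
  then have "vnorm ?a \<le> 2" using vnorm_nonneg[of ?a] by (cases "vnorm ?a = 0") (auto simp: mult_le_cancel_right)
  then have "(vnorm ?a)\<^sup>2 \<le> 2\<^sup>2" by (intro power_mono) auto
  then show ?thesis by (simp add: vnorm_sq)
qed

end

lemma bil_uminus:
  assumes "A \<in> carrier_mat d d" "u \<in> carrier_vec d" "v \<in> carrier_vec d"
  shows "bil A u (- v) = - bil A u v" "bil A (- u) v = - bil A u v"
    "u \<bullet> (- v) = - (u \<bullet> v)"
proof -
  have m: "- z = (-1) \<cdot>\<^sub>v z" if "z \<in> carrier_vec d" for z :: "real vec"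
    using that by (intro eq_vecI) auto
  show "bil A u (- v) = - bil A u v" "bil A (- u) v = - bil A u v"
    unfolding m[OF assms(2)] m[OF assms(3)] using bil_linear[OF assms(1)] assms by auto
  show "u \<bullet> (- v) = - (u \<bullet> v)" using assms by simp
qed

context mnl_round
begin

section \<open>Variance of the features and its price in log-determinant\<close>

lemma xbar_dim[simp]: "dim_vec (xbar w) = d"
  by (rule carrier_vecD[OF xbar_carrier])

text \<open>The trace of \<open>A * G w\<close>, that is, the variance of the feature of a random
  choice in the norm of \<open>A\<close>. For \<open>A\<close> the inverse of \<open>H\<close> it is
  the first-order growth of \<open>ln (det H)\<close> under adding \<open>G w\<close>.\<close>

definition tau :: "real vec \<Rightarrow> real mat \<Rightarrow> real" where
  "tau w A = (\<Sum>y\<in>Y. p w y * bil A (f y - xbar w) (f y - xbar w))"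

lemma tau_nonneg:
  assumes "spd d A" "w \<in> carrier_vec d" shows "0 \<le> tau w A"
  unfolding tau_def using p_pos[OF assms(2)] spd_nonneg[OF assms(1)]
  by (intro sum_nonneg mult_nonneg_nonneg) (auto simp: less_imp_le)

text \<open>Parallel axis identity; in particular the mean is the center that minimizes the second
  moment.\<close>

lemma tau_min:
  assumes A: "spd d A" and w: "w \<in> carrier_vec d" and z: "z \<in> carrier_vec d"
  shows "(\<Sum>y\<in>Y. p w y * bil A (f y - z) (f y - z)) = tau w A + bil A (xbar w - z) (xbar w - z)"
proof -
  note Ac = spd_carrier[OF A]
  let ?c = "xbar w - z"
  have c: "?c \<in> carrier_vec d" using z by simp
  have "bil A (f y - z) (f y - z) = bil A (f y - xbar w) (f y - xbar w)
      + 2 * (f y \<bullet> (A *\<^sub>v ?c) - xbar w \<bullet> (A *\<^sub>v ?c)) + bil A ?c ?c" for y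
  proof -
    have s: "f y - z = (f y - xbar w) + ?c" using z by (intro eq_vecI) auto
    have fx: "f y - xbar w \<in> carrier_vec d" by simp
    have "bil A (f y - z) (f y - z) = bil A (f y - xbar w) (f y - xbar w)
      + 2 * bil A (f y - xbar w) ?c + bil A ?c ?c"
      unfolding s using fx c Ac spd_swap[OF A c fx] by (simp only: bil_linear[OF Ac] add_carrier_vec)
    then show ?thesis using Ac c by (simp add: minus_scalar_prod_distrib[of _ d])
  qed
  then have "(\<Sum>y\<in>Y. p w y * bil A (f y - z) (f y - z)) = tau w A
      + 2 * ((\<Sum>y\<in>Y. p w y * (f y \<bullet> (A *\<^sub>v ?c))) - (xbar w \<bullet> (A *\<^sub>v ?c)) * (\<Sum>y\<in>Y. p w y))
      + bil A ?c ?c * (\<Sum>y\<in>Y. p w y)"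
    by (simp only: tau_def distrib_left right_diff_distrib sum.distrib sum_subtractf sum_distrib_left sum_distrib_right mult_ac)
  then show ?thesis using Ac c by (simp add: p_sum[OF w] xbar_dot)
qed

text \<open>A step of length \<open>1/20\<close> changes each probability at most by the factor
  \<open>exp (1/10) \<le> 6/5\<close>. The centers differ too, but by \<open>tau_min\<close> the
  variance at \<open>w\<close> only increases when it is taken about \<open>xbar w'\<close>.\<close>

lemma tau_change:
  assumes A: "spd d A" and w: "w \<in> carrier_vec d" and w': "w' \<in> carrier_vec d"
    and small: "vnorm (w' - w) \<le> 1 / 20"
  shows "tau w A \<le> 6 / 5 * tau w' A"
proof -
  have c: "w - w' \<in> carrier_vec d" using w w' by simp
  have "w - w' = - (w' - w)" using w w' by (intro eq_vecI) auto
  then have n: "vnorm (w - w') \<le> 1 / 20" using small w w' by (simp add: vnorm_def)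
  have fb: "f y \<bullet> (w - w') \<le> 1 / 20" "- (1 / 20) \<le> f y \<bullet> (w - w')" for y
    using f_dot(1)[OF c, of y] n by (auto simp: abs_le_iff)
  have pw: "p w y \<le> 6 / 5 * p w' y" if y: "y \<in> Y" for y
  proof -
    let ?Z = "\<Sum>j\<in>Y. p w' j * exp (f j \<bullet> (w - w'))"
    have "(\<Sum>j\<in>Y. p w' j * exp (- (1 / 20))) \<le> ?Z"
      using fb p_pos[OF w'] by (intro sum_mono mult_left_mono) (auto simp: less_imp_le)
    then have Z: "exp (- (1 / 20)) \<le> ?Z" using p_sum[OF w'] by (simp flip: sum_distrib_right)
    have "p w y \<le> p w' y * exp (1 / 20) / exp (- (1 / 20))"
      unfolding p_tilt[OF w' w y] using Z fb p_pos[OF w' y]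
      by (intro frac_le mult_left_mono) auto
    also have "\<dots> = p w' y * exp (1 / 20 + 1 / 20)" by (simp only: exp_add exp_minus) (simp add: field_simps)
    also have "\<dots> \<le> p w' y * (6 / 5)"
      using exp_bound[of "1 / 10 :: real"] p_pos[OF w' y] by (intro mult_left_mono) (auto simp: power2_eq_square)
    finally show ?thesis by simp
  qed
  have "tau w A \<le> (\<Sum>y\<in>Y. p w y * bil A (f y - xbar w') (f y - xbar w'))"
    using tau_min[OF A w xbar_carrier] spd_nonneg[OF A, of "xbar w - xbar w'"] by simp
  also have "\<dots> \<le> (\<Sum>y\<in>Y. 6 / 5 * p w' y * bil A (f y - xbar w') (f y - xbar w'))"
    using pw spd_nonneg[OF A] by (intro sum_mono mult_right_mono) auto
  also have "\<dots> = 6 / 5 * tau w' A" by (simp add: tau_def sum_distrib_left mult.assoc)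
  finally show ?thesis .
qed

text \<open>Passes from centered to raw features. As the outside option has feature zero, the
  squared norm of the mean is at most \<open>1 - p w 0\<close> times the second moment, so
  subtracting it leaves at least the fraction \<open>p w 0\<close>.\<close>

lemma tau_ge:
  assumes A: "spd d A" and w: "w \<in> carrier_vec d"
  shows "p w 0 * (\<Sum>i\<in>S. p w i * bil A (xs i) (xs i)) \<le> tau w A"
proof -
  note Ac = spd_carrier[OF A]
  define m where "m = bil A (xbar w) (xbar w)"
  define T where "T = (\<Sum>i\<in>S. p w i * bil A (xs i) (xs i))"
  define r where "r = 1 - p w 0"
  have pos: "p w i > 0" if "i \<in> S" for i using p_pos[OF w, of i] that by (simp add: Y_def)
  have T: "tau w A = T - m"
  proof -
    have "f y - 0\<^sub>v d = f y" "xbar w - 0\<^sub>v d = xbar w" for y by (auto intro!: eq_vecI)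
    then have "(\<Sum>y\<in>Y. p w y * bil A (f y) (f y)) = tau w A + m"
      using tau_min[OF A w, of "0\<^sub>v d"] by (simp add: m_def)
    moreover have "(\<Sum>y\<in>Y. p w y * bil A (f y) (f y)) = T"
      using Ac S0 by (simp add: sum_Y T_def f_item scalar_prod_left_zero[of _ d])
    ultimately show ?thesis by simp
  qed
  have T0: "T \<ge> 0" unfolding T_def using pos spd_nonneg[OF A] xs
    by (intro sum_nonneg mult_nonneg_nonneg) (auto simp: less_imp_le)
  have r: "(\<Sum>i\<in>S. p w i) = r" using p_sum_S[OF w] by (simp add: r_def)
  have "m \<le> r * T"
  proof (cases "S = {}")
    case True
    then have Y: "Y = {0}" unfolding Y_def by (rule arg_cong)
    have "xbar w = 0\<^sub>v d" unfolding xbar_def Y by (intro eq_vecI) auto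
    then show ?thesis using Ac True by (simp add: m_def T_def)
  next
    case False
    have "r > 0" unfolding r[symmetric] using pos False finS by (intro sum_pos) auto
    \<comment> \<open>The Cauchy-Schwarz inequality for the mean, read off from the spread of
      \<open>r \<cdot>\<^sub>v xs i\<close> around \<open>xbar w\<close>. It yields
      \<open>m \<le> r * T\<close> after division by \<open>r\<close>, hence the separate case of
      empty \<open>S\<close>.\<close>
    have "0 \<le> (\<Sum>i\<in>S. p w i * bil A (r \<cdot>\<^sub>v xs i - xbar w) (r \<cdot>\<^sub>v xs i - xbar w))"
      using pos spd_nonneg[OF A] xs by (intro sum_nonneg mult_nonneg_nonneg) (auto simp: less_imp_le)
    also have "\<dots> = (\<Sum>i\<in>S. p w i * (r\<^sup>2 * bil A (xs i) (xs i) - 2 * r * bil A (xs i) (xbar w) + m))"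
    proof (intro sum.cong refl)
      fix i
      have x: "xs i \<in> carrier_vec d" by (rule xs)
      have "bil A (r \<cdot>\<^sub>v xs i - xbar w) (r \<cdot>\<^sub>v xs i - xbar w)
        = r * (r * bil A (xs i) (xs i)) - r * bil A (xs i) (xbar w) - (r * bil A (xs i) (xbar w) - m)"
        using x Ac spd_swap[OF A xbar_carrier x] by (simp add: bil_linear[OF Ac] m_def right_diff_distrib)
      then have "bil A (r \<cdot>\<^sub>v xs i - xbar w) (r \<cdot>\<^sub>v xs i - xbar w)
        = r\<^sup>2 * bil A (xs i) (xs i) - 2 * r * bil A (xs i) (xbar w) + m"
        by (simp add: power2_eq_square right_diff_distrib)
      then show "p w i * bil A (r \<cdot>\<^sub>v xs i - xbar w) (r \<cdot>\<^sub>v xs i - xbar w)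
        = p w i * (r\<^sup>2 * bil A (xs i) (xs i) - 2 * r * bil A (xs i) (xbar w) + m)"
        by simp
    qed
    also have "\<dots> = r\<^sup>2 * T - 2 * r * (\<Sum>i\<in>S. p w i * bil A (xs i) (xbar w)) + m * r"
      unfolding r[symmetric] T_def
      by (simp add: sum_distrib_left sum_distrib_right sum.distrib sum_subtractf algebra_simps)
    also have "(\<Sum>i\<in>S. p w i * bil A (xs i) (xbar w)) = m"
      using Ac unfolding m_def by (subst xbar_dot) (auto simp: sum_Y f_item scalar_prod_left_zero[of _ d])
    finally have "0 \<le> r * (r * T - m)" by (simp add: power2_eq_square algebra_simps)
    then show ?thesis using \<open>r > 0\<close> by (simp add: zero_le_mult_iff)
  qed
  then show ?thesis unfolding T by (simp add: T_def[symmetric] r_def algebra_simps)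
qed

text \<open>The centered features scaled by \<open>sqrt (p w y)\<close> have outer products summing
  to \<open>G w\<close>, which is dominated by the identity, so \<open>ln_det_outer_sum\<close>
  applies to them.\<close>

lemma tau_le_ln_det:
  assumes H: "spd d H" and l: "\<And>v. v \<in> carrier_vec d \<Longrightarrow> bil H v v \<ge> l * (v \<bullet> v)" "l \<ge> 200"
    and w: "w \<in> carrier_vec d"
  shows "spd d (H + G w)" "0 < det (H + G w)"
    "tau w (minv H) \<le> 11 / 10 * (ln (det (H + G w)) - ln (det H))"
proof -
  let ?a = "\<lambda>y. sqrt (p w y) \<cdot>\<^sub>v (f y - xbar w)"
  have a: "?a y \<in> carrier_vec d" for y by simp
  have pp: "sqrt (p w y) * sqrt (p w y) = p w y" if "y \<in> Y" for y using p_pos[OF w that] by simp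
  have dot: "?a y \<bullet> v = sqrt (p w y) * ((f y - xbar w) \<bullet> v)" if "v \<in> carrier_vec d" for y v
    using that by simp
  have sq: "(\<Sum>y\<in>Y. (?a y \<bullet> u) * (?a y \<bullet> v)) = bil (G w) u v"
    if "u \<in> carrier_vec d" "v \<in> carrier_vec d" for u v
    unfolding bil_G_centered[OF w that] dot[OF that(1)] dot[OF that(2)]
  proof (intro sum.cong refl)
    fix y assume "y \<in> Y"
    have "sqrt (p w y) * ((f y - xbar w) \<bullet> u) * (sqrt (p w y) * ((f y - xbar w) \<bullet> v))
      = (sqrt (p w y) * sqrt (p w y)) * ((f y - xbar w) \<bullet> u) * ((f y - xbar w) \<bullet> v)"
      by (simp only: mult_ac)
    then show "sqrt (p w y) * ((f y - xbar w) \<bullet> u) * (sqrt (p w y) * ((f y - xbar w) \<bullet> v))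
      = p w y * ((f y - xbar w) \<bullet> u) * ((f y - xbar w) \<bullet> v)"
      by (simp only: pp[OF \<open>y \<in> Y\<close>])
  qed
  have "(\<Sum>y\<in>Y. (?a y \<bullet> v)\<^sup>2) \<le> v \<bullet> v" if "v \<in> carrier_vec d" for v
    using bil_G_bounds(2)[OF w that] sq[OF that that] by (simp add: power2_eq_square)
  note * = ln_det_outer_sum[OF H finY a l this G_carrier sq[symmetric]]
  have "bil (minv H) (?a y) (?a y) = p w y * bil (minv H) (f y - xbar w) (f y - xbar w)" if "y \<in> Y" for y
  proof -
    have c: "f y - xbar w \<in> carrier_vec d" by simp
    show ?thesis
      unfolding bil_linear(5)[OF spd_minv(1)[OF H] c a a] bil_linear(6)[OF spd_minv(1)[OF H] c c c]
      using pp[OF that] by (simp flip: mult.assoc)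
  qed
  then have "(\<Sum>y\<in>Y. bil (minv H) (?a y) (?a y)) = tau w (minv H)"
    unfolding tau_def by (intro sum.cong) auto
  with * show "spd d (H + G w)" "0 < det (H + G w)"
    "tau w (minv H) \<le> 11 / 10 * (ln (det (H + G w)) - ln (det H))" by auto
qed

text \<open>Normalizing the summands gives a predictable forecaster that competes with the updated
  parameters \<open>v y\<close>.\<close>
lemma discounted_likelihood_sum:
  assumes H: "spd d H" and l: "\<And>v. v \<in> carrier_vec d \<Longrightarrow> bil H v v \<ge> l * (v \<bullet> v)"
    and c: "c > 0" "l \<ge> 40 * c"
    and w: "w \<in> carrier_vec d" and v: "\<And>y. y \<in> Y \<Longrightarrow> v y \<in> carrier_vec d"
  shows "(\<Sum>y\<in>Y. p (v y) y * exp (- bil H (v y - w) (v y - w) / (2 * c)))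
     \<le> exp (11 / 20 * c * tau w (minv H))"
proof -
  have A: "spd d (minv H)" by (rule spd_minv_spd[OF H])
  define z where "z y = c / 2 * bil (minv H) (f y - xbar w) (f y - xbar w)" for y
  have fc: "f y - xbar w \<in> carrier_vec d" for y by simp
  have z0: "0 \<le> z y" for y unfolding z_def using c spd_nonneg[OF A fc] by simp
  have z1: "z y \<le> 1 / 20" for y
  proof -
    have "bil (minv H) (f y - xbar w) (f y - xbar w) \<le> ((f y - xbar w) \<bullet> (f y - xbar w)) / l"
      using l c by (intro bil_minv_le[OF H fc]) auto
    also have "\<dots> \<le> 4 / l" using centered_norm[OF w, of y] c by (intro divide_right_mono) auto
    finally have "z y \<le> c / 2 * (4 / l)" unfolding z_def using c by (intro mult_left_mono) auto
    also have "\<dots> \<le> 1 / 20" using c by (simp add: field_simps)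
    finally show ?thesis .
  qed
  have "p (v y) y * exp (- bil H (v y - w) (v y - w) / (2 * c)) \<le> p w y * (1 + 11 / 10 * z y)" if y: "y \<in> Y" for y
  proof -
    let ?v = "v y - w"
    have vc: "v y \<in> carrier_vec d" "?v \<in> carrier_vec d" using v[OF y] w by auto
    let ?Z = "\<Sum>j\<in>Y. p w j * exp (f j \<bullet> ?v)"
    \<comment> \<open>Jensen's inequality \<open>exp (xbar w \<bullet> ?v) \<le> ?Z\<close>, from
      the tangent of \<open>exp\<close> at the mean.\<close>
    have "(\<Sum>j\<in>Y. p w j * (exp (xbar w \<bullet> ?v) * (1 + (f j \<bullet> ?v - xbar w \<bullet> ?v)))) \<le> ?Z"
    proof (intro sum_mono mult_left_mono)
      fix j
      have "exp (xbar w \<bullet> ?v) * (1 + (f j \<bullet> ?v - xbar w \<bullet> ?v)) \<le> exp (xbar w \<bullet> ?v) * exp (f j \<bullet> ?v - xbar w \<bullet> ?v)"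
        by (intro mult_left_mono exp_ge_add_one_self) auto
      then show "exp (xbar w \<bullet> ?v) * (1 + (f j \<bullet> ?v - xbar w \<bullet> ?v)) \<le> exp (f j \<bullet> ?v)"
        by (simp flip: exp_add)
    qed (use p_pos[OF w] in \<open>auto simp: less_imp_le\<close>)
    moreover have "(\<Sum>j\<in>Y. p w j * (exp (xbar w \<bullet> ?v) * (1 + (f j \<bullet> ?v - xbar w \<bullet> ?v))))
       = exp (xbar w \<bullet> ?v) * ((\<Sum>j\<in>Y. p w j) + ((\<Sum>j\<in>Y. p w j * (f j \<bullet> ?v)) - (xbar w \<bullet> ?v) * (\<Sum>j\<in>Y. p w j)))"
      by (simp add: sum_distrib_left sum.distrib sum_subtractf sum_distrib_right distrib_left right_diff_distrib mult_ac)
    ultimately have Z: "exp (xbar w \<bullet> ?v) \<le> ?Z" using p_sum[OF w] xbar_dot[OF vc(2), of w] by simp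
    have "p (v y) y \<le> p w y * exp (f y \<bullet> ?v) / exp (xbar w \<bullet> ?v)"
      unfolding p_tilt[OF w vc(1) y] using Z p_pos[OF w y] less_le_trans[OF exp_gt_zero Z]
      by (intro divide_left_mono) auto
    also have "\<dots> = p w y * exp ((f y - xbar w) \<bullet> ?v)"
      using vc by (simp add: minus_scalar_prod_distrib[of _ d] exp_diff)
    \<comment> \<open>Young's inequality with weight \<open>c\<close> produces exactly the squared
      step that the discount cancels, so what remains no longer depends on the updated
      parameter.\<close>
    also have "\<dots> \<le> p w y * exp (z y + bil H ?v ?v / (2 * c))"
      using young_minv[OF H fc vc(2) c(1)] p_pos[OF w y] by (simp add: z_def)
    finally have "p (v y) y * exp (- bil H ?v ?v / (2 * c)) \<le>
      p w y * exp (z y + bil H ?v ?v / (2 * c)) * exp (- bil H ?v ?v / (2 * c))"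
      by (intro mult_right_mono) auto
    also have "\<dots> = p w y * exp (z y)" by (simp add: mult.assoc flip: exp_add)
    also have "exp (z y) \<le> 1 + z y + (z y)\<^sup>2" using z0 z1[of y] by (intro exp_bound) auto
    also have "\<dots> \<le> 1 + 11 / 10 * z y"
      using mult_left_mono[OF z1[of y] z0[of y]] z0[of y] by (simp add: power2_eq_square)
    finally show ?thesis using p_pos[OF w y] by simp
  qed
  then have "(\<Sum>y\<in>Y. p (v y) y * exp (- bil H (v y - w) (v y - w) / (2 * c))) \<le> (\<Sum>y\<in>Y. p w y * (1 + 11 / 10 * z y))"
    by (intro sum_mono) auto
  also have "\<dots> = (\<Sum>y\<in>Y. p w y) + 11 / 20 * c * tau w (minv H)"
    by (simp add: tau_def z_def sum_distrib_left distrib_left sum.distrib mult_ac)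
  also have "\<dots> \<le> exp (11 / 20 * c * tau w (minv H))"
    using exp_ge_add_one_self by (simp add: p_sum[OF w])
  finally show ?thesis .
qed

section \<open>One step of online mirror descent\<close>

definition omd_next :: "real mat \<Rightarrow> nat \<Rightarrow> nat \<Rightarrow> real vec \<Rightarrow> real vec" where
  "omd_next H K y w = (THE v. v \<in> param_ball d \<and> (\<forall>u\<in>param_ball d.
      vgrad d (mnl_loss v0 xs S y) w \<bullet> v
        + 1 / (2 * ofu_eta K) * bil (H + ofu_eta K \<cdot>\<^sub>m G w) (v - w) (v - w)
    \<le> vgrad d (mnl_loss v0 xs S y) w \<bullet> u
        + 1 / (2 * ofu_eta K) * bil (H + ofu_eta K \<cdot>\<^sub>m G w) (u - w) (u - w)))"

text \<open>\<open>bregman_loss\<close>, based at the new point, involves the gradient there, while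
  optimality of \<open>w'\<close> involves the gradient at \<open>w\<close> plus \<open>G w\<close>
  applied to the step. \<open>grad_remainder\<close> exchanges the two. Its error, times
  \<open>2 * ofu_eta K\<close>, is at most a tenth of the squared step because
  \<open>l \<ge> 100 * ofu_eta K\<close>; the other nine tenths of the term from the three-point
  identity survive.\<close>

lemma omd_step:
  assumes H: "spd d H" and l: "\<And>v. v \<in> carrier_vec d \<Longrightarrow> bil H v v \<ge> l * (v \<bullet> v)"
      "l \<ge> 100 * ofu_eta K"
    and K: "1 \<le> K" "card S \<le> K" and w: "w \<in> param_ball d" and y: "y \<in> Y"
  defines "w' \<equiv> omd_next H K y w"
  shows "w' \<in> param_ball d" "vnorm (w' - w) \<le> 1 / 20"
    "\<And>ws. ws \<in> param_ball d \<Longrightarrow> bil (H + G w') (w' - ws) (w' - ws) \<le> bil H (w - ws) (w - ws)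
       + 2 * ofu_eta K * (loss y ws - loss y w') - 9 / 10 * bil H (w' - w) (w' - w)"
proof -
  let ?e = "ofu_eta K"
  have e: "?e \<ge> 2" "?e > 0" using ofu_eta_ge_2[of K] by auto
  note wc = param_ballD(1)[OF w] and Hc = spd_carrier[OF H]
  define g where "g = xbar w - f y"
  have gc: "g \<in> carrier_vec d" by (simp add: g_def)
  have gv: "vgrad d (mnl_loss v0 xs S y) w = g" unfolding g_def by (rule vgrad_loss[OF wc y])
  define A where "A = H + ?e \<cdot>\<^sub>m G w"
  have A: "spd d A"
    unfolding A_def using bil_G_bounds(1)[OF wc] e
    by (intro spd_add_psd[OF H]) (auto simp: bil_mat_smult[OF G_carrier] bil_G_swap)
  have bilA: "bil A u v = bil H u v + ?e * bil (G w) u v" if "u \<in> carrier_vec d" "v \<in> carrier_vec d" for u v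
    unfolding A_def using that bil_mat_add[OF Hc _ that, of "?e \<cdot>\<^sub>m G w"] by (simp add: bil_mat_smult[OF G_carrier])
  have "w' \<in> param_ball d \<and> (\<forall>u\<in>param_ball d. g \<bullet> w' + 1 / (2 * ?e) * bil A (w' - w) (w' - w)
        \<le> g \<bullet> u + 1 / (2 * ?e) * bil A (u - w) (u - w))"
    unfolding w'_def omd_next_def gv A_def[symmetric]
    by (rule theI'[OF quadratic_min_unique[OF A gc wc e(2)]])
  then have w': "w' \<in> param_ball d" and min: "\<And>u. u \<in> param_ball d \<Longrightarrow>
       g \<bullet> w' + 1 / (2 * ?e) * bil A (w' - w) (w' - w) \<le> g \<bullet> u + 1 / (2 * ?e) * bil A (u - w) (u - w)"
    by auto
  show "w' \<in> param_ball d" by (rule w')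
  note w'c = param_ballD(1)[OF w']
  note var = quadratic_min_variational[OF A gc wc e(2) w' _ min]
  let ?v = "w' - w"
  have v: "?v \<in> carrier_vec d" using w'c wc by simp
  have lv: "l * (?v \<bullet> ?v) \<le> bil H ?v ?v" by (rule l(1)[OF v])
  \<comment> \<open>Optimality tested at the old point bounds the quadratic term by the gradient
    term. With \<open>n\<close> the length of the step this reads
    \<open>100 n\<^sup>2 \<le> 2 n\<close>, so even \<open>1/50\<close> would be a bound.\<close>
  show small: "vnorm ?v \<le> 1 / 20"
  proof -
    have "w - w' = - ?v" using wc w'c by (intro eq_vecI) auto
    moreover have "bil A ?v (- ?v) = - bil A ?v ?v" "g \<bullet> (- ?v) = - (g \<bullet> ?v)"
      by (rule bil_uminus(1)[OF spd_carrier[OF A] v v], rule bil_uminus(3)[OF spd_carrier[OF A] gc v])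
    ultimately have "bil A ?v ?v / ?e \<le> - (g \<bullet> ?v)" using var[OF w] by simp
    moreover have "- (g \<bullet> ?v) \<le> 2 * vnorm ?v" using grad_dot_le[OF wc v, of y] by (simp add: g_def abs_le_iff)
    ultimately have "bil A ?v ?v / ?e \<le> 2 * vnorm ?v" by linarith
    then have "bil A ?v ?v \<le> 2 * ?e * vnorm ?v" using e by (simp add: divide_le_eq mult_ac)
    moreover have "bil H ?v ?v \<le> bil A ?v ?v" using bilA[OF v v] bil_G_bounds(1)[OF wc v] e by simp
    moreover have "100 * ?e * (?v \<bullet> ?v) \<le> l * (?v \<bullet> ?v)"
      using l(2) self_scalar_prod_nonneg by (intro mult_right_mono) auto
    ultimately have "100 * ?e * (?v \<bullet> ?v) \<le> 2 * ?e * vnorm ?v" using lv by linarith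
    then have "50 * (vnorm ?v * vnorm ?v) \<le> vnorm ?v"
      using e by (simp add: vnorm_sq[symmetric] power2_eq_square)
    then show ?thesis
      using vnorm_nonneg[of ?v] by (cases "vnorm ?v = 0") (auto simp flip: mult.assoc)
  qed
  fix ws assume ws: "ws \<in> param_ball d"
  note wsc = param_ballD(1)[OF ws]
  let ?q = "w' - ws"
  have q: "?q \<in> carrier_vec d" using w'c wsc by simp
  have neg: "ws - w' = - ?q" using wsc w'c by (intro eq_vecI) auto
  have "0 \<le> g \<bullet> (ws - w') + bil A ?v (ws - w') / ?e" by (rule var[OF ws])
  moreover have "bil A ?v (- ?q) = - bil A ?v ?q" "g \<bullet> (- ?q) = - (g \<bullet> ?q)"
    by (rule bil_uminus(1)[OF spd_carrier[OF A] v q], rule bil_uminus(3)[OF spd_carrier[OF A] gc q])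
  ultimately have "g \<bullet> ?q + bil A ?v ?q / ?e \<le> 0" unfolding neg by simp
  then have opt: "g \<bullet> ?q + bil (G w) ?v ?q + bil H ?v ?q / ?e \<le> 0"
    unfolding bilA[OF v q] using e by (simp add: add_divide_distrib algebra_simps)
  have rem: "(xbar w' - xbar w) \<bullet> ?q - bil (G w) ?q ?v \<le> 5 * (?v \<bullet> ?v)"
    using grad_remainder[OF w w' ws small] by (simp add: abs_le_iff)
  have "(xbar w' - xbar w) \<bullet> ?q = (xbar w' - f y) \<bullet> ?q - g \<bullet> ?q"
    using q by (simp add: g_def minus_scalar_prod_distrib[of _ d])
  then have g': "(xbar w' - f y) \<bullet> ?q \<le> 5 * (?v \<bullet> ?v) - bil H ?v ?q / ?e"
    using opt rem bil_G_swap[OF q v, of w] by linarith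
  have breg: "bil (G w') ?q ?q \<le> 2 * ?e * (loss y ws - loss y w' + (xbar w' - f y) \<bullet> ?q)"
  proof -
    have "bil (G w') (- ?q) (- ?q) = bil (G w') ?q ?q" "(xbar w' - f y) \<bullet> (- ?q) = - ((xbar w' - f y) \<bullet> ?q)"
    proof -
      have "- ?q \<in> carrier_vec d" using q by simp
      then show "bil (G w') (- ?q) (- ?q) = bil (G w') ?q ?q"
        using bil_uminus(1,2)[OF G_carrier] q by simp
      show "(xbar w' - f y) \<bullet> (- ?q) = - ((xbar w' - f y) \<bullet> ?q)"
        by (rule bil_uminus(3)[OF G_carrier _ q]) simp
    qed
    then show ?thesis using bregman_loss[OF K w' ws y] unfolding neg by simp
  qed
  have three: "2 * bil H ?v ?q = bil H ?v ?v + bil H ?q ?q - bil H (w - ws) (w - ws)"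
  proof -
    have "w - ws = ?q - ?v" using wc w'c wsc by (intro eq_vecI) auto
    then have "bil H (w - ws) (w - ws) = bil H ?q ?q - bil H ?v ?q - (bil H ?v ?q - bil H ?v ?v)"
      using q v Hc spd_swap[OF H q v] by (simp add: bil_linear[OF Hc])
    then show ?thesis by simp
  qed
  have "2 * ?e * ((xbar w' - f y) \<bullet> ?q) \<le> 2 * ?e * (5 * (?v \<bullet> ?v) - bil H ?v ?q / ?e)"
    using g' e by (intro mult_left_mono) auto
  also have "\<dots> = 10 * ?e * (?v \<bullet> ?v) - 2 * bil H ?v ?q" using e by (simp add: field_simps)
  finally have "2 * ?e * ((xbar w' - f y) \<bullet> ?q) \<le> 10 * ?e * (?v \<bullet> ?v) - 2 * bil H ?v ?q" .
  moreover have "10 * (10 * ?e * (?v \<bullet> ?v)) \<le> bil H ?v ?v"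
  proof -
    have "100 * ?e * (?v \<bullet> ?v) \<le> l * (?v \<bullet> ?v)"
      using l(2) self_scalar_prod_nonneg by (intro mult_right_mono) auto
    then show ?thesis using lv by simp
  qed
  moreover have "bil (H + G w') ?q ?q = bil H ?q ?q + bil (G w') ?q ?q"
    by (rule bil_mat_add[OF Hc G_carrier q q])
  ultimately show "bil (H + G w') ?q ?q \<le> bil H (w - ws) (w - ws)
       + 2 * ?e * (loss y ws - loss y w') - 9 / 10 * bil H ?v ?v"
    using breg three by (simp add: distrib_left)
qed

end

section \<open>The confidence process along a history\<close>

locale ofu_run =
  fixes v0 :: real and N K d :: nat and x :: "nat \<Rightarrow> hist \<Rightarrow> nat \<Rightarrow> real vec"
    and sel :: "nat \<Rightarrow> hist \<Rightarrow> (nat \<Rightarrow> real) \<Rightarrow> nat set" and w1 ws :: "real vec" and \<kappa> \<delta> :: real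
  assumes v0: "v0 > 0" and K: "K \<ge> 1" and d: "d \<ge> 1"
    and x: "\<And>t h i. x t h i \<in> carrier_vec d \<and> vnorm (x t h i) \<le> 1"
    and ws: "ws \<in> param_ball d" and w1: "w1 \<in> param_ball d" and \<kappa>: "\<kappa> > 0"
    and curv: "\<And>t h S i w. S \<in> assortments N K \<Longrightarrow> i \<in> S \<Longrightarrow> w \<in> param_ball d \<Longrightarrow>
        mnl_prob v0 (x t h) S w i * mnl_prob v0 (x t h) S w 0 \<ge> \<kappa>"
    and sel: "\<And>t h \<alpha>. sel t h \<alpha> \<in> opt_argmax v0 N K \<alpha>"
    and \<delta>: "0 < \<delta>" "\<delta> \<le> 1"
begin

abbreviation \<eta> :: real where "\<eta> \<equiv> ofu_eta K"
abbreviation l :: real where "l \<equiv> ofu_lambda d K"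
abbreviation c :: real where "c \<equiv> ofu_c K"
abbreviation feat :: "hist \<Rightarrow> nat \<Rightarrow> real vec" where "feat h \<equiv> x (Suc (length h)) h"
abbreviation est :: "hist \<Rightarrow> real vec" where "est h \<equiv> fst (ofu_state v0 d K x w1 h)"
abbreviation Hm :: "hist \<Rightarrow> real mat" where "Hm h \<equiv> snd (ofu_state v0 d K x w1 h)"
abbreviation offer :: "hist \<Rightarrow> nat set" where "offer h \<equiv> ofu_offer v0 d K \<delta> x sel w1 h"
abbreviation \<alpha> :: "hist \<Rightarrow> nat \<Rightarrow> real" where "\<alpha> h \<equiv> ofu_alpha v0 d K \<delta> x w1 h"

text \<open>All deterministic estimates hold on each such history; these include the support of
  \<open>hist_pmf\<close>.\<close>

primrec valid :: "hist \<Rightarrow> bool" where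
  "valid [] = True"
| "valid (e # h) = (valid h \<and> fst e = offer h \<and> snd e \<in> insert 0 (fst e))"

lemma eta: "\<eta> \<ge> 2" by (rule ofu_eta_ge_2)

lemma lam: "l \<ge> 100 * \<eta>" "l \<ge> 200" "l > 0"
proof -
  have "sqrt 2 \<ge> sqrt ((5 / 4)\<^sup>2)" by (intro real_sqrt_le_mono) (simp add: power2_eq_square)
  then have "84 * (5 / 4) * 1 \<le> 84 * sqrt 2 * real d"
    using d by (intro mult_mono) auto
  then have "100 * \<eta> \<le> l" unfolding ofu_lambda_def using eta by (intro mult_right_mono) auto
  then show "l \<ge> 100 * \<eta>" "l \<ge> 200" "l > 0" using eta by auto
qed

lemma c_pos: "c > 0" "l \<ge> 40 * c"
  using eta lam by (auto simp: ofu_c_def)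

lemma offer_argmax: "offer h \<in> opt_argmax v0 N K (\<alpha> h)"
  by (simp add: ofu_offer_def sel)

lemma offer_assort: "offer h \<in> assortments N K"
  using offer_argmax by (simp add: opt_argmax_def)

lemma assort: "S \<in> assortments N K \<Longrightarrow> finite S" "S \<in> assortments N K \<Longrightarrow> 0 \<notin> S"
   "S \<in> assortments N K \<Longrightarrow> card S \<le> K"
  by (auto simp: assortments_def intro: finite_subset)

lemma round: "S \<in> assortments N K \<Longrightarrow> mnl_round v0 d (feat h) S"
  using v0 x assort by unfold_locales auto

lemma state_Cons:
  assumes "S \<in> assortments N K"
  shows "est ((S, y) # h) = mnl_round.omd_next v0 d (feat h) S (Hm h) K y (est h)"
    "Hm ((S, y) # h) = Hm h + Gmat v0 d (feat h) S (est ((S, y) # h))"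
  by (simp_all add: Let_def mnl_round.omd_next_def[OF round[OF assms]])

lemma state_Nil: "est [] = w1" "Hm [] = l \<cdot>\<^sub>m 1\<^sub>m d"
  by simp_all

declare ofu_state.simps [simp del]

lemma valid_Cons:
  assumes "valid (e # h)"
  obtains y where "e = (offer h, y)" "valid h" "y \<in> insert 0 (offer h)"
  using assms by (cases e) auto

lemma state_inv:
  assumes "valid h"
  shows "spd d (Hm h)" "\<And>v. v \<in> carrier_vec d \<Longrightarrow> bil (Hm h) v v \<ge> l * (v \<bullet> v)"
    "est h \<in> param_ball d" "\<And>v. v \<in> carrier_vec d \<Longrightarrow> bil (Hm h) v v \<le> (l + real (length h)) * (v \<bullet> v)"
proof -
  have "spd d (Hm h) \<and> (\<forall>v\<in>carrier_vec d. bil (Hm h) v v \<ge> l * (v \<bullet> v)) \<and> est h \<in> param_ball d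
     \<and> (\<forall>v\<in>carrier_vec d. bil (Hm h) v v \<le> (l + real (length h)) * (v \<bullet> v))"
    using assms
  proof (induction h)
    case Nil
    then show ?case
      using w1 lam spd_smult_one by (simp add: state_Nil bil_mat_smult[OF one_carrier_mat])
  next
    case (Cons e h)
    then obtain y where e: "e = (offer h, y)" and v: "valid h" and y: "y \<in> insert 0 (offer h)"
      by (metis valid_Cons)
    note IH = Cons.IH[OF v]
    interpret mnl_round v0 d "feat h" "offer h" by (rule round[OF offer_assort])
    have yY: "y \<in> Y" using y by (simp add: Y_def)
    have H: "spd d (Hm h)" "\<And>v. v \<in> carrier_vec d \<Longrightarrow> bil (Hm h) v v \<ge> l * (v \<bullet> v)" "est h \<in> param_ball d"
      using IH by auto
    have w': "est (e # h) \<in> param_ball d"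
      unfolding e state_Cons[OF offer_assort]
      by (rule omd_step(1)[OF H(1,2) lam(1) K assort(3)[OF offer_assort] H(3) yY])
    note w'c = param_ballD(1)[OF w']
    have Hs: "Hm (e # h) = Hm h + G (est (e # h))" unfolding e by (rule state_Cons(2)[OF offer_assort])
    have bil: "bil (Hm (e # h)) v v = bil (Hm h) v v + bil (G (est (e # h))) v v" if "v \<in> carrier_vec d" for v
      unfolding Hs by (rule bil_mat_add[OF spd_carrier[OF H(1)] G_carrier that that])
    have "spd d (Hm (e # h))" unfolding Hs by (rule tau_le_ln_det(1)[OF H(1,2) lam(2) w'c])
    then show ?case
      using w' bil IH bil_G_bounds[OF w'c] by (fastforce simp: distrib_right)
  qed
  then show "spd d (Hm h)" "\<And>v. v \<in> carrier_vec d \<Longrightarrow> bil (Hm h) v v \<ge> l * (v \<bullet> v)"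
    "est h \<in> param_ball d" "\<And>v. v \<in> carrier_vec d \<Longrightarrow> bil (Hm h) v v \<le> (l + real (length h)) * (v \<bullet> v)" by auto
qed

section \<open>The potential \<open>D\<close>: growth of the log-determinant since the start\<close>

definition D :: "hist \<Rightarrow> real" where "D h = ln (det (Hm h)) - real d * ln l"

lemma D_Nil: "D [] = 0"
  using lam by (simp add: D_def state_Nil ln_realpow)

text \<open>By \<open>hadamard\<close> the diagonal entries suffice, and each is at most
  \<open>l\<close> plus the number of rounds, because every summand \<open>G\<close> is dominated by
  the identity.\<close>

lemma D_le:
  assumes "valid h" shows "D h \<le> real d * ln (1 + real (length h) / l)"
proof -
  note H = state_inv[OF assms]
  have diag: "0 \<le> Hm h $$ (j, j) \<and> Hm h $$ (j, j) \<le> l + real (length h)" if "j < d" for j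
    using H(4)[of "unit_vec d j"] H(2)[of "unit_vec d j"] lam that
      bil_unit_vec[OF spd_carrier[OF H(1)] that that] by (simp add: scalar_prod_left_unit)
  have "det (Hm h) \<le> (\<Prod>j<d. Hm h $$ (j, j))" using hadamard[OF H(1)] by simp
  also have "\<dots> \<le> (\<Prod>j<d. l + real (length h))" using diag by (intro prod_mono) auto
  finally have "det (Hm h) \<le> (l + real (length h)) ^ d" by simp
  then have "ln (det (Hm h)) \<le> real d * ln (l + real (length h))"
    using hadamard[OF H(1)] lam by (subst ln_realpow[symmetric]) (auto intro: ln_mono)
  moreover have "ln (1 + real (length h) / l) = ln (l + real (length h)) - ln l"
  proof -
    have "1 + real (length h) / l = (l + real (length h)) / l" using lam by (simp add: field_simps)
    then show ?thesis using lam by (simp add: ln_div)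
  qed
  ultimately show ?thesis by (simp add: D_def right_diff_distrib)
qed

abbreviation tauh :: "hist \<Rightarrow> real vec \<Rightarrow> real" where
  "tauh h w \<equiv> mnl_round.tau v0 d (feat h) (offer h) w (minv (Hm h))"

lemma D_Cons:
  assumes "valid h" "y \<in> insert 0 (offer h)"
  shows "tauh h (est ((offer h, y) # h)) \<le> 11 / 10 * (D ((offer h, y) # h) - D h)"
    "0 \<le> tauh h (est ((offer h, y) # h))"
proof -
  interpret mnl_round v0 d "feat h" "offer h" by (rule round[OF offer_assort])
  have "valid ((offer h, y) # h)" using assms by simp
  note w' = param_ballD(1)[OF state_inv(3)[OF this]]
  note H = state_inv[OF assms(1)]
  show "tauh h (est ((offer h, y) # h)) \<le> 11 / 10 * (D ((offer h, y) # h) - D h)"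
    using tau_le_ln_det(3)[OF H(1,2) lam(2) w'] by (simp add: D_def state_Cons(2)[OF offer_assort])
  show "0 \<le> tauh h (est ((offer h, y) # h))" by (rule tau_nonneg[OF spd_minv_spd[OF H(1)] w'])
qed

text \<open>One-step likelihood ratio of the normalized forecaster against the true parameter.\<close>
definition lr :: "hist \<Rightarrow> nat \<Rightarrow> real" where
  "lr h y = (let S = offer h; w' = est ((S, y) # h) in
     exp (mnl_loss v0 (feat h) S y ws - mnl_loss v0 (feat h) S y w'
        - bil (Hm h) (w' - est h) (w' - est h) / (2 * c) - 11 / 20 * c * tauh h (est h)))"

text \<open>Because of the stopping, \<open>lrp h < 1 / \<delta>\<close> entails the same bound for every earlier history.\<close>
primrec lrp :: "hist \<Rightarrow> real" where
  "lrp [] = 1"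
| "lrp (e # h) = (if lrp h \<ge> 1 / \<delta> then lrp h else lrp h * lr h (snd e))"

lemma lr_pos: "lr h y > 0" by (simp add: lr_def Let_def)

lemma lrp_pos: "lrp h > 0" by (induction h) (auto simp: lr_pos)

text \<open>The probability under the truth cancels the true likelihood inside \<open>lr\<close>.
  What is left is the sum in \<open>discounted_likelihood_sum\<close> times the last factor of
  \<open>lr\<close>, which is the reciprocal of the bound given there.\<close>

lemma lr_supermartingale:
  assumes "valid h"
  shows "(\<Sum>y\<in>insert 0 (offer h). mnl_prob v0 (feat h) (offer h) ws y * lr h y) \<le> 1"
proof -
  interpret mnl_round v0 d "feat h" "offer h" by (rule round[OF offer_assort])
  note H = state_inv[OF assms]
  note wc = param_ballD(1)[OF H(3)] and wsc = param_ballD(1)[OF ws]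
  let ?v = "\<lambda>y. est ((offer h, y) # h)"
  let ?t = "11 / 20 * c * tau (est h) (minv (Hm h))"
  have vc: "?v y \<in> carrier_vec d" if "y \<in> Y" for y
    using state_inv(3)[of "(offer h, y) # h"] assms that by (auto simp: Y_def intro: param_ballD)
  have "p ws y * lr h y = p (?v y) y * exp (- bil (Hm h) (?v y - est h) (?v y - est h) / (2 * c)) * exp (- ?t)"
    if "y \<in> Y" for y
  proof -
    have "lr h y = exp (ln (p (?v y) y) - ln (p ws y))
        * exp (- bil (Hm h) (?v y - est h) (?v y - est h) / (2 * c)) * exp (- ?t)"
      by (simp add: lr_def Let_def loss_eq[OF that] flip: exp_add)
    then show ?thesis
      using p_pos[OF wsc that] p_pos[OF vc[OF that] that] by (simp add: exp_diff)
  qed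
  then have "(\<Sum>y\<in>Y. p ws y * lr h y)
     = (\<Sum>y\<in>Y. p (?v y) y * exp (- bil (Hm h) (?v y - est h) (?v y - est h) / (2 * c))) * exp (- ?t)"
    by (simp add: sum_distrib_right)
  also have "\<dots> \<le> exp ?t * exp (- ?t)"
    using discounted_likelihood_sum[OF H(1,2) c_pos wc vc] by (intro mult_right_mono) auto
  finally show ?thesis by (simp add: Y_def flip: exp_add)
qed

text \<open>The excess loss in \<open>omd_step\<close> is replaced by the logarithm of
  \<open>lr\<close>. The discount then takes \<open>\<eta> / c = 6/7\<close> of the squared step, of
  which \<open>9/10\<close> are available. The normalization takes at most
  \<open>11/20 * 6/5 * 11/10 < 1\<close> times \<open>2 * \<eta> * c\<close> times the growth of
  \<open>D\<close>, the factors coming from \<open>lr\<close>, \<open>tau_change\<close> and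
  \<open>D_Cons\<close>. The initial \<open>4 * l\<close> reflects that the ball has diameter
  2.\<close>

lemma confidence:
  assumes "valid h" "lrp h < 1 / \<delta>"
  shows "bil (Hm h) (est h - ws) (est h - ws) \<le> 4 * l + 2 * \<eta> * ln (lrp h) + 2 * \<eta> * c * D h"
  using assms
proof (induction h)
  case Nil
  let ?u = "w1 - ws"
  have u: "?u \<in> carrier_vec d" "w1 \<in> carrier_vec d" "ws \<in> carrier_vec d" using w1 ws param_ballD by auto
  have vn: "vnorm w1 \<le> 1" "vnorm ws \<le> 1" using w1 ws by (auto simp: param_ball_def)
  have "\<bar>w1 \<bullet> ws\<bar> \<le> 1"
    using cauchy_schwarz_vnorm[OF u(2,3)] mult_le_one[OF vn(1) _ vn(2)] by simp
  then have "?u \<bullet> ?u \<le> 4"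
    using u comm_scalar_prod[OF u(2,3)] param_ballD(2)[OF w1] param_ballD(2)[OF ws]
    by (simp add: minus_scalar_prod_distrib[of _ d] scalar_prod_minus_distrib[of _ d])
  then show ?case using u lam by (simp add: D_Nil state_Nil bil_mat_smult[OF one_carrier_mat])
next
  case (Cons e h)
  then obtain y where e: "e = (offer h, y)" and v: "valid h" and y: "y \<in> insert 0 (offer h)"
    by (metis valid_Cons)
  have small: "lrp h < 1 / \<delta>" using Cons.prems(2) by (auto split: if_splits)
  note IH = Cons.IH[OF v small]
  interpret mnl_round v0 d "feat h" "offer h" by (rule round[OF offer_assort])
  note H = state_inv[OF v]
  have yY: "y \<in> Y" using y by (simp add: Y_def)
  let ?w' = "est (e # h)" and ?w = "est h"
  let ?B = "bil (Hm h) (?w' - ?w) (?w' - ?w)"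
  have w'eq: "?w' = omd_next (Hm h) K y ?w" unfolding e by (rule state_Cons(1)[OF offer_assort])
  note step = omd_step[OF H(1,2) lam(1) K assort(3)[OF offer_assort] H(3) yY, folded w'eq]
  have w'c: "?w' \<in> carrier_vec d" by (rule param_ballD(1)[OF step(1)])
  have B0: "?B \<ge> 0" using spd_nonneg[OF H(1)] w'c param_ballD(1)[OF H(3)] by simp
  have ln: "ln (lrp (e # h)) = ln (lrp h) + (loss y ws - loss y ?w' - ?B / (2 * c) - 11 / 20 * c * tauh h ?w)"
    using small lrp_pos[of h] lr_pos[of h y] by (simp add: e ln_mult) (simp add: lr_def Let_def)
  have tau: "tauh h ?w \<le> 6 / 5 * (11 / 10 * (D (e # h) - D h))"
  proof -
    have "tauh h ?w \<le> 6 / 5 * tauh h ?w'"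
      by (rule tau_change[OF spd_minv_spd[OF H(1)] param_ballD(1)[OF H(3)] w'c step(2)])
    then show ?thesis using D_Cons(1)[OF v y] by (simp add: e)
  qed
  have Dinc: "D (e # h) - D h \<ge> 0" using D_Cons[OF v y] by (simp add: e)
  have ec: "\<eta> / c = 6 / 7" "\<eta> * c > 0" using eta c_pos by (auto simp: ofu_c_def)
  have "2 * \<eta> * (loss y ws - loss y ?w') = 2 * \<eta> * (ln (lrp (e # h)) - ln (lrp h))
      + \<eta> / c * ?B + 2 * (\<eta> * c) * (11 / 20 * tauh h ?w)"
    unfolding ln using c_pos by (simp add: field_simps)
  also have "\<dots> \<le> 2 * \<eta> * (ln (lrp (e # h)) - ln (lrp h)) + 6 / 7 * ?B + 2 * (\<eta> * c) * (D (e # h) - D h)"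
    unfolding ec(1) using tau Dinc ec(2) eta by (intro add_mono mult_left_mono) auto
  finally have "2 * \<eta> * (loss y ws - loss y ?w') \<le> 2 * \<eta> * (ln (lrp (e # h)) - ln (lrp h)) + 6 / 7 * ?B
     + 2 * (\<eta> * c) * (D (e # h) - D h)" .
  moreover have "bil (Hm (e # h)) (?w' - ws) (?w' - ws) \<le> bil (Hm h) (?w - ws) (?w - ws)
       + 2 * \<eta> * (loss y ws - loss y ?w') - 9 / 10 * ?B"
    using step(3)[OF _ ws] state_Cons(2)[OF offer_assort, of h y] by (simp add: e)
  ultimately show ?case using IH B0 by (simp add: algebra_simps)
qed

text \<open>The product of logarithms in the radius dominates \<open>ln (1 / \<delta>)\<close>. Its
  determinant term has \<open>2 * l\<close> where \<open>D_le\<close> has \<open>l\<close>;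
  \<open>ln (1 + 2 a) \<le> 2 * ln (1 + a)\<close> and \<open>2 \<le> sqrt 6\<close> make up for
  this.\<close>

lemma beta_nonneg: "ofu_beta d K \<delta> t \<ge> 0"
  and beta_sq: "4 * l + 2 * \<eta> * ln (1 / \<delta>) + 2 * \<eta> * c * (real d * ln (1 + real n / l)) \<le> (ofu_beta d K \<delta> (Suc n))\<^sup>2"
proof -
  have a1: "11 * (3 * ln (1 + (real K + 1) * real t) + 3) \<ge> 1" for t
  proof -
    have "ln (1 + (real K + 1) * real t) \<ge> 0" by (intro ln_ge_zero) auto
    then show ?thesis by simp
  qed
  have a2: "ln (2 * sqrt (1 + 2 * real t) / \<delta>) \<ge> ln (1 / \<delta>)" "ln (1 / \<delta>) \<ge> 0" for t
  proof -
    have "1 \<le> sqrt (1 + 2 * real t)" by simp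
    then have "1 \<le> 2 * sqrt (1 + 2 * real t)" by linarith
    then have "1 / \<delta> \<le> 2 * sqrt (1 + 2 * real t) / \<delta>"
      using \<delta> by (intro divide_right_mono) auto
    then show "ln (2 * sqrt (1 + 2 * real t) / \<delta>) \<ge> ln (1 / \<delta>)" using \<delta> by (intro ln_mono) auto
    show "ln (1 / \<delta>) \<ge> 0" using \<delta> by (intro ln_ge_zero) auto
  qed
  have a: "11 * (3 * ln (1 + (real K + 1) * real t) + 3) * ln (2 * sqrt (1 + 2 * real t) / \<delta>) \<ge> ln (1 / \<delta>)" for t
    using mult_mono[OF a1[of t] a2(1)[of t]] a1[of t] a2(2) by simp
  have g0: "ln (1 + (real t + 1) / (2 * l)) \<ge> 0" for t using lam by (intro ln_ge_zero) auto
  have g: "ln (1 + real n / l) \<le> sqrt 6 * ln (1 + (real (Suc n) + 1) / (2 * l))" for n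
  proof -
    let ?a = "real n / (2 * l)"
    have a: "?a \<ge> 0" using lam by simp
    have "1 + real n / l \<le> (1 + ?a)\<^sup>2"
      using lam by (simp add: power2_sum)
    then have "ln (1 + real n / l) \<le> ln ((1 + ?a)\<^sup>2)" using lam by (intro ln_mono add_pos_nonneg) auto
    also have "\<dots> = 2 * ln (1 + ?a)" using a by (simp add: ln_realpow)
    also have "\<dots> \<le> 2 * ln (1 + (real (Suc n) + 1) / (2 * l))"
    proof (intro mult_left_mono ln_mono add_left_mono divide_right_mono)
      show "0 < 1 + ?a" using a by linarith
    qed (use lam in auto)
    also have "\<dots> \<le> sqrt 6 * ln (1 + (real (Suc n) + 1) / (2 * l))"
      using g0[of "Suc n"] by (intro mult_right_mono real_le_rsqrt) auto
    finally show ?thesis .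
  qed
  define E where "E t = 11 * (3 * ln (1 + (real K + 1) * real t) + 3) * ln (2 * sqrt (1 + 2 * real t) / \<delta>)
         + 2 + sqrt 6 * c * real d * ln (1 + (real t + 1) / (2 * l))" for t
  have beta: "ofu_beta d K \<delta> t = 4 * \<eta> / l + sqrt (2 * \<eta> * E t + 4 * l)" for t
    by (simp add: ofu_beta_def E_def)
  have E0: "E t \<ge> 0" for t
  proof -
    have "0 \<le> sqrt 6 * c * real d * ln (1 + (real t + 1) / (2 * l))"
      using c_pos g0[of t] by (intro mult_nonneg_nonneg) auto
    then show ?thesis unfolding E_def using a[of t] a2(2) by linarith
  qed
  have r0: "2 * \<eta> * E t + 4 * l \<ge> 0" for t using E0[of t] eta lam by simp
  have f0: "4 * \<eta> / l \<ge> 0" using eta lam by simp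
  show "ofu_beta d K \<delta> t \<ge> 0" unfolding beta using f0 r0 by (intro add_nonneg_nonneg) auto
  have "c * real d * ln (1 + real n / l) \<le> c * real d * (sqrt 6 * ln (1 + (real (Suc n) + 1) / (2 * l)))"
    using c_pos g by (intro mult_left_mono) auto
  then have "ln (1 / \<delta>) + c * (real d * ln (1 + real n / l)) \<le> E (Suc n)"
    unfolding E_def using a[of "Suc n"] by (simp add: mult_ac)
  then have "2 * \<eta> * (ln (1 / \<delta>) + c * (real d * ln (1 + real n / l))) \<le> 2 * \<eta> * E (Suc n)"
    using eta by (intro mult_left_mono) auto
  then have "4 * l + 2 * \<eta> * ln (1 / \<delta>) + 2 * \<eta> * c * (real d * ln (1 + real n / l)) \<le> 2 * \<eta> * E (Suc n) + 4 * l"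
    by (simp add: algebra_simps)
  also have "\<dots> = (sqrt (2 * \<eta> * E (Suc n) + 4 * l))\<^sup>2" using r0 by simp
  also have "\<dots> \<le> (ofu_beta d K \<delta> (Suc n))\<^sup>2"
    unfolding beta using f0 r0 by (intro power_mono) auto
  finally show "4 * l + 2 * \<eta> * ln (1 / \<delta>) + 2 * \<eta> * c * (real d * ln (1 + real n / l)) \<le> (ofu_beta d K \<delta> (Suc n))\<^sup>2" .
qed

abbreviation beta :: "hist \<Rightarrow> real" where "beta h \<equiv> ofu_beta d K \<delta> (Suc (length h))"
abbreviation wn :: "hist \<Rightarrow> nat \<Rightarrow> real" where "wn h i \<equiv> wnorm (minv (Hm h)) (feat h i)"

lemma optimism:
  assumes "valid h" "lrp h < 1 / \<delta>"
  shows "feat h i \<bullet> ws \<le> \<alpha> h i" "\<alpha> h i \<le> feat h i \<bullet> ws + 2 * beta h * wn h i" "0 \<le> wn h i"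
    "(wn h i)\<^sup>2 = bil (minv (Hm h)) (feat h i) (feat h i)"
proof -
  note H = state_inv[OF assms(1)]
  have xc: "feat h i \<in> carrier_vec d" using x by blast
  have uc: "est h \<in> carrier_vec d" "ws \<in> carrier_vec d" using H(3) ws param_ballD by auto
  then have u: "est h - ws \<in> carrier_vec d" by simp
  have b0: "bil (minv (Hm h)) (feat h i) (feat h i) \<ge> 0" by (rule spd_nonneg[OF spd_minv_spd[OF H(1)] xc])
  then show w0: "0 \<le> wn h i" and sq: "(wn h i)\<^sup>2 = bil (minv (Hm h)) (feat h i) (feat h i)"
    by (auto simp: wnorm_def)
  have "ln (lrp h) \<le> ln (1 / \<delta>)" using assms(2) lrp_pos[of h] by (intro ln_mono) auto
  then have "2 * \<eta> * ln (lrp h) \<le> 2 * \<eta> * ln (1 / \<delta>)" using eta by (intro mult_left_mono) auto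
  moreover have "2 * \<eta> * c * D h \<le> 2 * \<eta> * c * (real d * ln (1 + real (length h) / l))"
    using D_le[OF assms(1)] eta c_pos by (intro mult_left_mono) auto
  ultimately have B: "bil (Hm h) (est h - ws) (est h - ws) \<le> (beta h)\<^sup>2"
    using confidence[OF assms] beta_sq[of "length h"] by linarith
  have "(feat h i \<bullet> (est h - ws))\<^sup>2 \<le> bil (minv (Hm h)) (feat h i) (feat h i) * bil (Hm h) (est h - ws) (est h - ws)"
    by (rule cauchy_schwarz_minv[OF H(1) xc u])
  also have "\<dots> \<le> (wn h i)\<^sup>2 * (beta h)\<^sup>2" using B b0 sq by (simp add: mult_left_mono)
  also have "\<dots> = (beta h * wn h i)\<^sup>2" by (simp add: power_mult_distrib)
  finally have "\<bar>feat h i \<bullet> (est h - ws)\<bar> \<le> beta h * wn h i"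
    using beta_nonneg w0 by (metis abs_le_square_iff abs_of_nonneg mult_nonneg_nonneg)
  then have "\<bar>feat h i \<bullet> est h - feat h i \<bullet> ws\<bar> \<le> beta h * wn h i"
    using xc uc by (simp add: scalar_prod_minus_distrib[of _ d])
  then show "feat h i \<bullet> ws \<le> \<alpha> h i" "\<alpha> h i \<le> feat h i \<bullet> ws + 2 * beta h * wn h i"
    by (auto simp: ofu_alpha_def Let_def abs_le_iff)
qed

end

section \<open>Regret of one round\<close>

text \<open>\<open>q0\<close> is the no-purchase probability, and with logits raised by
  \<open>e\<close> it becomes the quotient on the left, so the difference is the gain in revenue. If
  \<open>\<bar>M\<bar> \<ge> 1\<close> the claim follows from \<open>q0 \<le> 1\<close>; otherwise
  \<open>exp (e i) - 1 \<le> e i + M\<^sup>2\<close>.\<close>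

lemma revenue_gain:
  fixes q e :: "'i \<Rightarrow> real"
  assumes S: "finite S" and q: "\<And>i. i \<in> S \<Longrightarrow> q i \<ge> 0" "q0 > 0" "q0 + (\<Sum>i\<in>S. q i) = 1"
    and e: "\<And>i. i \<in> S \<Longrightarrow> 0 \<le> e i" "\<And>i. i \<in> S \<Longrightarrow> e i \<le> M"
  shows "q0 - q0 / (q0 + (\<Sum>i\<in>S. q i * exp (e i))) \<le> q0 * (\<Sum>i\<in>S. q i * e i) + M\<^sup>2"
proof -
  define Z where "Z = (\<Sum>i\<in>S. q i * (exp (e i) - 1))"
  have Z: "q0 + (\<Sum>i\<in>S. q i * exp (e i)) = 1 + Z"
    using q(3) by (simp add: Z_def right_diff_distrib sum_subtractf)
  have Z0: "Z \<ge> 0" unfolding Z_def using q e by (intro sum_nonneg mult_nonneg_nonneg) auto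
  have q1: "q0 \<le> 1" using q sum_nonneg[of S q] by simp
  have lin0: "0 \<le> q0 * (\<Sum>i\<in>S. q i * e i)" using q e by (intro mult_nonneg_nonneg sum_nonneg) auto
  show ?thesis
  proof (cases "\<bar>M\<bar> \<ge> 1")
    case True
    then have "1 \<le> M\<^sup>2" by (simp add: abs_square_less_1[symmetric] not_less[symmetric])
    moreover have "0 \<le> q0 / (1 + Z)" using q Z0 by simp
    ultimately show ?thesis unfolding Z using q1 lin0 by linarith
  next
    case False
    have "Z \<le> (\<Sum>i\<in>S. q i * (e i + M\<^sup>2))"
      unfolding Z_def
    proof (intro sum_mono mult_left_mono)
      fix i assume i: "i \<in> S"
      have "\<bar>e i\<bar> \<le> 1" using e[OF i] False by auto
      from exp_quadratic_bounds[OF this] have "exp (e i) - 1 \<le> e i + (e i)\<^sup>2" by linarith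
      moreover have "(e i)\<^sup>2 \<le> M\<^sup>2" using e[OF i] by (intro power_mono) auto
      ultimately show "exp (e i) - 1 \<le> e i + M\<^sup>2" by linarith
    qed (use q in auto)
    also have "\<dots> = (\<Sum>i\<in>S. q i * e i) + (\<Sum>i\<in>S. q i) * M\<^sup>2"
      by (simp add: distrib_left sum.distrib sum_distrib_right)
    also have "\<dots> \<le> (\<Sum>i\<in>S. q i * e i) + 1 * M\<^sup>2" using q by (intro add_left_mono mult_right_mono) auto
    finally have "q0 * Z \<le> q0 * ((\<Sum>i\<in>S. q i * e i) + M\<^sup>2)" using q by (intro mult_left_mono) auto
    also have "\<dots> \<le> q0 * (\<Sum>i\<in>S. q i * e i) + 1 * M\<^sup>2"
      unfolding distrib_left using q1 by (intro add_left_mono mult_right_mono) auto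
    finally have "q0 * Z \<le> q0 * (\<Sum>i\<in>S. q i * e i) + M\<^sup>2" by simp
    moreover have "q0 - q0 / (1 + Z) = (q0 * Z) / (1 + Z)" using Z0 by (simp add: field_simps)
    moreover have "(q0 * Z) / (1 + Z) \<le> q0 * Z"
      using divide_left_mono[of 1 "1 + Z" "q0 * Z"] Z0 q by simp
    ultimately show ?thesis unfolding Z by linarith
  qed
qed

lemma share_mono:
  fixes v0 a b :: real
  assumes "v0 > 0" "0 \<le> a" "0 \<le> b"
  shows "a / (v0 + a) \<le> b / (v0 + b) \<longleftrightarrow> a \<le> b"
proof -
  have "a / (v0 + a) \<le> b / (v0 + b) \<longleftrightarrow> a * (v0 + b) \<le> b * (v0 + a)"
    using assms by (simp add: pos_divide_le_eq pos_le_divide_eq add_pos_nonneg mult.commute divide_le_eq le_divide_eq)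
  also have "\<dots> \<longleftrightarrow> a * v0 \<le> b * v0" by (simp add: algebra_simps)
  finally show ?thesis using assms by simp
qed

text \<open>With unit rewards the revenue is an increasing function of the total weight
  alone.\<close>

lemma opt_argmax_sum:
  assumes "v0 > 0" "S \<in> opt_argmax v0 N K a" "S' \<in> assortments N K"
  shows "(\<Sum>i\<in>S'. exp (a i)) \<le> (\<Sum>i\<in>S. exp (a i))"
proof -
  have "opt_rev v0 a S' \<le> opt_rev v0 a S" using assms by (auto simp: opt_argmax_def)
  then show ?thesis using share_mono[OF assms(1), of "\<Sum>i\<in>S'. exp (a i)" "\<Sum>i\<in>S. exp (a i)"]
    by (simp add: opt_rev_def sum_nonneg)
qed

lemma opt_argmax_card:
  assumes "v0 > 0" "S \<in> opt_argmax v0 N K a"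
  shows "card S = K \<or> S = {1..N}"
proof (rule ccontr)
  assume neg: "\<not> ?thesis"
  have S: "S \<subseteq> {1..N}" "card S \<le> K" using assms by (auto simp: opt_argmax_def assortments_def)
  then obtain i where i: "i \<in> {1..N}" "i \<notin> S" using neg by blast
  have fin: "finite S" using S finite_subset by blast
  have "insert i S \<in> assortments N K" using S i neg fin by (auto simp: assortments_def)
  from opt_argmax_sum[OF assms this] show False using i fin by (simp add: not_le[symmetric])
qed

context ofu_run
begin

lemma exp_rev_eq:
  assumes "S \<in> assortments N K"
  shows "exp_rev v0 xs S w = (\<Sum>i\<in>S. exp (xs i \<bullet> w)) / (v0 + (\<Sum>i\<in>S. exp (xs i \<bullet> w)))"
proof -
  have "mnl_prob v0 xs S w i * 1 = exp (xs i \<bullet> w) / (v0 + (\<Sum>i\<in>S. exp (xs i \<bullet> w)))" if "i \<in> S" for i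
  proof -
    have "i \<noteq> 0" using assort(2)[OF assms] that by metis
    then show ?thesis using that unfolding mnl_prob_def by simp
  qed
  then have "exp_rev v0 xs S w = (\<Sum>i\<in>S. exp (xs i \<bullet> w) / (v0 + (\<Sum>i\<in>S. exp (xs i \<bullet> w))))"
    unfolding exp_rev_def by (rule sum.cong[OF refl])
  then show ?thesis by (simp only: sum_divide_distrib)
qed

lemma finite_assort: "finite (assortments N K)" "{} \<in> assortments N K"
proof -
  have "assortments N K \<subseteq> Pow {1..N}" by (auto simp: assortments_def)
  then show "finite (assortments N K)" by (rule finite_subset) simp
qed (simp add: assortments_def)

abbreviation inst_regret :: "hist \<Rightarrow> real" where
  "inst_regret h \<equiv> Max ((\<lambda>S. exp_rev v0 (feat h) S ws) ` assortments N K) - exp_rev v0 (feat h) (offer h) ws"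

definition Bd :: real where "Bd = v0 * real K / (v0 + real K)\<^sup>2"

lemma Bd_pos: "Bd > 0" using v0 K by (simp add: Bd_def)

text \<open>Optimism bounds the best revenue by that of the offered set at inflated utilities, so
  the regret is a gain as in \<open>revenue_gain\<close>. The bound is stated with the variance at
  the updated estimate of an arbitrary possible outcome \<open>y\<close>, because that is the
  quantity for which \<open>D\<close> pays.\<close>

lemma inst_regret_le:
  assumes h: "valid h" "lrp h < 1 / \<delta>" and y: "y \<in> insert 0 (offer h)" and th: "\<theta> > 0"
  defines "t' \<equiv> tauh h (est ((offer h, y) # h))"
  shows "inst_regret h \<le> beta h * (27 * Bd * \<theta> + 6561 * t' / \<theta>) + 4 * (beta h)\<^sup>2 * t' / \<kappa>"
proof -
  let ?S = "offer h" and ?w' = "est ((offer h, y) # h)" and ?u = "\<lambda>i. feat h i \<bullet> ws"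
  interpret mnl_round v0 d "feat h" ?S by (rule round[OF offer_assort])
  note H = state_inv[OF h(1)]
  have w': "?w' \<in> param_ball d" using state_inv(3)[of "(offer h, y) # h"] h y by simp
  note w'c = param_ballD(1)[OF w'] and wsc = param_ballD(1)[OF ws]
  have A: "spd d (minv (Hm h))" by (rule spd_minv_spd[OF H(1)])
  have t0: "t' \<ge> 0" unfolding t'_def using D_Cons(2)[OF h(1) y] .
  have b0: "beta h \<ge> 0" by (rule beta_nonneg)
  note opt = optimism[OF h]
  define V where "V S = (\<Sum>i\<in>S. exp (?u i))" for S
  define V' where "V' S = (\<Sum>i\<in>S. exp (\<alpha> h i))" for S
  have Vpos: "V S \<ge> 0" "V' S \<ge> 0" for S by (auto simp: V_def V'_def intro: sum_nonneg)
  have rhs0: "0 \<le> beta h * (27 * Bd * \<theta> + 6561 * t' / \<theta>) + 4 * (beta h)\<^sup>2 * t' / \<kappa>"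
    using b0 t0 th Bd_pos \<kappa> by (intro add_nonneg_nonneg mult_nonneg_nonneg divide_nonneg_nonneg) auto
  have rev: "exp_rev v0 (feat h) S ws = V S / (v0 + V S)" if "S \<in> assortments N K" for S
    unfolding V_def by (rule exp_rev_eq[OF that])
  show ?thesis
  \<comment> \<open>Offering every item leaves no regret. Otherwise the set has exactly
    \<open>K\<close> items, which gives its total weight the order \<open>K\<close>.\<close>
  proof (cases "?S = {1..N}")
    case True
    have "exp_rev v0 (feat h) S ws \<le> exp_rev v0 (feat h) ?S ws" if "S \<in> assortments N K" for S
    proof -
      have "V S \<le> V ?S" unfolding V_def using that True by (intro sum_mono2) (auto simp: assortments_def)
      then show ?thesis unfolding rev[OF that] rev[OF offer_assort] using share_mono[OF v0] Vpos by simp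
    qed
    then have "inst_regret h \<le> 0" using finite_assort by (auto intro!: Max.boundedI)
    then show ?thesis using rhs0 by linarith
  next
    case False
    then have card: "card ?S = K" using opt_argmax_card[OF v0 offer_argmax] by blast
    have "exp_rev v0 (feat h) S ws \<le> V' ?S / (v0 + V' ?S)" if S: "S \<in> assortments N K" for S
    proof -
      have "V S \<le> V' S" unfolding V_def V'_def using opt(1) by (intro sum_mono) simp
      also have "\<dots> \<le> V' ?S" unfolding V'_def by (rule opt_argmax_sum[OF v0 offer_argmax S])
      finally show ?thesis unfolding rev[OF S] using share_mono[OF v0] Vpos by simp
    qed
    then have "Max ((\<lambda>S. exp_rev v0 (feat h) S ws) ` assortments N K) \<le> V' ?S / (v0 + V' ?S)"
      using finite_assort by (intro Max.boundedI) auto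
    then have r1: "inst_regret h \<le> V' ?S / (v0 + V' ?S) - V ?S / (v0 + V ?S)"
      unfolding rev[OF offer_assort] by linarith
    define q where "q i = p ws i" for i
    define e where "e i = \<alpha> h i - ?u i" for i
    have q: "q i = exp (?u i) / (v0 + V ?S)" if "i \<in> ?S" for i
      using that S0 by (auto simp: q_def mnl_prob_def V_def)
    have q0: "q 0 = v0 / (v0 + V ?S)" by (simp add: q_def mnl_prob_def V_def)
    have qpos: "q i > 0" if "i \<in> Y" for i unfolding q_def by (rule p_pos[OF wsc that])
    have qsum: "q 0 + (\<Sum>i\<in>?S. q i) = 1" using p_sum_S[OF wsc] by (simp add: q_def)
    have vV: "v0 + V ?S > 0" "v0 + V' ?S > 0" using v0 Vpos by (auto intro: add_pos_nonneg)
    have "q 0 + (\<Sum>i\<in>?S. q i * exp (e i)) = (v0 + V' ?S) / (v0 + V ?S)"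
    proof -
      have "(\<Sum>i\<in>?S. q i * exp (e i)) = (\<Sum>i\<in>?S. exp (\<alpha> h i) / (v0 + V ?S))"
        by (intro sum.cong refl) (simp add: q e_def exp_diff)
      then show ?thesis by (simp add: q0 V'_def add_divide_distrib sum_divide_distrib)
    qed
    then have r: "q 0 / (q 0 + (\<Sum>i\<in>?S. q i * exp (e i))) = v0 / (v0 + V' ?S)"
      using vV by (simp add: q0)
    have r2: "V' ?S / (v0 + V' ?S) - V ?S / (v0 + V ?S) = q 0 - q 0 / (q 0 + (\<Sum>i\<in>?S. q i * exp (e i)))"
    proof -
      have "V' ?S / (v0 + V' ?S) = 1 - v0 / (v0 + V' ?S)" "V ?S / (v0 + V ?S) = 1 - v0 / (v0 + V ?S)"
        using vV by (simp_all add: field_simps)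
      then show ?thesis unfolding r by (simp add: q0)
    qed
    define qq where "qq i = wn h i" for i
    have qq0: "qq i \<ge> 0" for i unfolding qq_def by (rule opt(3))
    have qqsq: "(qq i)\<^sup>2 = bil (minv (Hm h)) (feat h i) (feat h i)" for i unfolding qq_def by (rule opt(4))
    have tge: "p ?w' 0 * (\<Sum>i\<in>?S. p ?w' i * (qq i)\<^sup>2) \<le> t'"
      unfolding qqsq t'_def by (rule tau_ge[OF A w'c])
    have pw': "p ?w' i > 0" if "i \<in> Y" for i by (rule p_pos[OF w'c that])
    have inY: "i \<in> Y" if "i \<in> ?S" for i using that by (simp add: Y_def)
    have qqle: "(qq i)\<^sup>2 \<le> t' / \<kappa>" if i: "i \<in> ?S" for i
    proof -
      have "\<kappa> * (qq i)\<^sup>2 \<le> p ?w' i * p ?w' 0 * (qq i)\<^sup>2"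
        using curv[OF offer_assort i w'] by (intro mult_right_mono) auto
      also have "\<dots> = p ?w' 0 * (p ?w' i * (qq i)\<^sup>2)" by simp
      also have "\<dots> \<le> p ?w' 0 * (\<Sum>i\<in>?S. p ?w' i * (qq i)\<^sup>2)"
        using i finS pw' inY by (intro mult_left_mono member_le_sum) (auto simp: less_imp_le)
      finally show ?thesis using tge \<kappa> by (simp add: field_simps)
    qed
    have e: "0 \<le> e i" "e i \<le> 2 * beta h * qq i" for i
      using opt(1,2)[of i] by (auto simp: e_def qq_def)
    define M where "M = 2 * beta h * sqrt (t' / \<kappa>)"
    have eM: "e i \<le> M" if "i \<in> ?S" for i
    proof -
      have "qq i \<le> sqrt (t' / \<kappa>)" using qqle[OF that] by (rule real_le_rsqrt)
      then show ?thesis using e(2)[of i] b0 unfolding M_def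
        by (smt (verit) mult_left_mono mult_nonneg_nonneg)
    qed
    have r3: "inst_regret h \<le> q 0 * (\<Sum>i\<in>?S. q i * e i) + M\<^sup>2"
      using r1 revenue_gain[OF finS _ qpos[OF Y0] qsum e(1) eM] qpos inY
      unfolding r2 by (fastforce simp: less_imp_le)
    have M2: "M\<^sup>2 = 4 * (beta h)\<^sup>2 * t' / \<kappa>"
      using t0 \<kappa> by (simp add: M_def power_mult_distrib)
    \<comment> \<open>\<open>6561 = 81\<^sup>2\<close>: the logits at \<open>ws\<close> and at
      \<open>?w'\<close> differ by at most 2, so each of the two probabilities changes at most by
      the factor \<open>exp 4 \<le> 81\<close>.\<close>
    have prod: "q 0 * q i \<le> 6561 * (p ?w' 0 * p ?w' i)" if "i \<in> ?S" for i
    proof -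
      have one: "p ws i \<le> exp 4 * p ?w' i" if i: "i \<in> Y" for i
      proof -
        have n: "- 2 \<le> f j \<bullet> (ws - ?w') \<and> f j \<bullet> (ws - ?w') \<le> 2" for j
          using f_dot_ball[OF ws, of j] f_dot_ball[OF w', of j] wsc w'c
          by (auto simp: scalar_prod_minus_distrib[of _ d] abs_le_iff)
        let ?Z = "\<Sum>j\<in>Y. p ?w' j * exp (f j \<bullet> (ws - ?w'))"
        have "(\<Sum>j\<in>Y. p ?w' j * exp (- 2)) \<le> ?Z"
          using n pw' by (intro sum_mono mult_left_mono) (auto simp: less_imp_le)
        then have Z: "exp (- 2) \<le> ?Z" using p_sum[OF w'c] by (simp flip: sum_distrib_right)
        have "p ws i \<le> p ?w' i * exp 2 / exp (- 2)"
          unfolding p_tilt[OF w'c wsc i] using Z n pw'[OF i] by (intro frac_le mult_left_mono) auto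
        also have "\<dots> = p ?w' i * exp (2 + 2)" by (simp only: exp_add exp_minus) (simp add: field_simps)
        finally show ?thesis by (simp add: mult.commute)
      qed
      have "exp (4::real) \<le> 81"
      proof -
        have "exp (4::real) = exp 1 ^ 4" by (simp flip: exp_of_nat_mult)
        also have "\<dots> \<le> 3 ^ 4" using exp_le by (intro power_mono) auto
        finally show ?thesis by simp
      qed
      then have "exp 4 * p ?w' j \<le> 81 * p ?w' j" if "j \<in> Y" for j
        using pw'[OF that] by (intro mult_right_mono) auto
      then have "p ws j \<le> 81 * p ?w' j" if "j \<in> Y" for j
        using order_trans[OF one[OF that]] that by blast
      then have "q 0 * q i \<le> (81 * p ?w' 0) * (81 * p ?w' i)"
        unfolding q_def using inY[OF that] p_pos[OF wsc] pw' by (intro mult_mono) (auto simp: less_imp_le)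
      then show ?thesis by simp
    qed
    \<comment> \<open>Each item weight lies in \<open>[1/3, 3]\<close>, which costs a factor 3 in
      the numerator and 9 in the squared denominator.\<close>
    have q0q: "q 0 * (\<Sum>i\<in>?S. q i) \<le> 27 * Bd"
    proof -
      have ui: "1 / 3 \<le> exp (?u i) \<and> exp (?u i) \<le> 3" if "i \<in> ?S" for i
      proof -
        have b: "- 1 \<le> ?u i \<and> ?u i \<le> 1" using f_dot_ball[OF ws, of i] that by (simp add: f_item abs_le_iff)
        have "exp (?u i) \<le> exp 1" "exp (- 1) \<le> exp (?u i)" using b by auto
        moreover have "1 / 3 \<le> exp (- 1 :: real)" using exp_le by (simp add: exp_minus field_simps)
        ultimately show ?thesis using exp_le by linarith
      qed
      have VK: "real K / 3 \<le> V ?S" "V ?S \<le> real K * 3"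
      proof -
        have "(\<Sum>i\<in>?S. 1 / 3) \<le> V ?S" unfolding V_def using ui by (intro sum_mono) auto
        then show "real K / 3 \<le> V ?S" by (simp add: card)
        have "V ?S \<le> (\<Sum>i\<in>?S. 3)" unfolding V_def using ui by (intro sum_mono) auto
        then show "V ?S \<le> real K * 3" by (simp add: card)
      qed
      have "q 0 * (\<Sum>i\<in>?S. q i) = v0 * V ?S / (v0 + V ?S)\<^sup>2"
        unfolding q0 by (simp add: q V_def sum_divide_distrib[symmetric] power2_eq_square)
      also have "\<dots> \<le> v0 * (real K * 3) / ((v0 + real K) / 3)\<^sup>2"
        using v0 VK K by (intro frac_le mult_left_mono power_mono) auto
      also have "\<dots> = 27 * Bd" by (simp add: Bd_def power2_eq_square)
      finally show ?thesis .
    qed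
    have "q 0 * (\<Sum>i\<in>?S. q i * e i) = (\<Sum>i\<in>?S. (q 0 * q i) * e i)" by (simp add: sum_distrib_left mult.assoc)
    also have "\<dots> \<le> (\<Sum>i\<in>?S. beta h * (\<theta> * (q 0 * q i) + 6561 * (p ?w' 0 * (p ?w' i * (qq i)\<^sup>2)) / \<theta>))"
    proof (intro sum_mono)
      fix i assume i: "i \<in> ?S"
      have qi: "q 0 * q i \<ge> 0" using qpos[OF Y0] qpos[OF inY[OF i]] by simp
      \<comment> \<open>Young's inequality with the fixed weight: summed with the weights
        \<open>q 0 * q i\<close>, the first part is controlled by \<open>q0q\<close>, the second by
        \<open>prod\<close> and \<open>tge\<close>.\<close>
      have "2 * qq i \<le> \<theta> + (qq i)\<^sup>2 / \<theta>"
      proof -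
        have "0 \<le> (\<theta> - qq i)\<^sup>2" by simp
        then show ?thesis using th by (simp add: power2_eq_square field_simps)
      qed
      then have "beta h * (2 * qq i) \<le> beta h * (\<theta> + (qq i)\<^sup>2 / \<theta>)" using b0 by (intro mult_left_mono)
      then have "e i \<le> beta h * (\<theta> + (qq i)\<^sup>2 / \<theta>)" using e(2)[of i] by linarith
      then have "(q 0 * q i) * e i \<le> (q 0 * q i) * (beta h * (\<theta> + (qq i)\<^sup>2 / \<theta>))"
        using qi by (intro mult_left_mono)
      also have "\<dots> = beta h * (\<theta> * (q 0 * q i) + (q 0 * q i) * ((qq i)\<^sup>2 / \<theta>))" by (simp add: algebra_simps)
      also have "\<dots> \<le> beta h * (\<theta> * (q 0 * q i) + (6561 * (p ?w' 0 * p ?w' i)) * ((qq i)\<^sup>2 / \<theta>))"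
        using prod[OF i] b0 th by (intro mult_left_mono add_left_mono mult_right_mono) auto
      finally show "(q 0 * q i) * e i \<le> beta h * (\<theta> * (q 0 * q i) + 6561 * (p ?w' 0 * (p ?w' i * (qq i)\<^sup>2)) / \<theta>)"
        by (simp add: mult.assoc)
    qed
    also have "\<dots> = beta h * (\<theta> * (q 0 * (\<Sum>i\<in>?S. q i)) + 6561 * (p ?w' 0 * (\<Sum>i\<in>?S. p ?w' i * (qq i)\<^sup>2)) / \<theta>)"
      by (simp add: sum_distrib_left sum.distrib sum_divide_distrib distrib_left)
    also have "\<dots> \<le> beta h * (\<theta> * (27 * Bd) + 6561 * t' / \<theta>)"
      using b0 th q0q tge by (intro mult_left_mono add_mono divide_right_mono) auto
    finally show ?thesis using r3 M2 by (simp add: mult_ac)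
  qed
qed

text \<open>The variance terms telescope in \<open>D\<close>. The constants round up
  \<open>6561 * 11/10\<close> and \<open>4 * 11/10\<close>, the factor \<open>11/10\<close> being
  that of \<open>D_Cons\<close>; the uniform bound \<open>b\<close> on the radii keeps the
  coefficients the same in every round.\<close>

lemma regret_le:
  assumes "valid h" "lrp h < 1 / \<delta>" and b: "\<And>t. t \<le> length h \<Longrightarrow> ofu_beta d K \<delta> t \<le> b" and th: "\<theta> > 0"
  shows "regret v0 N K x ws h \<le> real (length h) * (27 * b * Bd * \<theta>) + (7218 * b / \<theta> + 5 * b\<^sup>2 / \<kappa>) * D h"
  using assms(1-3)
proof (induction h)
  case Nil
  then show ?case by (simp add: D_Nil)
next
  case (Cons e h)
  then obtain y where e: "e = (offer h, y)" and v: "valid h" and y: "y \<in> insert 0 (offer h)"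
    by (metis valid_Cons)
  have small: "lrp h < 1 / \<delta>" using Cons.prems(2) by (auto split: if_splits)
  have IH: "regret v0 N K x ws h \<le> real (length h) * (27 * b * Bd * \<theta>) + (7218 * b / \<theta> + 5 * b\<^sup>2 / \<kappa>) * D h"
    using Cons.IH[OF v small] Cons.prems(3) by simp
  let ?t = "tauh h (est ((offer h, y) # h))"
  have t: "0 \<le> ?t" "?t \<le> 11 / 10 * (D (e # h) - D h)" using D_Cons[OF v y] by (auto simp: e)
  have bb: "beta h \<le> b" "0 \<le> beta h" using Cons.prems(3)[of "Suc (length h)"] beta_nonneg by auto
  have "inst_regret h \<le> beta h * (27 * Bd * \<theta> + 6561 * ?t / \<theta>) + 4 * (beta h)\<^sup>2 * ?t / \<kappa>"
    by (rule inst_regret_le[OF v small y th])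
  also have "\<dots> \<le> b * (27 * Bd * \<theta> + 6561 * ?t / \<theta>) + 4 * b\<^sup>2 * ?t / \<kappa>"
    using bb t th \<kappa> Bd_pos
    by (intro add_mono mult_right_mono divide_right_mono mult_left_mono power_mono add_nonneg_nonneg) auto
  also have "\<dots> = 27 * b * Bd * \<theta> + (6561 * b / \<theta> + 4 * b\<^sup>2 / \<kappa>) * ?t"
    by (simp add: distrib_left distrib_right mult.commute mult.left_commute)
  also have "\<dots> \<le> 27 * b * Bd * \<theta> + (6561 * b / \<theta> + 4 * b\<^sup>2 / \<kappa>) * (11 / 10 * (D (e # h) - D h))"
    using bb t th \<kappa> by (intro add_left_mono mult_left_mono add_nonneg_nonneg divide_nonneg_nonneg) auto
  also have "\<dots> \<le> 27 * b * Bd * \<theta> + (7218 * b / \<theta> + 5 * b\<^sup>2 / \<kappa>) * (D (e # h) - D h)"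
  proof -
    have "D (e # h) - D h \<ge> 0" using t by simp
    moreover have "(6561 * b / \<theta> + 4 * b\<^sup>2 / \<kappa>) * (11 / 10) \<le> 7218 * b / \<theta> + 5 * b\<^sup>2 / \<kappa>"
    proof -
      have "0 \<le> b / \<theta>" "0 \<le> b\<^sup>2 / \<kappa>" using bb th \<kappa> by auto
      then show ?thesis by (simp add: distrib_right)
    qed
    ultimately have "(6561 * b / \<theta> + 4 * b\<^sup>2 / \<kappa>) * (11 / 10) * (D (e # h) - D h)
       \<le> (7218 * b / \<theta> + 5 * b\<^sup>2 / \<kappa>) * (D (e # h) - D h)" by (intro mult_right_mono)
    then show ?thesis by (simp only: mult.assoc add_le_cancel_left)
  qed
  finally have "inst_regret h \<le> 27 * b * Bd * \<theta> + (7218 * b / \<theta> + 5 * b\<^sup>2 / \<kappa>) * (D (e # h) - D h)" .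
  moreover have "regret v0 N K x ws (e # h) = regret v0 N K x ws h + inst_regret h"
    by (simp add: e)
  moreover have "real (length (e # h)) * (27 * b * Bd * \<theta>)
      = real (length h) * (27 * b * Bd * \<theta>) + 27 * b * Bd * \<theta>"
    by (simp add: distrib_right)
  moreover have "(7218 * b / \<theta> + 5 * b\<^sup>2 / \<kappa>) * (D (e # h) - D h)
      = (7218 * b / \<theta> + 5 * b\<^sup>2 / \<kappa>) * D (e # h) - (7218 * b / \<theta> + 5 * b\<^sup>2 / \<kappa>) * D h"
    by (rule right_diff_distrib)
  ultimately show ?case using IH by linarith
qed

end

section \<open>The maximal inequality and the final bound\<close>

context ofu_run
begin

abbreviation hp :: "nat \<Rightarrow> hist pmf" where "hp n \<equiv> hist_pmf v0 d K \<delta> x sel w1 ws n"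

lemma pmf_mnl:
  assumes S: "S \<in> assortments N K"
  shows "pmf (mnl_pmf v0 (feat h) S ws) y = mnl_prob v0 (feat h) S ws y"
    "set_pmf (mnl_pmf v0 (feat h) S ws) \<subseteq> insert 0 S"
proof -
  interpret mnl_round v0 d "feat h" S by (rule round[OF S])
  note wsc = param_ballD(1)[OF ws]
  have out: "p ws i = 0" if "i \<notin> Y" for i using that by (auto simp: mnl_prob_def Y_def)
  have nn: "0 \<le> p ws i" for i using out[of i] p_pos[OF wsc, of i] by (cases "i \<in> Y") auto
  have "(\<integral>\<^sup>+i. ennreal (p ws i) \<partial>count_space UNIV) = (\<Sum>i\<in>Y. ennreal (p ws i))"
    by (rule nn_integral_count_space') (auto simp: out)
  also have "\<dots> = ennreal (\<Sum>i\<in>Y. p ws i)" using nn by (rule sum_ennreal)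
  finally have one: "(\<integral>\<^sup>+i. ennreal (p ws i) \<partial>count_space UNIV) = 1" by (simp add: p_sum[OF wsc])
  show 1: "pmf (mnl_pmf v0 (feat h) S ws) y = p ws y" for y
    unfolding mnl_pmf_def using nn one by (rule pmf_embed_pmf)
  show "set_pmf (mnl_pmf v0 (feat h) S ws) \<subseteq> insert 0 S"
  proof
    fix y assume "y \<in> set_pmf (mnl_pmf v0 (feat h) S ws)"
    then have "p ws y \<noteq> 0" using 1[of y] by (simp add: set_pmf_iff)
    then have "y \<in> Y" using out[of y] by blast
    then show "y \<in> insert 0 S" by (simp only: Y_def)
  qed
qed

lemma hist_support: "h \<in> set_pmf (hp n) \<Longrightarrow> valid h \<and> length h = n"
proof (induction n arbitrary: h)
  case 0
  then show ?case by simp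
next
  case (Suc n)
  then obtain h' y where h': "h' \<in> set_pmf (hp n)"
    and y: "y \<in> set_pmf (mnl_pmf v0 (feat h') (offer h') ws)" and h: "h = (offer h', y) # h'"
    by (auto simp: Let_def)
  have "y \<in> insert 0 (offer h')" using pmf_mnl(2)[OF offer_assort] y by (rule subsetD)
  then show ?case using Suc.IH[OF h'] h by simp
qed

text \<open>Above the threshold the process is frozen, below it \<open>lr_supermartingale\<close>
  controls the next factor; either way the conditional mean does not increase.\<close>

lemma lrp_expectation: "(\<integral>\<^sup>+h. ennreal (lrp h) \<partial>measure_pmf (hp n)) \<le> 1"
proof (induction n)
  case 0
  then show ?case by simp
next
  case (Suc n)
  have step: "(\<integral>\<^sup>+y. ennreal (lrp ((offer h, y) # h)) \<partial>measure_pmf (mnl_pmf v0 (feat h) (offer h) ws)) \<le> ennreal (lrp h)"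
    if h: "valid h" for h
  proof (cases "lrp h \<ge> 1 / \<delta>")
    case True
    then show ?thesis by simp
  next
    case False
    let ?S = "offer h"
    interpret mnl_round v0 d "feat h" ?S by (rule round[OF offer_assort])
    have nn: "0 \<le> lrp h * (p ws y * lr h y)" if "y \<in> insert 0 ?S" for y
      using lrp_pos[of h] lr_pos[of h y] p_pos[OF param_ballD(1)[OF ws], of y] that by (simp add: Y_def)
    have "(\<integral>\<^sup>+y. ennreal (lrp ((offer h, y) # h)) \<partial>measure_pmf (mnl_pmf v0 (feat h) ?S ws))
       = (\<Sum>y\<in>insert 0 ?S. ennreal (lrp ((offer h, y) # h)) * ennreal (pmf (mnl_pmf v0 (feat h) ?S ws) y))"
      using finS by (intro nn_integral_measure_pmf_support) (auto dest: subsetD[OF pmf_mnl(2)[OF offer_assort]])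
    also have "\<dots> = (\<Sum>y\<in>insert 0 ?S. ennreal (lrp h * lr h y) * ennreal (p ws y))"
      using False by (simp add: pmf_mnl(1)[OF offer_assort])
    also have "\<dots> = (\<Sum>y\<in>insert 0 ?S. ennreal (lrp h * (p ws y * lr h y)))"
      using lrp_pos[of h] lr_pos p_pos[OF param_ballD(1)[OF ws]]
      by (intro sum.cong refl) (auto simp: Y_def mult_ac less_imp_le simp flip: ennreal_mult)
    also have "\<dots> = ennreal (lrp h * (\<Sum>y\<in>insert 0 ?S. p ws y * lr h y))"
      unfolding sum_distrib_left using nn by (rule sum_ennreal)
    also have "\<dots> \<le> ennreal (lrp h * 1)"
      using lr_supermartingale[OF h] lrp_pos[of h] by (intro ennreal_leI mult_left_mono) auto
    finally show ?thesis by simp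
  qed
  have "(\<integral>\<^sup>+h. ennreal (lrp h) \<partial>measure_pmf (hp (Suc n)))
     = (\<integral>\<^sup>+h. (\<integral>\<^sup>+y. ennreal (lrp ((offer h, y) # h)) \<partial>measure_pmf (mnl_pmf v0 (feat h) (offer h) ws)) \<partial>measure_pmf (hp n))"
    by (simp add: Let_def)
  also have "\<dots> \<le> (\<integral>\<^sup>+h. ennreal (lrp h) \<partial>measure_pmf (hp n))"
    using step hist_support by (intro nn_integral_mono_AE) (auto simp: AE_measure_pmf_iff)
  finally show ?case using Suc.IH by (rule order_trans)
qed

text \<open>Markov's inequality at the last time only. As the process stays frozen once it has
  reached \<open>1 / \<delta>\<close>, this covers all earlier times as well.\<close>

lemma good_event: "measure_pmf.prob (hp n) {h. lrp h < 1 / \<delta>} \<ge> 1 - \<delta>"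
proof -
  let ?A = "{h. 1 / \<delta> \<le> lrp h}"
  have "ennreal (1 / \<delta>) * emeasure (hp n) ?A = (\<integral>\<^sup>+h. ennreal (1 / \<delta>) * indicator ?A h \<partial>measure_pmf (hp n))"
    by (subst nn_integral_cmult_indicator) auto
  also have "\<dots> \<le> (\<integral>\<^sup>+h. ennreal (lrp h) \<partial>measure_pmf (hp n))"
    by (intro nn_integral_mono) (auto split: split_indicator intro: ennreal_leI)
  also have "\<dots> \<le> 1" by (rule lrp_expectation)
  finally have "ennreal (1 / \<delta>) * emeasure (hp n) ?A \<le> 1" .
  moreover have "ennreal (1 / \<delta> * measure_pmf.prob (hp n) ?A) = ennreal (1 / \<delta>) * emeasure (hp n) ?A"
    unfolding measure_pmf.emeasure_eq_measure by (rule ennreal_mult) (use \<delta> in auto)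
  ultimately have "ennreal (1 / \<delta> * measure_pmf.prob (hp n) ?A) \<le> ennreal 1" by simp
  then have "1 / \<delta> * measure_pmf.prob (hp n) ?A \<le> 1" by (subst (asm) ennreal_le_iff) auto
  then have "measure_pmf.prob (hp n) ?A \<le> \<delta>" using \<delta> by (simp add: divide_le_eq)
  moreover have "?A = UNIV - {h. lrp h < 1 / \<delta>}" by auto
  ultimately show ?thesis using measure_pmf.prob_compl[of "{h. lrp h < 1 / \<delta>}" "hp n"] by simp
qed

section \<open>Logarithmic factors and final constants\<close>

definition Lg :: "nat \<Rightarrow> real" where "Lg T = ln (exp 1 + real T * real K * real d / \<delta>)"

lemma Lg_bounds:
  assumes T: "T \<ge> 1"
  shows "Lg T \<ge> 1" "ln (real K + 1) \<le> Lg T" "ln (real T + 1) \<le> Lg T"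
    "ln (real T / \<delta>) \<le> Lg T" "ln (real T * real K) \<le> Lg T"
proof -
  let ?q = "real T * real K * real d / \<delta>"
  have r: "real T \<ge> 1" "real K \<ge> 1" "real d \<ge> 1" "1 / \<delta> \<ge> 1" using T K d \<delta> by auto
  have TK: "real T * real K \<ge> real T" "real T * real K \<ge> real K" using r by auto
  have TK1: "real T * real K \<ge> 1" using TK r by linarith
  have "real T * real K * 1 \<le> real T * real K * real d"
    using r by (intro mult_left_mono) auto
  then have q: "real T * real K / \<delta> \<le> ?q" using \<delta> by (intro divide_right_mono) auto
  have q1: "real T * real K \<le> real T * real K / \<delta>"
    using TK1 r(4) mult_left_mono[of 1 "1 / \<delta>" "real T * real K"] by simp
  have q2: "real T / \<delta> \<le> real T * real K / \<delta>" using TK \<delta> by (intro divide_right_mono) auto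
  have e: "1 \<le> exp (1::real)" by simp
  have mono: "ln a \<le> Lg T" if "0 < a" "a \<le> exp 1 + ?q" for a unfolding Lg_def using that by (intro ln_mono)
  have T0: "0 < real T / \<delta>" using r \<delta> by (intro divide_pos_pos) linarith+
  show "Lg T \<ge> 1" using mono[of "exp 1"] q q1 TK1 by simp
  show "ln (real K + 1) \<le> Lg T" by (rule mono) (use TK q q1 e r in linarith)+
  show "ln (real T + 1) \<le> Lg T" by (rule mono) (use TK q q1 e r in linarith)+
  show "ln (real T / \<delta>) \<le> Lg T" by (rule mono) (use T0 q q2 e in linarith)+
  show "ln (real T * real K) \<le> Lg T" by (rule mono) (use TK1 q q1 e in linarith)+
qed

text \<open>With \<open>L = Lg T\<close>, \<open>\<eta>\<close> is at most \<open>5/2 * L\<close>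
  and the logarithms in the radius are at most \<open>3 * L\<close>. The radicand is then at most
  \<open>3295 * d * L ^ 4\<close>, rounded up to the square \<open>3481 = 59\<^sup>2\<close>; the
  summand in front of the root is at most 1, which makes 60.\<close>

lemma beta_le:
  assumes T: "T \<ge> 1" and t: "t \<le> T"
  shows "ofu_beta d K \<delta> t \<le> 60 * sqrt (real d) * (Lg T)\<^sup>2"
proof -
  define L where "L = Lg T"
  note Lb = Lg_bounds[OF T, folded L_def]
  have L1: "L \<ge> 1" by (rule Lb(1))
  have r: "real T \<ge> 1" "real K \<ge> 1" "real d \<ge> 1" "1 / \<delta> \<ge> 1" "real t \<le> real T" using T K d \<delta> t by auto
  have L2: "L \<le> L\<^sup>2" "1 \<le> L\<^sup>2" using L1 mult_mono[of 1 L 1 L] mult_left_mono[of 1 L L] by (auto simp: power2_eq_square)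
  have eta_le: "\<eta> \<le> 5 / 2 * L" unfolding ofu_eta_def using Lb(2) L1 by simp
  have lam_le: "l \<le> 315 * real d * L"
  proof -
    have "sqrt 2 \<le> sqrt ((3 / 2)\<^sup>2)" by (intro real_sqrt_le_mono) (simp add: power2_eq_square)
    then have "84 * sqrt 2 * real d * \<eta> \<le> 84 * (3 / 2) * real d * (5 / 2 * L)"
      using eta eta_le by (intro mult_mono) auto
    then show ?thesis by (simp add: ofu_lambda_def)
  qed
  have ln6: "ln 6 \<le> (2 :: real)" and ln3: "ln 3 \<le> (2 :: real)"
  proof -
    have "5 / 2 \<le> exp (1::real)" using exp_lower_Taylor_quadratic[of "1 :: real"] by simp
    then have "(5 / 2) * (5 / 2) \<le> exp 1 * exp (1::real)" by (intro mult_mono) auto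
    also have "\<dots> = exp 2" by (simp flip: exp_add)
    finally have "ln (6::real) \<le> ln (exp 2)" by (intro ln_mono) auto
    then show "ln 6 \<le> (2 :: real)" by simp
    moreover have "ln (3::real) \<le> ln 6" by (intro ln_mono) auto
    ultimately show "ln 3 \<le> (2 :: real)" by linarith
  qed
  define f1 where "f1 = ln (1 + (real K + 1) * real t)"
  define f2 where "f2 = ln (2 * sqrt (1 + 2 * real t) / \<delta>)"
  define f3 where "f3 = ln (1 + (real t + 1) / (2 * l))"
  have TK: "real T * real K \<ge> real T" "real T * real K \<ge> 1"
    using mult_mono[of 1 "real T" 1 "real K"] r by auto
  have f1: "0 \<le> f1" "f1 \<le> 3 * L"
  proof -
    show "0 \<le> f1" unfolding f1_def by (intro ln_ge_zero) auto
    have "(real K + 1) * real t \<le> (real K + 1) * real T" using r by (intro mult_left_mono) auto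
    moreover have "(real K + 1) * real T = real T * real K + real T" by (simp add: algebra_simps)
    ultimately have "1 + (real K + 1) * real t \<le> 3 * (real T * real K)" using TK by linarith
    then have "f1 \<le> ln (3 * (real T * real K))" unfolding f1_def by (intro ln_mono) (auto intro: add_pos_nonneg)
    also have "\<dots> = ln 3 + ln (real T * real K)" using r by (simp add: ln_mult)
    finally show "f1 \<le> 3 * L" using ln3 Lb(5) L1 by linarith
  qed
  have f2: "0 \<le> f2" "f2 \<le> 3 * L"
  proof -
    have s: "1 \<le> sqrt (1 + 2 * real t)" by simp
    have "sqrt (1 + 2 * real t) \<le> 1 + 2 * real t" by (rule real_le_lsqrt) (auto simp: power2_eq_square)
    then have u: "2 * sqrt (1 + 2 * real t) \<le> 6 * real T" using r by linarith
    have "\<delta> \<le> 2 * sqrt (1 + 2 * real t)" using s \<delta> by linarith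
    then have "1 \<le> 2 * sqrt (1 + 2 * real t) / \<delta>" using \<delta> by (simp add: pos_le_divide_eq)
    then show "0 \<le> f2" unfolding f2_def by (rule ln_ge_zero)
    have "2 * sqrt (1 + 2 * real t) / \<delta> \<le> 6 * real T / \<delta>" using u \<delta> by (intro divide_right_mono) auto
    moreover have "0 < 2 * sqrt (1 + 2 * real t) / \<delta>" using s \<delta> by (intro divide_pos_pos) linarith+
    ultimately have "f2 \<le> ln (6 * real T / \<delta>)" unfolding f2_def by (intro ln_mono)
    also have "6 * real T / \<delta> = 6 * (real T / \<delta>)" by simp
    also have "ln (6 * (real T / \<delta>)) = ln 6 + ln (real T / \<delta>)" using r \<delta> by (intro ln_mult_pos) auto
    finally show "f2 \<le> 3 * L" using ln6 Lb(4) L1 by linarith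
  qed
  have f3: "0 \<le> f3" "f3 \<le> L"
  proof -
    have p: "0 \<le> (real t + 1) / (2 * l)" using lam by simp
    then show "0 \<le> f3" unfolding f3_def by (intro ln_ge_zero) linarith
    have "(real t + 1) / (2 * l) \<le> (real T + 1) / 400" using r lam by (intro frac_le) auto
    also have "\<dots> \<le> real T" using r by simp
    finally have "1 + (real t + 1) / (2 * l) \<le> real T + 1" by simp
    then have "f3 \<le> ln (real T + 1)" unfolding f3_def using p by (intro ln_mono) linarith+
    then show "f3 \<le> L" using Lb(3) by linarith
  qed
  define A where "A = 11 * (3 * f1 + 3) * f2"
  define B where "B = sqrt 6 * c * real d * f3"
  have A: "0 \<le> A" "A \<le> 396 * L\<^sup>2"
  proof -
    show "0 \<le> A" unfolding A_def using f1 f2 by (intro mult_nonneg_nonneg) auto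
    have "A \<le> (132 * L) * (3 * L)" unfolding A_def by (rule mult_mono) (use f1 f2 L1 in auto)
    then show "A \<le> 396 * L\<^sup>2" by (simp add: power2_eq_square)
  qed
  have B: "0 \<le> B" "B \<le> 9 * real d * L\<^sup>2"
  proof -
    show "0 \<le> B" unfolding B_def using f3 c_pos by (intro mult_nonneg_nonneg) auto
    have c: "c \<le> 3 * L" unfolding ofu_c_def using eta_le L1 by simp
    have "sqrt 6 \<le> 3" by (rule real_le_lsqrt) auto
    then have "B \<le> 3 * (3 * L) * real d * L"
      unfolding B_def using c f3 c_pos L1 by (intro mult_mono) auto
    then show "B \<le> 9 * real d * L\<^sup>2" by (simp add: power2_eq_square mult_ac)
  qed
  have dL: "L\<^sup>2 \<le> real d * L\<^sup>2" "1 \<le> real d * L\<^sup>2" "L \<le> L ^ 4" "L ^ 3 \<le> L ^ 4"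
    using r L2 L1 mult_mono[of 1 "real d" 1 "L\<^sup>2"] power_increasing[of 1 4 L] power_increasing[of 3 4 L]
    by (auto simp: mult_le_cancel_right1)
  have E: "0 \<le> A + 2 + B" "A + 2 + B \<le> 407 * (real d * L\<^sup>2)" using A B dL by auto
  have "2 * \<eta> * (A + 2 + B) \<le> (5 * L) * (407 * (real d * L\<^sup>2))"
    by (rule mult_mono) (use eta_le eta E L1 in auto)
  also have "\<dots> = 2035 * real d * L ^ 3" by (simp add: power2_eq_square power3_eq_cube)
  also have "\<dots> \<le> 2035 * real d * L ^ 4" using dL by (intro mult_left_mono) auto
  finally have m: "2 * \<eta> * (A + 2 + B) \<le> 2035 * real d * L ^ 4" .
  have "315 * real d * L \<le> 315 * real d * L ^ 4" using dL by (intro mult_left_mono) auto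
  then have "2 * \<eta> * (A + 2 + B) + 4 * l \<le> 3295 * real d * L ^ 4" using lam_le m by linarith
  also have "\<dots> \<le> 3481 * real d * L ^ 4" using L1 by (intro mult_right_mono) auto
  also have "\<dots> = (59 * sqrt (real d) * L\<^sup>2)\<^sup>2" by (simp add: power_mult_distrib flip: power_mult)
  finally have "sqrt (2 * \<eta> * (A + 2 + B) + 4 * l) \<le> 59 * sqrt (real d) * L\<^sup>2"
    using L1 by (intro real_le_lsqrt) auto
  moreover have "4 * \<eta> / l \<le> 1" using lam eta by (simp add: divide_le_eq)
  moreover have "1 \<le> sqrt (real d) * L\<^sup>2" using mult_mono[of 1 "sqrt (real d)" 1 "L\<^sup>2"] r L2 by simp
  moreover have "ofu_beta d K \<delta> t = 4 * \<eta> / l + sqrt (2 * \<eta> * (A + 2 + B) + 4 * l)"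
    by (simp add: ofu_beta_def A_def B_def f1_def f2_def f3_def)
  ultimately show ?thesis by (simp add: L_def)
qed

lemma regret_bound:
  assumes h: "valid h" "lrp h < 1 / \<delta>" and T: "length h = T"
  shows "regret v0 N K x ws h \<le> 1000000 * Lg T ^ 5 *
    (sqrt (v0 * real K) / (v0 + real K) * real d * sqrt (real T) + (real d)\<^sup>2 / \<kappa>)"
\<comment> \<open>\<open>Lg_bounds\<close> needs at least one round; with none the regret is
  0.\<close>
proof (cases "T = 0")
  case True
  then have "regret v0 N K x ws h = 0" using T by simp
  moreover have "Lg 0 \<ge> 0" by (simp add: Lg_def)
  ultimately show ?thesis using True v0 \<kappa> by simp
next
  case False
  then have T1: "T \<ge> 1" by simp
  define L where "L = Lg T"
  note Lb = Lg_bounds[OF T1, folded L_def]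
  have L1: "L \<ge> 1" by (rule Lb(1))
  have r: "real T \<ge> 1" "real K \<ge> 1" "real d \<ge> 1" using T1 K d by auto
  define b where "b = 60 * sqrt (real d) * L\<^sup>2"
  have b0: "b \<ge> 0" by (simp add: b_def)
  \<comment> \<open>\<open>s * s\<close> bounds \<open>D h\<close> and \<open>z * z\<close> is
    \<open>Bd * T\<close>. The Young weight \<open>s / z\<close> balances the two contributions,
    since \<open>T * Bd * (s / z)\<close> and \<open>s * s / (s / z)\<close> both equal
    \<open>s * z\<close>; the root of \<open>Bd\<close> in \<open>z\<close> is the factor
    \<open>sqrt (v0 * K) / (v0 + K)\<close>.\<close>
  define s where "s = sqrt (real d * L)"
  define z where "z = sqrt (Bd * real T)"
  have s0: "s > 0" and z0: "z > 0" using r L1 Bd_pos by (auto simp: s_def z_def)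
  have s2: "s * s = real d * L" and z2: "z * z = Bd * real T"
    using r L1 Bd_pos by (auto simp: s_def z_def)
  have D: "D h \<le> s * s"
  proof -
    have "real T / l \<le> real T" using lam r by (simp add: divide_le_eq mult_le_cancel_left1)
    then have "1 + real T / l \<le> real T + 1" by simp
    moreover have "0 < 1 + real T / l" using lam by (simp add: add_pos_nonneg)
    ultimately have "ln (1 + real T / l) \<le> ln (real T + 1)" by (intro ln_mono)
    then have "real d * ln (1 + real T / l) \<le> real d * L" using Lb(3) by (intro mult_left_mono) auto
    then show ?thesis using D_le[OF h(1)] T s2 by simp
  qed
  have "regret v0 N K x ws h \<le> real T * (27 * b * Bd * (s / z)) + (7218 * b / (s / z) + 5 * b\<^sup>2 / \<kappa>) * D h"
    using regret_le[OF h, of b "s / z"] beta_le[OF T1] T s0 z0 by (simp add: b_def L_def)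
  also have "\<dots> \<le> real T * (27 * b * Bd * (s / z)) + (7218 * b / (s / z) + 5 * b\<^sup>2 / \<kappa>) * (s * s)"
    using D b0 s0 z0 \<kappa> by (intro add_left_mono mult_left_mono add_nonneg_nonneg divide_nonneg_nonneg) auto
  also have "real T * (27 * b * Bd * (s / z)) = 27 * b * s * (z * z) / z" by (simp add: z2)
  also have "\<dots> = 27 * b * s * z" using z0 by simp
  also have "27 * b * s * z + (7218 * b / (s / z) + 5 * b\<^sup>2 / \<kappa>) * (s * s) = 7245 * (b * s * z) + 5 * b\<^sup>2 * (s * s) / \<kappa>"
    using s0 by (simp add: distrib_right)
  also have "\<dots> \<le> 1000000 * L ^ 5 * (sqrt (v0 * real K) / (v0 + real K) * real d * sqrt (real T) + (real d)\<^sup>2 / \<kappa>)"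
  proof -
    define W where "W = sqrt (v0 * real K) / (v0 + real K) * sqrt (real T)"
    have zW: "z = W"
    proof -
      have "sqrt Bd = sqrt (v0 * real K) / (v0 + real K)"
        unfolding Bd_def using v0 by (simp add: real_sqrt_divide)
      then show ?thesis by (simp add: z_def W_def real_sqrt_mult)
    qed
    have "sqrt (real d) * s = real d * sqrt L" unfolding s_def by (simp add: real_sqrt_mult)
    then have "b * s * z = 60 * L\<^sup>2 * (real d * sqrt L) * W" unfolding b_def zW by (simp add: mult_ac)
    also have "\<dots> \<le> 60 * L\<^sup>2 * (real d * L) * W"
    proof -
      have "sqrt L \<le> L" using L1 by (intro real_le_lsqrt) (auto simp: power2_eq_square mult_le_cancel_left1)
      then show ?thesis using z0 zW by (intro mult_right_mono mult_left_mono) auto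
    qed
    also have "\<dots> = 60 * L ^ 3 * (real d * W)" by (simp add: power2_eq_square power3_eq_cube mult_ac)
    also have "\<dots> \<le> 60 * L ^ 5 * (real d * W)"
      using z0 zW L1 by (intro mult_right_mono mult_left_mono power_increasing) auto
    finally have 1: "b * s * z \<le> 60 * L ^ 5 * (real d * W)" .
    \<comment> \<open>Origin of the exponent 5: \<open>b\<^sup>2\<close> has degree 4 in
      \<open>L\<close> and \<open>s * s\<close> has degree 1. The leading term was bounded with
      degree 3 and then raised to match.\<close>
    have 2: "5 * b\<^sup>2 * (s * s) / \<kappa> = 18000 * L ^ 5 * ((real d)\<^sup>2 / \<kappa>)"
      unfolding b_def s2 by (simp add: power_mult_distrib power2_eq_square eval_nat_numeral)
    have 3: "0 \<le> L ^ 5 * (real d * W)" "0 \<le> L ^ 5 * ((real d)\<^sup>2 / \<kappa>)"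
      using L1 z0 zW \<kappa> by auto
    have "7245 * (b * s * z) + 5 * b\<^sup>2 * (s * s) / \<kappa>
      \<le> 1000000 * (L ^ 5 * (real d * W)) + 1000000 * (L ^ 5 * ((real d)\<^sup>2 / \<kappa>))"
    proof -
      have "18000 * L ^ 5 * ((real d)\<^sup>2 / \<kappa>) = 18000 * (L ^ 5 * ((real d)\<^sup>2 / \<kappa>))"
        "60 * L ^ 5 * (real d * W) = 60 * (L ^ 5 * (real d * W))" by (simp_all only: mult.assoc)
      then show ?thesis using 1 2 3 by linarith
    qed
    also have "\<dots> = 1000000 * L ^ 5 * (sqrt (v0 * real K) / (v0 + real K) * real d * sqrt (real T) + (real d)\<^sup>2 / \<kappa>)"
      by (simp add: W_def distrib_left mult_ac)
    finally show ?thesis .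
  qed
  finally show ?thesis by (simp add: L_def)
qed

lemma regret_high_probability:
  "measure_pmf.prob (hp T) {h. regret v0 N K x ws h \<le> 1000000 * Lg T ^ 5 *
    (sqrt (v0 * real K) / (v0 + real K) * real d * sqrt (real T) + (real d)\<^sup>2 / \<kappa>)} \<ge> 1 - \<delta>"
proof -
  have "measure_pmf.prob (hp T) {h. lrp h < 1 / \<delta>} \<le> measure_pmf.prob (hp T)
    {h. regret v0 N K x ws h \<le> 1000000 * Lg T ^ 5 *
    (sqrt (v0 * real K) / (v0 + real K) * real d * sqrt (real T) + (real d)\<^sup>2 / \<kappa>)}"
    by (rule measure_pmf.finite_measure_mono_AE)
      (use hist_support regret_bound in \<open>auto simp: AE_measure_pmf_iff\<close>)
  then show ?thesis using good_event[of T] by linarith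
qed

end
theorem theorem2:
  shows "\<exists>C > 0. \<exists>p::nat. \<forall>(v0::real) (N::nat) (K::nat) (d::nat)
      (x :: nat \<Rightarrow> hist \<Rightarrow> nat \<Rightarrow> real vec)
      (sel :: nat \<Rightarrow> hist \<Rightarrow> (nat \<Rightarrow> real) \<Rightarrow> nat set)
      (w1::real vec) (wstar::real vec) (\<kappa>::real) (\<delta>::real) (T::nat).
    v0 > 0 \<longrightarrow> K \<ge> 1 \<longrightarrow> d \<ge> 1 \<longrightarrow>
    (\<forall>t h i. x t h i \<in> carrier_vec d \<and> vnorm (x t h i) \<le> 1) \<longrightarrow>
    wstar \<in> param_ball d \<longrightarrow> w1 \<in> param_ball d \<longrightarrow>
    \<kappa> > 0 \<longrightarrow>
    (\<forall>t h S i w. S \<in> assortments N K \<longrightarrow> i \<in> S \<longrightarrow> w \<in> param_ball d \<longrightarrow>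
        mnl_prob v0 (x t h) S w i * mnl_prob v0 (x t h) S w 0 \<ge> \<kappa>) \<longrightarrow>
    (\<forall>t h \<alpha>. sel t h \<alpha> \<in> opt_argmax v0 N K \<alpha>) \<longrightarrow>
    0 < \<delta> \<longrightarrow> \<delta> \<le> 1 \<longrightarrow>
    measure_pmf.prob (hist_pmf v0 d K \<delta> x sel w1 wstar T)
      {h. regret v0 N K x wstar h \<le>
            C * (ln (exp 1 + real T * real K * real d / \<delta>)) ^ p *
            (sqrt (v0 * real K) / (v0 + real K) * real d * sqrt (real T) + (real d)\<^sup>2 / \<kappa>)}
      \<ge> 1 - \<delta>"
\<comment> \<open>The witnesses are the constant and the exponent of \<open>regret_bound\<close>;
  neither depends on the instance, so they can be fixed before all other quantifiers.\<close>
proof (intro exI[of _ "1000000::real"] conjI exI[of _ "5::nat"] allI impI, goal_cases)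
  case (2 v0 N K d x sel w1 wstar \<kappa> \<delta> T)
  interpret ofu_run v0 N K d x sel w1 wstar \<kappa> \<delta>
    using 2 by unfold_locales blast+
  show ?case using regret_high_probability[of T] by (simp add: Lg_def)
qed simp

end
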